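(* Let $\Lambda_0\ge 1$ and let $a:\mathbb{R}^+\to\mathbb{R}$ be a continuous function with $$\Lambda_0^{-1}\le a(t)\le \Lambda_0\qquad\text{for all } t\in\mathbb{R}^+ .$$ Let $\varphi$ be a positive function in $L^1(\mathbb{R}^+)$. Let $\mu$ be a modulus of continuity satisfying the Osgood condition. Suppose that there exists a positive function $\psi\in L^1(\mathbb{R}^+)\cap L^\infty(\mathbb{R}^+)$ such that $$\sup_{\max\{0,\,t-\frac12\}<t_1<t_2<t+\frac12}\frac{|a(t_2)-a(t_1)|}{\mu(t_2-t_1)}\le \psi(t)\qquad\text{for a.e. } t\in\mathbb{R}^+ .$$ Let $u$ be a function defined on $\mathbb{R}^+_t\times\mathbb{R}_x$ with $$u\in L^2_{\rm loc}(\mathbb{R}^+_t,H^2(\mathbb{R}_x))\cap H^1_{\rm loc}(\mathbb{R}^+_t,L^2(\mathbb{R}_x)),$$ $$\|u_t(t,\cdot)-a(t)u_{xx}(t,\cdot)\|^2_{L^2(\mathbb{R}_x)}\le \varphi(t)\,\|u(t,\cdot)\|^2_{H^1(\mathbb{R}_x)}\qquad\text{for a.e. } t\in\mathbb{R}^+ ,$$ and such that $u$ is rapidly decaying, i.e. for all $\lambda>0$, $$\lim_{t\to+\infty}e^{\lambda t}\|u(t,\cdot)\|_{H^1(\mathbb{R}_x)}=0 .$$ Then $u\equiv 0$.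
   Context: $\mathbb{R}^+=[0,+\infty[$. The subscripts in $\mathbb{R}^+_t$, $\mathbb{R}_x$ only indicate the variable. A modulus of continuity is a function $\mu:\mathbb{R}^+\to\mathbb{R}^+$ that is continuous, increasing, concave, and satisfies $\mu(0)=0$. A modulus of continuity $\mu$ satisfies the Osgood condition if $\int_0^1\frac{1}{\mu(s)}\,ds=+\infty$. *)

theory Defs
  imports "HOL-Analysis.Analysis"
begin

text \<open>
  Elements of the function spaces below are represented by complex-valued functions; two
  representatives of the same element agree almost everywhere. The half line of nonnegative
  reals is \<open>{0..}\<close>, and the values of functions of \<open>t\<close> at \<open>t < 0\<close> are irrelevant.
\<close>

definition modulus_of_continuity :: "(real \<Rightarrow> real) \<Rightarrow> bool" where
  "modulus_of_continuity \<mu> \<longleftrightarrow>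
     (\<forall>s\<ge>0. 0 \<le> \<mu> s) \<and> continuous_on {0..} \<mu> \<and> mono_on {0..} \<mu> \<and> concave_on {0..} \<mu> \<and> \<mu> 0 = 0"

text \<open>Division is in \<^typ>\<open>ennreal\<close>, where \<open>1 / 0 = \<infinity>\<close>.\<close>

definition osgood :: "(real \<Rightarrow> real) \<Rightarrow> bool" where
  "osgood \<mu> \<longleftrightarrow> (\<integral>\<^sup>+ s. 1 / ennreal (\<mu> s) \<partial>lebesgue_on {0..1}) = \<infinity>"

text \<open>
  The local oscillation quotient is formed in \<^typ>\<open>ennreal\<close>, so that an unbounded set of
  quotients has supremum \<open>\<infinity>\<close>, and \<open>c / 0 = \<infinity>\<close> for \<open>c > 0\<close>.
\<close>

definition local_modulus_quotient :: "(real \<Rightarrow> real) \<Rightarrow> (real \<Rightarrow> real) \<Rightarrow> real \<Rightarrow> ennreal" where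
  "local_modulus_quotient \<mu> a t =
     (SUP (t1, t2) \<in> {(t1, t2). max 0 (t - 1/2) < t1 \<and> t1 < t2 \<and> t2 < t + 1/2}.
        ennreal \<bar>a t2 - a t1\<bar> / ennreal (\<mu> (t2 - t1)))"

definition test_functions :: "real set \<Rightarrow> (real \<Rightarrow> real) set" where
  "test_functions S =
     {\<eta>. (\<forall>n x. (deriv ^^ n) \<eta> differentiable (at x)) \<and>
         compact (closure {x. \<eta> x \<noteq> 0}) \<and> closure {x. \<eta> x \<noteq> 0} \<subseteq> S}"

definition locally_integrable :: "(real \<Rightarrow> complex) \<Rightarrow> bool" where
  "locally_integrable f \<longleftrightarrow> (\<forall>K. compact K \<longrightarrow> integrable (lebesgue_on K) f)"

definition has_weak_deriv :: "(real \<Rightarrow> complex) \<Rightarrow> (real \<Rightarrow> complex) \<Rightarrow> bool" where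
  "has_weak_deriv f g \<longleftrightarrow>
     locally_integrable f \<and> locally_integrable g \<and>
     (\<forall>\<eta> \<in> test_functions UNIV.
        (LINT x|lebesgue. deriv \<eta> x *\<^sub>R f x) = - (LINT x|lebesgue. \<eta> x *\<^sub>R g x))"

text \<open>A weak derivative is unique up to a null set.\<close>

definition weak_deriv :: "(real \<Rightarrow> complex) \<Rightarrow> (real \<Rightarrow> complex)" where
  "weak_deriv f = (SOME g. has_weak_deriv f g)"

definition L2 :: "(real \<Rightarrow> complex) set" where
  "L2 = {f \<in> borel_measurable lebesgue. integrable lebesgue (\<lambda>x. (norm (f x))\<^sup>2)}"

definition L2_norm :: "(real \<Rightarrow> complex) \<Rightarrow> real" where
  "L2_norm f = sqrt (LINT x|lebesgue. (norm (f x))\<^sup>2)"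

primrec sobolev :: "nat \<Rightarrow> (real \<Rightarrow> complex) set" where
  "sobolev 0 = L2"
| "sobolev (Suc k) = {f \<in> L2. \<exists>g \<in> sobolev k. has_weak_deriv f g}"

text \<open>Meaningful for \<open>f \<in> sobolev k\<close> only.\<close>

definition sobolev_norm :: "nat \<Rightarrow> (real \<Rightarrow> complex) \<Rightarrow> real" where
  "sobolev_norm k f = sqrt (\<Sum>j\<le>k. (L2_norm ((weak_deriv ^^ j) f))\<^sup>2)"

text \<open>
  The space of locally square integrable functions of \<open>t \<ge> 0\<close> (up to and including \<open>t = 0\<close>)
  with values in \<open>sobolev k\<close>. Since the values lie in a separable Hilbert space of functions,
  strong measurability in \<open>t\<close> is expressed by joint measurability of \<open>(t, x) \<mapsto> u t x\<close>.
\<close>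

definition L2_loc_sobolev :: "nat \<Rightarrow> (real \<Rightarrow> real \<Rightarrow> complex) set" where
  "L2_loc_sobolev k =
     {u. (\<lambda>(t, x). u t x) \<in> borel_measurable (lebesgue_on ({0..} \<times> UNIV)) \<and>
         (AE t in lebesgue_on {0..}. u t \<in> sobolev k) \<and>
         (\<forall>T>0. integrable (lebesgue_on {0..T}) (\<lambda>t. (sobolev_norm k (u t))\<^sup>2))}"

text \<open>
  The weak time derivative of an \<open>L2\<close>-valued function. For every test function \<open>\<eta>\<close> of \<open>t\<close> the
  identity is one between \<open>L2\<close>-valued Bochner integrals, whose values are computed pointwise
  for almost every \<open>x\<close>.
\<close>

definition has_time_deriv ::
    "(real \<Rightarrow> real \<Rightarrow> complex) \<Rightarrow> (real \<Rightarrow> real \<Rightarrow> complex) \<Rightarrow> bool" where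
  "has_time_deriv u v \<longleftrightarrow>
     u \<in> L2_loc_sobolev 0 \<and> v \<in> L2_loc_sobolev 0 \<and>
     (\<forall>\<eta> \<in> test_functions {0<..}. AE x in lebesgue.
        (LINT t|lebesgue_on {0..}. deriv \<eta> t *\<^sub>R u t x) =
          - (LINT t|lebesgue_on {0..}. \<eta> t *\<^sub>R v t x))"

definition H1_loc_L2 :: "(real \<Rightarrow> real \<Rightarrow> complex) set" where
  "H1_loc_L2 = {u. \<exists>v. has_time_deriv u v}"

definition time_deriv :: "(real \<Rightarrow> real \<Rightarrow> complex) \<Rightarrow> (real \<Rightarrow> real \<Rightarrow> complex)" where
  "time_deriv u = (SOME v. has_time_deriv u v)"

end

theory Submission
  imports Defs "HOL-Computational_Algebra.Polynomial"
begin

text \<open>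
  The coefficient depends on \<open>t\<close> only, so \<open>\<partial>\<^sub>x\<^sup>2\<close> commutes with the
  equation. Write \<open>A = \<parallel>u\<parallel>\<^sup>2\<close>, \<open>B = \<parallel>u\<^sub>x\<parallel>\<^sup>2\<close> and
  \<open>f = u\<^sub>t - a u\<^sub>x\<^sub>x\<close>. From \<open>A' = 2 \<langle>u, u\<^sub>t\<rangle>\<close>, \<open>B' = - 2 \<langle>u\<^sub>x\<^sub>x, u\<^sub>t\<rangle>\<close> and the Cauchy-Schwarz
  inequality for \<open>A u\<^sub>x\<^sub>x + B u\<close> and \<open>f\<close>, the frequency \<open>(A + B) / A\<close> satisfies
  \<open>((A + B) / A)' \<le> (\<Lambda>\<^sub>0 / 2) \<phi> (A + B) / A\<close> as long as \<open>A > 0\<close>. As \<open>\<phi>\<close> is integrable, the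
  frequency stays bounded, hence \<open>A' \<ge> - C (1 + \<phi>) A\<close>. So \<open>A\<close> never reaches zero from a
  positive value and decays at most exponentially, which contradicts the rapid decay.

  The two identities for \<open>A'\<close> and \<open>B'\<close> hold in integrated form. The first follows from the
  product rule in \<open>t\<close> for almost every fixed \<open>x\<close> and Fubini; the second is its limit for difference
  quotients of \<open>u\<close> in \<open>x\<close>.
\<close>

section \<open>Primitives of locally integrable functions\<close>

text \<open>Put \<open>w = A u_xx + B u\<close>. Since
  \<open>\<langle>u_xx, u\<rangle> = - B\<close>, \<open>w\<close> is orthogonal to \<open>u\<close>
  and \<open>\<langle>w, u_xx\<rangle> = |w|^2 / A\<close>, so
  \<open>A^2 (B / A)' = - (2 a / A) |w|^2 - 2 \<langle>w, f\<rangle>\<close>. The first term is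
  non-positive and completes the square against the second, which leaves
  \<open>A |f|^2 / (2 a)\<close>. The resulting factor \<open>\<Lambda>\<^sub>0 / 2\<close> is
  enlarged to \<open>1 + \<Lambda>\<^sub>0\<close> below, so that one weight \<open>\<kappa>\<close>
  serves both differential inequalities. Two obstacles shape the proof. \<open>A\<close> and
  \<open>B\<close> are only absolutely continuous, and the frequency has no meaning where
  \<open>A\<close> vanishes; so the inequalities are kept free of division and solutions are
  compared with barriers that are linear in \<open>\<integral> \<kappa>\<close>, for which a product
  rule is enough. Such barriers work only while the integral is small, hence the short intervals and
  late tails. Moreover \<open>u_t\<close> has no derivative in \<open>x\<close>, so the integration
  by parts behind \<open>B'\<close> is done for difference quotients, with all derivatives in
  \<open>x\<close> falling on \<open>u\<close>. \<open>ac_from\<close> encodes absolute continuity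
  by an explicit density; no pointwise derivative of \<open>A\<close> or \<open>B\<close> is
  formed.\<close>

definition ac_from :: "real \<Rightarrow> (real \<Rightarrow> 'a::euclidean_space) \<Rightarrow> (real \<Rightarrow> 'a) \<Rightarrow> bool" where
  "ac_from a F f \<longleftrightarrow> (\<forall>s t. a \<le> s \<longrightarrow> s \<le> t \<longrightarrow>
     set_integrable lborel {s..t} f \<and> F t - F s = (LBINT r:{s..t}. f r))"

lemma ac_fromD:
  assumes "ac_from a F f" "a \<le> s" "s \<le> t"
  shows "set_integrable lborel {s..t} f" "F t - F s = (LBINT r:{s..t}. f r)"
  using assms unfolding ac_from_def by blast+

lemma ac_from_mono: "ac_from a F f \<Longrightarrow> a \<le> b \<Longrightarrow> ac_from b F f"
  unfolding ac_from_def by (meson order_trans)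

lemma ac_from_continuous:
  assumes "ac_from a F f"
  shows "continuous_on {a..t} F"
proof (cases "a \<le> t")
  case True
  have i: "f integrable_on {a..t}"
    using set_borel_integral_eq_integral(1)[OF ac_fromD(1)[OF assms order_refl True]] .
  have e: "F r = F a + integral {a..r} f" if "r \<in> {a..t}" for r
    using ac_fromD[OF assms order_refl, of r] that set_borel_integral_eq_integral(2)[of "{a..r}" f]
    by (auto simp: algebra_simps)
  have "continuous_on {a..t} (\<lambda>r. F a + integral {a..r} f)"
    by (intro continuous_intros indefinite_integral_continuous_1 i)
  then show ?thesis
    by (rule continuous_on_eq) (rule e[symmetric])
qed auto

lemma set_integrable_Icc:
  fixes f :: "real \<Rightarrow> 'a::euclidean_space"
  assumes "set_integrable lborel S f" "{s..t} \<subseteq> S"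
  shows "set_integrable lborel {s..t} f"
  using set_integrable_subset[OF assms(1) _ assms(2)] by auto

lemma set_integral_Icc_split:
  fixes f :: "real \<Rightarrow> 'a::euclidean_space"
  assumes "set_integrable lborel {s..t} f" "s \<le> r" "r \<le> t"
  shows "(LBINT x:{s..t}. f x) = (LBINT x:{s..r}. f x) + (LBINT x:{r..t}. f x)"
proof -
  have 1: "set_integrable lborel {s..r} f" "set_integrable lborel {r..t} f"
    using assms by (auto intro!: set_integrable_Icc[OF assms(1)])
  show ?thesis
    using Henstock_Kurzweil_Integration.integral_combine[OF assms(2,3) set_borel_integral_eq_integral(1)[OF assms(1)]]
      set_borel_integral_eq_integral(2)[OF 1(1)] set_borel_integral_eq_integral(2)[OF 1(2)]
      set_borel_integral_eq_integral(2)[OF assms(1)] by simp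
qed

lemma ac_fromI:
  assumes "\<And>t. a \<le> t \<Longrightarrow> set_integrable lborel {a..t} f"
    and "\<And>t. a \<le> t \<Longrightarrow> F t - F a = (LBINT r:{a..t}. f r)"
  shows "ac_from a F f"
  unfolding ac_from_def
proof (intro allI impI conjI)
  fix s t assume st: "a \<le> s" "s \<le> t"
  have i: "set_integrable lborel {a..t} f" using assms(1) st by auto
  show "set_integrable lborel {s..t} f"
    by (rule set_integrable_Icc[OF i]) (use st in auto)
  show "F t - F s = (LBINT r:{s..t}. f r)"
    using set_integral_Icc_split[OF i st] assms(2)[of t] assms(2)[of s] st by (simp add: algebra_simps)
qed

lemma ac_from_add:
  assumes F: "ac_from a F f" and G: "ac_from a G g"
  shows "ac_from a (\<lambda>t. F t + G t) (\<lambda>t. f t + g t)"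
  unfolding ac_from_def
proof (intro allI impI conjI)
  fix s t assume st: "a \<le> s" "s \<le> t"
  note i = ac_fromD(1)[OF F st] ac_fromD(1)[OF G st]
  show "set_integrable lborel {s..t} (\<lambda>t. f t + g t)"
    by (rule set_integral_add(1)[OF i])
  show "(F t + G t) - (F s + G s) = (LBINT r:{s..t}. f r + g r)"
    using ac_fromD(2)[OF F st] ac_fromD(2)[OF G st] set_integral_add(2)[OF i] by (simp add: algebra_simps)
qed

lemma ac_from_diff:
  assumes F: "ac_from a F f" and G: "ac_from a G g"
  shows "ac_from a (\<lambda>t. F t - G t) (\<lambda>t. f t - g t)"
  unfolding ac_from_def
proof (intro allI impI conjI)
  fix s t assume st: "a \<le> s" "s \<le> t"
  note i = ac_fromD(1)[OF F st] ac_fromD(1)[OF G st]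
  show "set_integrable lborel {s..t} (\<lambda>t. f t - g t)"
    by (rule set_integral_diff(1)[OF i])
  show "(F t - G t) - (F s - G s) = (LBINT r:{s..t}. f r - g r)"
    using ac_fromD(2)[OF F st] ac_fromD(2)[OF G st] set_integral_diff(2)[OF i] by (simp add: algebra_simps)
qed

lemma ac_from_const: "ac_from a (\<lambda>_. c) (\<lambda>_. 0)"
  unfolding ac_from_def by (auto simp: set_integrable_def)

lemma ac_from_cmult:
  fixes F :: "real \<Rightarrow> real"
  shows "ac_from a F f \<Longrightarrow> ac_from a (\<lambda>t. c * F t) (\<lambda>t. c * f t)"
  unfolding ac_from_def by (auto simp: right_diff_distrib[symmetric])

lemma ac_from_deriv:
  fixes F :: "real \<Rightarrow> 'a::euclidean_space"
  assumes "\<And>x. (F has_vector_derivative f x) (at x)" "continuous_on UNIV f"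
  shows "ac_from a F f"
  unfolding ac_from_def
proof (intro allI impI conjI)
  fix s t :: real assume st: "a \<le> s" "s \<le> t"
  show i: "set_integrable lborel {s..t} f"
    by (rule borel_integrable_compact[of "{s..t}" f, folded set_integrable_def])
      (auto intro: continuous_on_subset[OF assms(2)])
  have "(f has_integral (F t - F s)) {s..t}"
    by (rule fundamental_theorem_of_calculus) (use st assms(1) in \<open>auto intro: has_vector_derivative_at_within\<close>)
  then show "F t - F s = (LBINT r:{s..t}. f r)"
    using set_borel_integral_eq_integral(2)[OF i] by (simp add: integral_unique)
qed

section \<open>The product rule for absolutely continuous functions\<close>

abbreviation lborel2 :: "(real \<times> real) measure" where "lborel2 \<equiv> lborel \<Otimes>\<^sub>M lborel"

text \<open>Fubini for \<open>pr (f s) (g t)\<close> on the plane, split along the diagonal: the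
  part \<open>t \<le> s\<close> gives one iterated integral and the part \<open>s < t\<close> the
  other. The bilinear map is general because the product rule is needed for real products, for
  scaling by test functions and for inner products.\<close>

lemma integral_product_triangles:
  fixes f :: "real \<Rightarrow> 'a::euclidean_space" and g :: "real \<Rightarrow> 'b::euclidean_space"
    and pr :: "'a \<Rightarrow> 'b \<Rightarrow> 'c::euclidean_space"
  assumes bb: "bounded_bilinear pr"
    and f: "integrable lborel f" and g: "integrable lborel g"
  shows "integrable lborel (\<lambda>t. pr (f t) (LBINT s:{..t}. g s))"
    and "integrable lborel (\<lambda>t. pr (LBINT s:{..t}. f s) (g t))"
    and "pr (integral\<^sup>L lborel f) (integral\<^sup>L lborel g) =
      (LBINT t. pr (f t) (LBINT s:{..t}. g s)) + (LBINT t. pr (LBINT s:{..t}. f s) (g t))"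
proof -
  interpret bb: bounded_bilinear pr by (rule bb)
  let ?lo = "\<lambda>(s,t). indicator {..s} t *\<^sub>R pr (f s) (g t)" and ?hi = "\<lambda>(s,t). indicator {s<..} t *\<^sub>R pr (f s) (g t)"
  have [measurable]: "f \<in> borel_measurable borel" "g \<in> borel_measurable borel" using f g by auto
  have prm: "(\<lambda>p. pr (fst p) (snd p)) \<in> borel_measurable borel"
    by (intro borel_measurable_continuous_onI bb.continuous_on continuous_intros)
  have prm': "(\<lambda>x. pr (F x) (G x)) \<in> borel_measurable N"
    if "F \<in> borel_measurable N" "G \<in> borel_measurable N" for F G and N :: "'z measure"
    using measurable_compose[OF borel_measurable_Pair[OF that] prm] by simp
  obtain K where K: "0 \<le> K" "\<And>x y. norm (pr x y) \<le> norm x * norm y * K" using bb.nonneg_bounded by blast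
  have I: "integrable lborel2 (\<lambda>(s,t). pr (f s) (g t))"
  proof (rule Bochner_Integration.integrable_bound)
    show "integrable lborel2 (\<lambda>(s,t). K * (norm (f s) * norm (g t)))"
      by (rule lborel_pair.Fubini_integrable) (use f g in \<open>auto simp: norm_mult abs_mult intro!: integrable_mult_right integrable_mult_left\<close>)
    show "(\<lambda>(s,t). pr (f s) (g t)) \<in> borel_measurable lborel2"
      unfolding case_prod_unfold by (rule prm') measurable
    show "AE x in lborel2. norm (case x of (s, t) \<Rightarrow> pr (f s) (g t)) \<le> norm (case x of (s, t) \<Rightarrow> K * (norm (f s) * norm (g t)))"
      using K by (auto simp: case_prod_unfold mult_ac)
  qed
  have I1: "integrable lborel2 ?lo"
    and I2: "integrable lborel2 ?hi"
  proof -
    have S1: "{x. snd x \<le> fst x} \<in> sets lborel2" "{x. fst x < snd x} \<in> sets lborel2"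
      unfolding lborel_prod sets_lborel
      by (intro borel_closed borel_open closed_Collect_le open_Collect_less continuous_intros)+
    show "integrable lborel2 ?lo"
      using integrable_mult_indicator[OF S1(1) I]
      by (rule back_subst[of "integrable lborel2"]) (auto simp: indicator_def)
    show "integrable lborel2 ?hi"
      using integrable_mult_indicator[OF S1(2) I]
      by (rule back_subst[of "integrable lborel2"]) (auto simp: indicator_def)
  qed
  have i1: "(LBINT t. indicator {..s} t *\<^sub>R pr (f s) (g t)) = pr (f s) (LBINT t:{..s}. g t)" for s
    unfolding set_lebesgue_integral_def bb.scaleR_right[symmetric]
    by (rule integral_bounded_linear[OF bb.bounded_linear_right])
      (use integrable_mult_indicator[of "{..s}" lborel g] g in auto)
  have i2: "(LBINT s. indicator {s<..} t *\<^sub>R pr (f s) (g t)) = pr (LBINT s:{..t}. f s) (g t)" for t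
  proof -
    have "(LBINT s. indicator {s<..} t *\<^sub>R pr (f s) (g t)) = (LBINT s. pr (indicator {..<t} s *\<^sub>R f s) (g t))"
      by (rule Bochner_Integration.integral_cong) (auto simp: bb.zero_left indicator_def)
    \<comment> \<open>The part \<open>s < t\<close> has open half-lines as slices; they differ from
      the closed ones by one point.\<close>
    also have "\<dots> = (LBINT s. pr (indicator {..t} s *\<^sub>R f s) (g t))"
    proof (rule integral_cong_AE)
      show "AE s in lborel. pr (indicator {..<t} s *\<^sub>R f s) (g t) = pr (indicator {..t} s *\<^sub>R f s) (g t)"
        using AE_lborel_singleton[of t] by eventually_elim (auto simp: indicator_def)
    qed (rule prm'; measurable)+
    also have "\<dots> = pr (LBINT s:{..t}. f s) (g t)"
      unfolding set_lebesgue_integral_def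
      by (rule integral_bounded_linear[OF bb.bounded_linear_left])
        (use integrable_mult_indicator[of "{..t}" lborel f] f in auto)
    finally show ?thesis .
  qed
  show "integrable lborel (\<lambda>t. pr (f t) (LBINT s:{..t}. g s))"
    using lborel_pair.integrable_fst'[OF I1] by (simp add: i1)
  show "integrable lborel (\<lambda>t. pr (LBINT s:{..t}. f s) (g t))"
    using lborel_pair.integrable_snd[OF I2] by (simp add: i2)
  have "pr (integral\<^sup>L lborel f) (integral\<^sup>L lborel g) = (LBINT s. pr (f s) (integral\<^sup>L lborel g))"
    by (rule integral_bounded_linear[OF bb.bounded_linear_left f, symmetric])
  also have "\<dots> = (LBINT s. LBINT t. pr (f s) (g t))"
    by (rule Bochner_Integration.integral_cong)
      (auto intro!: integral_bounded_linear[OF bb.bounded_linear_right g, symmetric])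
  also have "\<dots> = integral\<^sup>L lborel2 (\<lambda>(s,t). pr (f s) (g t))"
    by (rule lborel_pair.integral_fst[OF I])
  also have "\<dots> = integral\<^sup>L lborel2 (\<lambda>x. ?lo x
      + ?hi x)"
    by (rule Bochner_Integration.integral_cong) (auto simp: indicator_def)
  also have "\<dots> = integral\<^sup>L lborel2 ?lo
      + integral\<^sup>L lborel2 ?hi"
    by (rule Bochner_Integration.integral_add[OF I1 I2])
  also have "integral\<^sup>L lborel2 ?lo = (LBINT s. pr (f s) (LBINT t:{..s}. g t))"
    using lborel_pair.integral_fst[OF I1] by (simp add: i1)
  also have "integral\<^sup>L lborel2 ?hi = (LBINT t. pr (LBINT s:{..t}. f s) (g t))"
    using lborel_pair.integral_snd[OF I2] by (simp add: i2)
  finally show "pr (integral\<^sup>L lborel f) (integral\<^sup>L lborel g) =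
      (LBINT t. pr (f t) (LBINT s:{..t}. g s)) + (LBINT t. pr (LBINT s:{..t}. f s) (g t))" .
qed

text \<open>With the densities cut off to \<open>{a..t}\<close>, the inner integrals over
  \<open>{..r}\<close> in the triangle identity become \<open>F r - F a\<close> and
  \<open>G r - G a\<close>. This gives the rule for the increments; the contributions of
  \<open>F a\<close> and \<open>G a\<close> are linear and are added back.\<close>

lemma ac_from_prod:
  fixes F f :: "real \<Rightarrow> 'a::euclidean_space" and G g :: "real \<Rightarrow> 'b::euclidean_space"
    and pr :: "'a \<Rightarrow> 'b \<Rightarrow> 'c::euclidean_space"
  assumes bb: "bounded_bilinear pr" and F: "ac_from a F f" and G: "ac_from a G g"
  shows "ac_from a (\<lambda>t. pr (F t) (G t)) (\<lambda>t. pr (f t) (G t) + pr (F t) (g t))"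
proof (rule ac_fromI)
  interpret bb: bounded_bilinear pr by (rule bb)
  fix t assume t: "a \<le> t"
  let ?f = "\<lambda>r. indicator {a..t} r *\<^sub>R f r" and ?g = "\<lambda>r. indicator {a..t} r *\<^sub>R g r"
  have fi: "integrable lborel ?f" and gi: "integrable lborel ?g"
    using ac_fromD(1)[OF F order_refl t] ac_fromD(1)[OF G order_refl t] by (auto simp: set_integrable_def)
  have eF: "(LBINT s:{..r}. ?f s) = F r - F a" if "r \<in> {a..t}" for r
  proof -
    have "(LBINT s:{..r}. ?f s) = (LBINT s:{a..r}. f s)"
      unfolding set_lebesgue_integral_def
      by (rule Bochner_Integration.integral_cong) (use that in \<open>auto simp: indicator_def\<close>)
    then show ?thesis using ac_fromD(2)[OF F order_refl, of r] that by simp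
  qed
  have eG: "(LBINT s:{..r}. ?g s) = G r - G a" if "r \<in> {a..t}" for r
  proof -
    have "(LBINT s:{..r}. ?g s) = (LBINT s:{a..r}. g s)"
      unfolding set_lebesgue_integral_def
      by (rule Bochner_Integration.integral_cong) (use that in \<open>auto simp: indicator_def\<close>)
    then show ?thesis using ac_fromD(2)[OF G order_refl, of r] that by simp
  qed
  have e1: "pr (?f r) (LBINT s:{..r}. ?g s) = pr (?f r) (G r - G a)" for r
    by (cases "r \<in> {a..t}") (auto simp: eG bb.zero_left)
  have e2: "pr (LBINT s:{..r}. ?f s) (?g r) = pr (F r - F a) (?g r)" for r
    by (cases "r \<in> {a..t}") (auto simp: eF bb.zero_right)
  note T = integral_product_triangles[OF bb fi gi, unfolded e1 e2]
  have j1: "integrable lborel (\<lambda>r. pr (?f r) (G a))" "(LBINT r. pr (?f r) (G a)) = pr (integral\<^sup>L lborel ?f) (G a)"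
    using integrable_bounded_linear[OF bb.bounded_linear_left fi] integral_bounded_linear[OF bb.bounded_linear_left fi] by auto
  have j2: "integrable lborel (\<lambda>r. pr (F a) (?g r))" "(LBINT r. pr (F a) (?g r)) = pr (F a) (integral\<^sup>L lborel ?g)"
    using integrable_bounded_linear[OF bb.bounded_linear_right gi] integral_bounded_linear[OF bb.bounded_linear_right gi] by auto
  have eq: "indicator {a..t} r *\<^sub>R (pr (f r) (G r) + pr (F r) (g r)) =
     (pr (?f r) (G r - G a) + pr (F r - F a) (?g r)) + (pr (?f r) (G a) + pr (F a) (?g r))" for r
    by (simp add: bb.diff_right bb.diff_left bb.scaleR_left bb.scaleR_right algebra_simps)
  show "set_integrable lborel {a..t} (\<lambda>t. pr (f t) (G t) + pr (F t) (g t))"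
    unfolding set_integrable_def eq
    by (intro Bochner_Integration.integrable_add T(1,2) j1 j2)
  have If: "integral\<^sup>L lborel ?f = F t - F a" and Ig: "integral\<^sup>L lborel ?g = G t - G a"
    using ac_fromD(2)[OF F order_refl t] ac_fromD(2)[OF G order_refl t] by (auto simp: set_lebesgue_integral_def)
  have "(LBINT r:{a..t}. pr (f r) (G r) + pr (F r) (g r)) =
      ((LBINT r. pr (?f r) (G r - G a)) + (LBINT r. pr (F r - F a) (?g r))) +
      ((LBINT r. pr (?f r) (G a)) + (LBINT r. pr (F a) (?g r)))"
    unfolding set_lebesgue_integral_def eq
    by (simp only: Bochner_Integration.integral_add Bochner_Integration.integrable_add T(1,2) j1 j2)
  also have "\<dots> = pr (F t - F a) (G t - G a) + (pr (F t - F a) (G a) + pr (F a) (G t - G a))"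
    unfolding T(3)[symmetric] j1(2) j2(2) If Ig ..
  also have "\<dots> = pr (F t) (G t) - pr (F a) (G a)"
    by (simp add: bb.diff_right bb.diff_left)
  finally show "pr (F t) (G t) - pr (F a) (G a) = (LBINT r:{a..t}. pr (f r) (G r) + pr (F r) (g r))" by simp
qed

section \<open>Differential inequalities\<close>

text \<open>The indefinite integral is continuous, so it changes little near either endpoint. These
  short intervals are what allows linear barriers in place of an exponential integrating
  factor.\<close>

lemma primitive_small:
  fixes \<beta> :: "real \<Rightarrow> real"
  assumes "set_integrable lborel {s..T} \<beta>" "s < T"
  shows "\<exists>d. s < d \<and> d \<le> T \<and> (LBINT r:{s..d}. \<beta> r) \<le> 1/2"
    and "\<exists>d. s \<le> d \<and> d < T \<and> (LBINT r:{d..T}. \<beta> r) \<le> 1/2"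
proof -
  have i: "\<beta> integrable_on {s..T}" using set_borel_integral_eq_integral(1)[OF assms(1)] .
  define I where "I r = (LBINT x:{s..r}. \<beta> x)" for r
  have Ieq: "I r = integral {s..r} \<beta>" if "r \<in> {s..T}" for r
    unfolding I_def
    by (rule set_borel_integral_eq_integral(2)[OF set_integrable_Icc[OF assms(1)]]) (use that in auto)
  have c: "continuous_on {s..T} I"
    by (rule continuous_on_eq[OF indefinite_integral_continuous_1[OF i]]) (rule Ieq[symmetric])
  have I0: "I s = 0" using Ieq[of s] assms(2) by simp
  obtain e where e: "e > 0" "\<And>r. r \<in> {s..T} \<Longrightarrow> dist r s < e \<Longrightarrow> dist (I r) (I s) < 1/2"
    using continuous_onE[OF c, of s "1/2"] assms(2) by (metis atLeastAtMost_iff half_gt_zero_iff less_eq_real_def zero_less_one)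
  define d where "d = min T (s + e/2)"
  have "s < d" "d \<le> T" "dist d s < e" using e assms(2) by (auto simp: d_def dist_real_def)
  moreover from this have "dist (I d) (I s) < 1/2" using e by auto
  ultimately show "\<exists>d. s < d \<and> d \<le> T \<and> (LBINT r:{s..d}. \<beta> r) \<le> 1/2"
    using I0 unfolding I_def[symmetric] by (intro exI[of _ d]) (auto simp: dist_real_def)
  obtain e where e: "e > 0" "\<And>r. r \<in> {s..T} \<Longrightarrow> dist r T < e \<Longrightarrow> dist (I r) (I T) < 1/2"
    using continuous_onE[OF c, of T "1/2"] assms(2) by (metis atLeastAtMost_iff half_gt_zero_iff less_eq_real_def zero_less_one)
  define d where "d = max s (T - e/2)"
  have d: "s \<le> d" "d < T" "dist d T < e" using e assms(2) by (auto simp: d_def dist_real_def)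
  moreover from this have "dist (I d) (I T) < 1/2" using e by auto
  moreover have "I T = I d + (LBINT x:{d..T}. \<beta> x)"
    unfolding I_def by (rule set_integral_Icc_split[OF assms(1)]) (use d in auto)
  ultimately show "\<exists>d. s \<le> d \<and> d < T \<and> (LBINT r:{d..T}. \<beta> r) \<le> 1/2"
    by (intro exI[of _ d]) (auto simp: dist_real_def)
qed

lemma set_integral_mono_Icc:
  fixes f g :: "real \<Rightarrow> real"
  assumes "set_integrable lborel {s..t} f" "set_integrable lborel {s..t} g"
    "AE r in lborel. s \<le> r \<and> r \<le> t \<longrightarrow> f r \<le> g r"
  shows "(LBINT r:{s..t}. f r) \<le> (LBINT r:{s..t}. g r)"
  unfolding set_lebesgue_integral_def
  by (rule integral_mono_AE) (use assms in \<open>auto simp: set_integrable_def indicator_def elim!: AE_mp\<close>)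

text \<open>The inequality is available only where \<open>P\<close> is positive, so only the sign of
  \<open>P\<close> is at stake. After the last time \<open>c\<close> with
  \<open>P c \<le> 0\<close>, choose an interval on which
  \<open>\<integral> \<beta> \<le> 1/2\<close>. At a maximum point \<open>m\<close> of
  \<open>P\<close> there, \<open>P m \<le> P c + P m / 2\<close>, which is impossible for
  \<open>P m > 0\<close>.\<close>

lemma ac_gronwall:
  fixes P :: "real \<Rightarrow> real"
  assumes P: "ac_from s P p" and \<beta>: "set_integrable lborel {s..T} \<beta>" "\<And>r. s \<le> r \<Longrightarrow> 0 \<le> \<beta> r"
    and P0: "P s \<le> 0"
    and ineq: "AE r in lborel. s \<le> r \<and> r \<le> T \<and> P r > 0 \<longrightarrow> p r \<le> \<beta> r * P r"
    and t: "s \<le> t" "t \<le> T"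
  shows "P t \<le> 0"
proof (rule ccontr)
  assume "\<not> P t \<le> 0"
  have cont: "continuous_on {s..t} P" by (rule ac_from_continuous[OF P])
  let ?Z = "{r \<in> {s..t}. P r \<le> 0}"
  have "closed ?Z"
    using continuous_closed_preimage[OF cont, of "{..0}"] by (simp add: vimage_def Int_def)
  moreover have Z: "?Z \<noteq> {}" "bdd_above ?Z" using P0 t by auto
  ultimately have c: "Sup ?Z \<in> ?Z" by (rule closed_contains_Sup[rotated 2])
  \<comment> \<open>\<open>P\<close> is positive strictly after \<open>c\<close> and up to
    \<open>t\<close>, so the hypothesis \<open>ineq\<close> applies on all of that interval.\<close>
  define c where "c = Sup ?Z"
  have c: "s \<le> c" "c < t" "P c \<le> 0" using c \<open>\<not> P t \<le> 0\<close> unfolding c_def[symmetric] by (auto simp: less_le)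
  have pos: "P r > 0" if "c < r" "r \<le> t" for r
  proof (rule ccontr)
    assume "\<not> P r > 0"
    then have "r \<in> ?Z" using that c by auto
    then have "r \<le> c" unfolding c_def by (rule cSup_upper[OF _ Z(2)])
    then show False using that by simp
  qed
  obtain d where d: "c < d" "d \<le> t" "(LBINT r:{c..d}. \<beta> r) \<le> 1/2"
    using primitive_small(1)[of c t \<beta>] set_integrable_Icc[OF \<beta>(1), of c t] c t by auto
  have "continuous_on {c..d} P" by (rule continuous_on_subset[OF cont]) (use c d in auto)
  then obtain m where m: "m \<in> {c..d}" "\<And>r. r \<in> {c..d} \<Longrightarrow> P r \<le> P m"
    using continuous_attains_sup[of "{c..d}" P] d by auto
  have "P m > 0" using m(2)[of d] pos[of d] d by auto
  then have "c < m" using m(1) c by (auto simp: less_le)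
  have i: "set_integrable lborel {c..m} \<beta>" "set_integrable lborel {c..d} \<beta>" "set_integrable lborel {m..d} \<beta>"
    using set_integrable_Icc[OF \<beta>(1)] c d m t by auto
  have "P m - P c = (LBINT r:{c..m}. p r)" using ac_fromD(2)[OF P, of c m] c m by auto
  also have "\<dots> \<le> (LBINT r:{c..m}. \<beta> r * P m)"
  proof (rule set_integral_mono_Icc)
    show "set_integrable lborel {c..m} p" using ac_fromD(1)[OF P, of c m] c m by auto
    show "set_integrable lborel {c..m} (\<lambda>r. \<beta> r * P m)" using i by simp
    show "AE r in lborel. c \<le> r \<and> r \<le> m \<longrightarrow> p r \<le> \<beta> r * P m"
      using ineq AE_lborel_singleton[of c]
    proof eventually_elim
      case (elim r)
      show ?case
      proof
        assume r: "c \<le> r \<and> r \<le> m"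
        then have "p r \<le> \<beta> r * P r" using elim pos[of r] c d m t by auto
        also have "\<dots> \<le> \<beta> r * P m" using \<beta>(2)[of r] m(2)[of r] r c d m by (intro mult_left_mono) auto
        finally show "p r \<le> \<beta> r * P m" .
      qed
    qed
  qed
  also have "\<dots> = (LBINT r:{c..m}. \<beta> r) * P m" by simp
  also have "\<dots> \<le> 1/2 * P m"
  proof (rule mult_right_mono)
    have "0 \<le> (LBINT r:{m..d}. \<beta> r)" unfolding set_lebesgue_integral_def
      by (rule Bochner_Integration.integral_nonneg) (use \<beta>(2) m c in \<open>auto simp: indicator_def\<close>)
    then show "(LBINT r:{c..m}. \<beta> r) \<le> 1/2"
      using d(3) set_integral_Icc_split[OF i(2), of m] m by auto
  qed (use \<open>P m > 0\<close> in auto)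
  finally show False using c \<open>P m > 0\<close> by auto
qed

lemma set_integral_Icc_self:
  fixes f :: "real \<Rightarrow> 'a::euclidean_space"
  shows "(LBINT r:{a..a}. f r) = 0"
  unfolding set_lebesgue_integral_def
proof (rule integral_eq_zero_AE)
  show "AE r in lborel. indicat_real {a..a} r *\<^sub>R f r = 0"
    using AE_lborel_singleton[of a] by eventually_elim auto
qed

lemma ac_from_integral:
  fixes f :: "real \<Rightarrow> 'a::euclidean_space"
  assumes "\<And>t. a \<le> t \<Longrightarrow> set_integrable lborel {a..t} f"
  shows "ac_from a (\<lambda>t. LBINT r:{a..t}. f r) f"
proof (rule ac_fromI[OF assms])
  show "(LBINT r:{a..t}. f r) - (LBINT r:{a..a}. f r) = (LBINT r:{a..t}. f r)" for t
  proof -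
    have "(LBINT r:{a..a}. f r) = 0"
      by (rule set_integral_Icc_self)
    then show ?thesis by simp
  qed
qed

lemma set_integral_nonneg_Icc:
  fixes f :: "real \<Rightarrow> real"
  assumes "\<And>r. s \<le> r \<Longrightarrow> 0 \<le> f r"
  shows "0 \<le> (LBINT r:{s..t}. f r)"
  unfolding set_lebesgue_integral_def
  by (rule Bochner_Integration.integral_nonneg) (use assms in \<open>auto simp: indicator_def\<close>)

text \<open>Start so close to \<open>T\<close> that \<open>\<integral> \<beta> \<le> 1/2\<close>
  from \<open>d\<close> on. The barrier \<open>P d * (1 - K t)\<close> is still at least
  \<open>P d / 2\<close> at time \<open>T\<close>, and \<open>P\<close> cannot fall below it: where
  it does, \<open>P \<le> P d\<close>, so \<open>P\<close> decreases no faster than the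
  barrier.\<close>

lemma ac_no_zero:
  fixes P :: "real \<Rightarrow> real"
  assumes P: "ac_from s P p" and \<beta>: "set_integrable lborel {s..T} \<beta>" "\<And>r. s \<le> r \<Longrightarrow> 0 \<le> \<beta> r"
    and "s < T" and pos: "\<And>r. s \<le> r \<Longrightarrow> r < T \<Longrightarrow> P r > 0"
    and ineq: "AE r in lborel. s \<le> r \<and> r < T \<longrightarrow> - (\<beta> r * P r) \<le> p r"
  shows "P T > 0"
proof -
  obtain d where d: "s \<le> d" "d < T" "(LBINT r:{d..T}. \<beta> r) \<le> 1/2"
    using primitive_small(2)[OF \<beta>(1) \<open>s < T\<close>] by auto
  \<comment> \<open>\<open>\<beta>\<close> is integrable only up to \<open>T\<close>, whereas
    \<open>ac_from\<close> asks for a density on the whole half-line; hence the cut-off.\<close>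
  define \<gamma> where "\<gamma> r = indicator {..T} r *\<^sub>R \<beta> r" for r
  have \<gamma>: "set_integrable lborel {d..t} \<gamma>" for t
  proof -
    have "set_integrable lborel ({d..t} \<inter> {..T}) \<beta>" by (rule set_integrable_subset[OF \<beta>(1)]) (use d in auto)
    moreover have "(\<lambda>x. indicator ({d..t} \<inter> {..T}) x *\<^sub>R \<beta> x) = (\<lambda>x. indicator {d..t} x *\<^sub>R \<gamma> x)"
      by (auto simp: \<gamma>_def indicator_def)
    ultimately show ?thesis unfolding set_integrable_def by argo
  qed
  define K where "K t = (LBINT r:{d..t}. \<gamma> r)" for t
  have K: "ac_from d K \<gamma>" unfolding K_def by (rule ac_from_integral[OF \<gamma>])
  have K0: "0 \<le> K r" for r
    unfolding K_def by (rule set_integral_nonneg_Icc) (use \<beta>(2) d in \<open>auto simp: \<gamma>_def indicator_def\<close>)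
  have KT: "K T \<le> 1/2"
  proof -
    have "K T = (LBINT r:{d..T}. \<beta> r)"
      unfolding K_def set_lebesgue_integral_def
      by (rule Bochner_Integration.integral_cong) (auto simp: \<gamma>_def indicator_def)
    then show ?thesis using d by simp
  qed
  define X where "X t = (P d + (- P d) * K t) - P t" for t
  have X: "ac_from d X (\<lambda>t. (0 + (- P d) * \<gamma> t) - p t)"
    unfolding X_def by (intro ac_from_diff ac_from_add ac_from_const ac_from_cmult K ac_from_mono[OF P d(1)])
  have Pd: "0 < P d" using pos d by simp
  have "X T \<le> 0"
  proof (rule ac_gronwall[OF X, where T=T and \<beta>="\<lambda>_. 0"])
    show "X d \<le> 0" unfolding X_def using mult_nonneg_nonneg[OF _ K0, of "P d" d] Pd by simp
    show "AE r in lborel. d \<le> r \<and> r \<le> T \<and> 0 < X r \<longrightarrow> (0 + (- P d) * \<gamma> r) - p r \<le> 0 * X r"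
      using ineq AE_lborel_singleton[of T]
    proof eventually_elim
      case (elim r)
      show ?case
      proof (intro impI, elim conjE)
        assume r: "d \<le> r" "r \<le> T" "0 < X r"
        have "P r \<le> P d" using r(3) mult_nonneg_nonneg[OF _ K0, of "P d" r] Pd unfolding X_def by simp
        then have "\<beta> r * P r \<le> \<beta> r * P d" using \<beta>(2)[of r] r d by (intro mult_left_mono) auto
        moreover have "- p r \<le> \<beta> r * P r" using elim r d by auto
        ultimately show "(0 + (- P d) * \<gamma> r) - p r \<le> 0 * X r" using r by (simp add: \<gamma>_def mult.commute)
      qed
    qed
  qed (use d in \<open>auto simp: set_integrable_def\<close>)
  moreover have "P d * K T \<le> P d * (1/2)" by (rule mult_left_mono[OF KT]) (use Pd in simp)
  ultimately show ?thesis using Pd unfolding X_def by linarith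
qed

text \<open>What the equation contributes once space has been integrated out: \<open>p\<close> and
  \<open>q\<close> are the densities of \<open>A\<close> and \<open>B\<close>.
  \<open>quotient\<close> is the bound \<open>((A + B) / A)' \<le> \<kappa> (A + B) / A\<close>
  multiplied by \<open>A^2\<close>, so it makes sense at zeros of \<open>A\<close>.
  \<open>lower\<close> still contains \<open>B\<close>; it becomes a closed inequality for
  \<open>A\<close> as soon as the frequency is bounded.\<close>

locale frequency_ode =
  fixes A B p q \<kappa> :: "real \<Rightarrow> real" and c :: real
  assumes A: "ac_from 0 A p" and B: "ac_from 0 B q"
    and nonneg: "\<And>t. 0 \<le> t \<Longrightarrow> 0 \<le> A t" "\<And>t. 0 \<le> t \<Longrightarrow> 0 \<le> B t" "\<And>t. 0 \<le> t \<Longrightarrow> 0 \<le> \<kappa> t"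
    and c: "0 \<le> c"
    and \<kappa>: "set_integrable lborel {0..} \<kappa>"
    and quotient: "AE t in lborel. 0 \<le> t \<longrightarrow> q t * A t - B t * p t \<le> \<kappa> t * (A t + B t) * A t"
    and lower: "AE t in lborel. 0 \<le> t \<longrightarrow> - ((c + \<kappa> t) * (A t + B t)) \<le> p t"
begin

lemma \<kappa>_Icc: "0 \<le> s \<Longrightarrow> set_integrable lborel {s..t} \<kappa>"
  by (rule set_integrable_Icc[OF \<kappa>]) auto

text \<open>
  While \<open>\<integral> \<kappa> \<le> 1/2\<close>, the factor \<open>1 + 2 \<integral> \<kappa>\<close> grows fast enough to replace the integrating
  factor \<open>exp (\<integral> \<kappa>)\<close>; being linear, it needs no chain rule for absolutely continuous functions.
\<close>

lemma quotient_bound: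
  assumes st: "0 \<le> s" "s \<le> t" and pos: "\<And>r. s \<le> r \<Longrightarrow> r \<le> t \<Longrightarrow> 0 < A r"
    and small: "(LBINT r:{s..t}. \<kappa> r) \<le> 1/2"
  shows "A t + B t \<le> 2 * ((A s + B s) / A s) * A t"
proof -
  define m0 where "m0 = (A s + B s) / A s"
  have m0: "0 \<le> m0" unfolding m0_def using nonneg st by auto
  define K where "K t = (LBINT r:{s..t}. \<kappa> r)" for t
  have K: "ac_from s K \<kappa>" unfolding K_def
    by (rule ac_from_integral) (use st \<kappa>_Icc in auto)
  have K0: "K s = 0" unfolding K_def by (rule set_integral_Icc_self)
  have K_le: "0 \<le> K r \<and> K r \<le> 1/2" if "s \<le> r" "r \<le> t" for r
  proof -
    have "0 \<le> \<kappa> x" if "s \<le> x" for x using nonneg(3) st that by auto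
    then have "K r \<ge> 0" "0 \<le> (LBINT r:{r..t}. \<kappa> r)"
      unfolding K_def using that by (auto intro!: set_integral_nonneg_Icc)
    then show ?thesis
      using set_integral_Icc_split[OF \<kappa>_Icc[OF st(1)], of r t] that small unfolding K_def by linarith
  qed
  have As: "ac_from s A p" "ac_from s B q" using ac_from_mono[OF A st(1)] ac_from_mono[OF B st(1)] .
  define m where "m r = m0 + 2 * m0 * K r" for r
  have m: "ac_from s m (\<lambda>r. 0 + 2 * m0 * \<kappa> r)"
    unfolding m_def by (intro ac_from_add ac_from_const ac_from_cmult K)
  define P where "P r = (A r + B r) - m r * A r" for r
  define P' where "P' r = (p r + q r) - ((0 + 2 * m0 * \<kappa> r) * A r + m r * p r)" for r
  have P: "ac_from s P P'"
    unfolding P_def P'_def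
    by (intro ac_from_add ac_from_diff ac_from_prod[OF bounded_bilinear_mult] m As)
  have "continuous_on {s..t} A" by (rule ac_from_continuous[OF As(1)])
  then obtain z where z: "z \<in> {s..t}" "\<And>r. r \<in> {s..t} \<Longrightarrow> A z \<le> A r"
    using continuous_attains_inf[of "{s..t}" A] st by auto
  define \<delta> where "\<delta> = A z"
  have \<delta>: "\<delta> > 0" unfolding \<delta>_def using z(1) pos by auto
  \<comment> \<open>\<open>P' A\<close> is bounded by \<open>(\<kappa> A + p) P\<close>. Dividing by
    \<open>A\<close> leaves \<open>p / A\<close>, which is dominated by an integrable function
    because \<open>A\<close> is at least \<open>\<delta>\<close> on \<open>{s..t}\<close>.\<close>
  define \<beta> where "\<beta> r = \<kappa> r + \<bar>p r\<bar> / \<delta>" for r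
  have "P t \<le> 0"
  proof (rule ac_gronwall[OF P, where T=t and \<beta>=\<beta>])
    show "set_integrable lborel {s..t} \<beta>"
      unfolding \<beta>_def
      using set_integral_add(1)[OF \<kappa>_Icc[OF st(1)] set_integrable_divide[OF set_integrable_abs[OF ac_fromD(1)[OF As(1) order_refl st(2)]]]]
      by simp
    show "0 \<le> \<beta> r" if "s \<le> r" for r unfolding \<beta>_def using nonneg(3)[of r] that st \<delta> by auto
    show "P s \<le> 0" unfolding P_def m_def K0 m0_def using pos[of s] st by auto
    show "AE r in lborel. s \<le> r \<and> r \<le> t \<and> 0 < P r \<longrightarrow> P' r \<le> \<beta> r * P r"
      using quotient
    proof eventually_elim
      case (elim r)
      show ?case
      proof (intro impI, elim conjE)
        assume r: "s \<le> r" "r \<le> t" "0 < P r"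
        have Ar: "0 < A r" "\<delta> \<le> A r" using pos z r unfolding \<delta>_def by auto
        have mr: "m r \<le> 2 * m0" unfolding m_def using K_le[of r] r m0 mult_left_mono[of "K r" "1/2" "2*m0"] by auto
        have e: "q r * A r - B r * p r \<le> \<kappa> r * (A r + B r) * A r" using elim r st by auto
        have "P' r * A r = (q r * A r - B r * p r) + p r * P r - 2 * m0 * \<kappa> r * A r * A r"
          unfolding P'_def P_def by (simp add: algebra_simps)
        \<comment> \<open>The smallness of \<open>\<integral> \<kappa>\<close> enters here: the
          barrier \<open>m\<close> stays below \<open>2 * m0\<close>, so its slope
          \<open>2 * m0 * \<kappa>\<close> is at least \<open>m * \<kappa>\<close>.\<close>
        also have "\<dots> \<le> \<kappa> r * (A r + B r) * A r + p r * P r - m r * \<kappa> r * A r * A r"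
        proof -
          have "m r * (\<kappa> r * A r * A r) \<le> 2 * m0 * (\<kappa> r * A r * A r)"
            using mr nonneg(3)[of r] Ar r st by (intro mult_right_mono) auto
          then show ?thesis using e by (simp add: mult_ac)
        qed
        also have "\<dots> = (\<kappa> r * A r + p r) * P r" unfolding P_def by (simp add: algebra_simps)
        also have "\<dots> \<le> (\<beta> r * A r) * P r"
        proof (rule mult_right_mono)
          have "p r \<le> \<bar>p r\<bar> / \<delta> * A r"
          proof -
            have "\<bar>p r\<bar> * \<delta> \<le> \<bar>p r\<bar> * A r" using Ar by (intro mult_left_mono) auto
            then have "\<bar>p r\<bar> \<le> \<bar>p r\<bar> / \<delta> * A r" using \<delta> by (simp add: field_simps)
            then show ?thesis by linarith
          qed
          then show "\<kappa> r * A r + p r \<le> \<beta> r * A r" unfolding \<beta>_def by (simp add: algebra_simps)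
        qed (use r in auto)
        finally have "P' r * A r \<le> (\<beta> r * P r) * A r" by (simp add: mult_ac)
        then show "P' r \<le> \<beta> r * P r" using Ar by simp
      qed
    qed
  qed (use st in auto)
  then have "A t + B t \<le> m t * A t" unfolding P_def by simp
  also have "\<dots> \<le> (2 * m0) * A t"
    using K_le[of t] st m0 nonneg(1)[of t] mult_left_mono[of "K t" "1/2" "2*m0"] unfolding m_def
    by (intro mult_right_mono) auto
  finally show ?thesis unfolding m0_def .
qed

text \<open>At a first zero \<open>T\<close> the frequency might blow up, but
  \<open>quotient_bound\<close> started at a time \<open>d\<close> shortly before \<open>T\<close>
  bounds it on \<open>{d..<T}\<close> by a constant that does not depend on the distance to
  \<open>T\<close>. Then \<open>lower\<close> reads \<open>p \<ge> - m (c + \<kappa>) A\<close> and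
  \<open>ac_no_zero\<close> excludes the zero.\<close>

lemma stays_positive:
  assumes st: "0 \<le> s" "s \<le> t" and "0 < A s"
  shows "0 < A t"
proof (rule ccontr)
  assume nt: "\<not> 0 < A t"
  have cont: "continuous_on {s..t} A" using continuous_on_subset[OF ac_from_continuous[OF A, of t]] st by auto
  let ?Z = "{r \<in> {s..t}. A r \<le> 0}"
  have "closed ?Z"
    using continuous_closed_preimage[OF cont, of "{..0}"] by (simp add: vimage_def Int_def)
  moreover have Z: "?Z \<noteq> {}" "bdd_below ?Z" using nt st by auto
  ultimately have "Inf ?Z \<in> ?Z" by (rule closed_contains_Inf[rotated 2])
  moreover define T where "T = Inf ?Z"
  ultimately have T: "s < T" "T \<le> t" "A T \<le> 0" using \<open>0 < A s\<close> by (auto simp: less_le)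
  have pos: "0 < A r" if "s \<le> r" "r < T" for r
  proof (rule ccontr)
    assume "\<not> 0 < A r"
    then have "r \<in> ?Z" using that T by auto
    then have "T \<le> r" unfolding T_def by (rule cInf_lower[OF _ Z(2)])
    then show False using that by simp
  qed
  obtain d where d: "s \<le> d" "d < T" "(LBINT r:{d..T}. \<kappa> r) \<le> 1/2"
    using primitive_small(2)[OF \<kappa>_Icc[OF st(1)] T(1)] by auto
  define m where "m = 2 * ((A d + B d) / A d)"
  have m: "0 \<le> m" unfolding m_def using nonneg[of d] d st by auto
  have "0 < A T"
  proof (rule ac_no_zero[where P=A and p=p and T=T and s=d and \<beta>="\<lambda>r. m * (c + \<kappa> r)"])
    show "ac_from d A p" by (rule ac_from_mono[OF A]) (use d st in auto)
    show "set_integrable lborel {d..T} (\<lambda>r. m * (c + \<kappa> r))"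
      using \<kappa>_Icc[of d T] d st
      by (intro set_integrable_mult_right set_integral_add(1)) (auto simp: set_integrable_def)
    show "0 \<le> m * (c + \<kappa> r)" if "d \<le> r" for r using nonneg(3)[of r] c m that d st by auto
    show "AE r in lborel. d \<le> r \<and> r < T \<longrightarrow> - (m * (c + \<kappa> r) * A r) \<le> p r"
      using lower
    proof eventually_elim
      case (elim r)
      show ?case
      proof
        assume r: "d \<le> r \<and> r < T"
        have "(LBINT x:{d..r}. \<kappa> x) \<le> 1/2"
        proof -
          have "0 \<le> (LBINT x:{r..T}. \<kappa> x)" using nonneg d st r by (intro set_integral_nonneg_Icc) auto
          then show ?thesis using set_integral_Icc_split[OF \<kappa>_Icc[of d T], of r] d(3) d st r by auto
        qed
        then have "A r + B r \<le> m * A r"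
          unfolding m_def using pos r d st by (intro quotient_bound) auto
        then have "(c + \<kappa> r) * (A r + B r) \<le> (c + \<kappa> r) * (m * A r)"
          using nonneg(3)[of r] c r d st by (intro mult_left_mono) auto
        then show "- (m * (c + \<kappa> r) * A r) \<le> p r" using elim r d st by (auto simp: mult_ac)
      qed
    qed
  qed (use d pos in auto)
  then show False using T by simp
qed

text \<open>Integrability of \<open>\<kappa>\<close> up to infinity enters here. For
  \<open>t < s\<close> the interval is empty and the integral is zero, so the bound may be stated
  for all \<open>t\<close>.\<close>

lemma tail_small:
  assumes "0 < e" "0 \<le> s0"
  shows "\<exists>s\<ge>s0. \<forall>t. (LBINT r:{s..t}. \<kappa> r) \<le> e"
proof -
  have lim: "(\<lambda>n. (LBINT r:{0..real n}. \<kappa> r)) \<longlonglongrightarrow> (LBINT r:{0..}. \<kappa> r)"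
  proof -
    have "(\<lambda>n. (LBINT r:{0..real n}. \<kappa> r)) \<longlonglongrightarrow> (LINT r:(\<Union>n. {0..real n})|lborel. \<kappa> r)"
    proof (rule set_integral_cont_up)
      have "(\<Union>n. {0..real n}) = {0..}" using real_arch_simple by auto
      then show "set_integrable lborel (\<Union>n. {0..real n}) \<kappa>" using \<kappa> by simp
    qed (auto simp: incseq_def)
    moreover have "(\<Union>n. {0..real n}) = {0..}" using real_arch_simple by auto
    ultimately show ?thesis by simp
  qed
  have le: "(LBINT r:{0..t}. \<kappa> r) \<le> (LBINT r:{0..}. \<kappa> r)" for t
    unfolding set_lebesgue_integral_def
    by (rule integral_mono_AE)
      (use \<kappa> \<kappa>_Icc[of 0 t] nonneg in \<open>auto simp: set_integrable_def indicator_def\<close>)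
  obtain n where n: "\<And>k. k \<ge> n \<Longrightarrow> \<bar>(LBINT r:{0..real k}. \<kappa> r) - (LBINT r:{0..}. \<kappa> r)\<bar> < e"
    using LIMSEQ_D[OF lim \<open>0 < e\<close>] by auto
  define k where "k = max n (nat \<lceil>s0\<rceil>)"
  have k: "s0 \<le> real k" "n \<le> k" unfolding k_def by linarith+
  have "(LBINT r:{real k..t}. \<kappa> r) \<le> e" for t
  proof (cases "real k \<le> t")
    case True
    have "(LBINT r:{0..t}. \<kappa> r) = (LBINT r:{0..real k}. \<kappa> r) + (LBINT r:{real k..t}. \<kappa> r)"
      by (rule set_integral_Icc_split[OF \<kappa>_Icc]) (use True in auto)
    then show ?thesis using le[of t] n[OF k(2)] by linarith
  qed (use assms in \<open>auto simp: set_lebesgue_integral_def\<close>)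
  then show ?thesis using k by blast
qed

text \<open>Two tails are used. From \<open>s\<close> on
  \<open>\<integral> \<kappa> \<le> 1/2\<close>, so the frequency stays below \<open>M\<close> for
  all later times. From \<open>T\<close> on \<open>\<integral> \<kappa> \<le> 1 / (2 * M)\<close>,
  so the barrier \<open>A T * (1 - M * K t) * exp (- M * c * (t - T))\<close> keeps at least half of
  its exponential. The constant part \<open>c\<close> of the rate goes into the exponential, the
  integrable part \<open>\<kappa>\<close> into the linear factor.\<close>

lemma exponential_lower_bound:
  assumes t0: "0 \<le> t0" "0 < A t0"
  shows "\<exists>m>0. \<exists>\<gamma>. \<exists>T. \<forall>t\<ge>T. m * exp (- \<gamma> * t) \<le> A t"
proof -
  have pos: "0 < A t" if "t0 \<le> t" for t using stays_positive[OF t0(1) that t0(2)] .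
  obtain s where s: "t0 \<le> s" "\<And>t. (LBINT r:{s..t}. \<kappa> r) \<le> 1/2"
    using tail_small[of "1/2" t0] t0 by auto
  define M where "M = 2 * ((A s + B s) / A s)"
  have M: "A t + B t \<le> M * A t" if "s \<le> t" for t
    unfolding M_def using that pos s t0 by (intro quotient_bound) auto
  have "M > 0"
    unfolding M_def using pos[of s] nonneg(2)[of s] s t0 by (auto intro!: divide_pos_pos add_pos_nonneg)
  obtain T where T: "s \<le> T" "\<And>t. (LBINT r:{T..t}. \<kappa> r) \<le> 1 / (2 * M)"
    using tail_small[of "1 / (2 * M)" s] \<open>M > 0\<close> s t0 by auto
  have T0: "0 \<le> T" using T s t0 by auto
  define K where "K t = (LBINT r:{T..t}. \<kappa> r)" for t
  have K: "ac_from T K \<kappa>" unfolding K_def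
    by (rule ac_from_integral) (use T0 \<kappa>_Icc in auto)
  have K_le: "0 \<le> K r \<and> M * K r \<le> 1/2" if "T \<le> r" for r
  proof
    show "0 \<le> K r" unfolding K_def using nonneg T0 by (intro set_integral_nonneg_Icc) auto
    show "M * K r \<le> 1/2"
      using mult_left_mono[OF T(2)[of r], of M] \<open>M > 0\<close> unfolding K_def by simp
  qed
  define \<gamma> where "\<gamma> = M * c"
  define E where "E t = exp (- \<gamma> * (t - T))" for t
  have E: "ac_from T E (\<lambda>t. - \<gamma> * E t)"
    unfolding E_def
    by (rule ac_from_deriv)
      (auto intro!: derivative_eq_intros continuous_intros simp: has_real_derivative_iff_has_vector_derivative[symmetric])
  define m where "m t = A T + (- (A T * M)) * K t" for t
  have m: "ac_from T m (\<lambda>t. 0 + (- (A T * M)) * \<kappa> t)"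
    unfolding m_def by (intro ac_from_add ac_from_const ac_from_cmult K)
  have AT: "0 < A T" using pos T s by auto
  have K0: "K T = 0" unfolding K_def by (rule set_integral_Icc_self)
  have m_le: "A T / 2 \<le> m t \<and> m t \<le> A T" if "T \<le> t" for t
    using mult_left_mono[of "M * K t" "1/2" "A T"] K_le[OF that] AT \<open>M > 0\<close> unfolding m_def by auto
  define P where "P t = m t * E t - A t" for t
  define P' where "P' t = ((0 + (- (A T * M)) * \<kappa> t) * E t + m t * (- \<gamma> * E t)) - p t" for t
  have P: "ac_from T P P'"
    unfolding P_def P'_def
    by (intro ac_from_diff ac_from_prod[OF bounded_bilinear_mult] m E ac_from_mono[OF A T0])
  have Pt: "P t \<le> 0" if "T \<le> t" for t
  proof (rule ac_gronwall[OF P, where T=t and \<beta>="\<lambda>_. 0"])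
    show "P T \<le> 0" unfolding P_def m_def E_def K0 by simp
    show "AE r in lborel. T \<le> r \<and> r \<le> t \<and> 0 < P r \<longrightarrow> P' r \<le> 0 * P r"
      using lower
    proof eventually_elim
      case (elim r)
      show ?case
      proof (intro impI, elim conjE)
        assume r: "T \<le> r" "r \<le> t" "0 < P r"
        have E0: "E r > 0" unfolding E_def by simp
        have \<kappa>0: "0 \<le> \<kappa> r" using nonneg(3) r T0 by auto
        have "m r * (M * \<kappa> r * E r) \<le> A T * (M * \<kappa> r * E r)"
          using m_le[OF r(1)] \<open>M > 0\<close> \<kappa>0 E0 by (intro mult_right_mono) auto
        moreover have "- p r \<le> (c + \<kappa> r) * (M * A r)"
        proof -
          have "(c + \<kappa> r) * (A r + B r) \<le> (c + \<kappa> r) * (M * A r)"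
            using M[of r] c \<kappa>0 r T by (intro mult_left_mono) auto
          then show ?thesis using elim r T0 by auto
        qed
        \<comment> \<open>Since \<open>m r \<le> A T\<close>, the slope
          \<open>- A T * M * \<kappa>\<close> of \<open>m\<close> is at most
          \<open>- m * M * \<kappa>\<close>; both parts of the rate then appear as multiples of
          \<open>P\<close> itself.\<close>
        ultimately have "P' r \<le> - ((c + \<kappa> r) * M) * P r"
          unfolding P'_def P_def \<gamma>_def by (simp add: algebra_simps)
        also have "\<dots> \<le> 0" using c \<kappa>0 \<open>M > 0\<close> r by (auto intro!: mult_nonneg_nonneg simp: mult_le_0_iff)
        finally show "P' r \<le> 0 * P r" by simp
      qed
    qed
    show "set_integrable lborel {T..t} (\<lambda>_. 0::real)" by (simp add: set_integrable_def)
  qed (use that in auto)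
  have "(A T / 2 * exp (\<gamma> * T)) * exp (- \<gamma> * t) \<le> A t" if "T \<le> t" for t
  proof -
    have "A T / 2 * E t \<le> m t * E t" using m_le[OF that] by (intro mult_right_mono) (auto simp: E_def)
    also have "\<dots> \<le> A t" using Pt[OF that] unfolding P_def by simp
    finally show ?thesis unfolding E_def by (simp add: exp_add[symmetric] algebra_simps)
  qed
  then show ?thesis using AT by (intro exI[of _ "A T / 2 * exp (\<gamma> * T)"]) auto
qed

text \<open>The exponent \<open>\<gamma>\<close> of the lower bound depends on the solution, which
  is why decay is required at every rate \<open>r\<close>.\<close>

lemma vanishes:
  assumes decay: "\<And>r. ((\<lambda>t. exp (r * t) * A t) \<longlongrightarrow> 0) at_top" and "0 \<le> t"
  shows "A t = 0"
proof (rule ccontr)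
  assume "A t \<noteq> 0"
  then have "0 < A t" using nonneg(1)[OF \<open>0 \<le> t\<close>] by simp
  then obtain m \<gamma> T where m: "m > 0" "\<And>t. t \<ge> T \<Longrightarrow> m * exp (- \<gamma> * t) \<le> A t"
    using exponential_lower_bound[OF \<open>0 \<le> t\<close>] by blast
  have "eventually (\<lambda>t. m \<le> exp (\<gamma> * t) * A t) at_top"
    using eventually_ge_at_top[of T]
  proof eventually_elim
    case (elim t)
    have "exp (\<gamma> * t) * (m * exp (- \<gamma> * t)) \<le> exp (\<gamma> * t) * A t"
      using m(2)[OF elim] by (intro mult_left_mono) auto
    then show ?case by (simp add: exp_minus field_simps)
  qed
  moreover have "eventually (\<lambda>t. exp (\<gamma> * t) * A t < m) at_top"
    using order_tendstoD(2)[OF decay[of \<gamma>] m(1)] .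
  ultimately have "eventually (\<lambda>t::real. False) at_top" by eventually_elim auto
  then show False by simp
qed

end

section \<open>Test functions\<close>

text \<open>From \<open>(1 + y / n) ^ n \<le> exp y\<close> with \<open>y = 1 / w\<close> and
  \<open>n = k + 2\<close>. The exponent is two larger than \<open>k\<close> so that a factor
  \<open>w^2\<close> survives the division by \<open>w ^ k\<close>.\<close>

lemma exp_minus_inverse_le:
  fixes w :: real
  assumes "0 < w"
  shows "exp (- (1/w)) / w ^ k \<le> real (k+2) ^ (k+2) * w\<^sup>2"
proof -
  let ?n = "k + 2"
  have "(1 / (real ?n * w)) ^ ?n \<le> (1 + (1/w) / real ?n) ^ ?n"
    using assms by (intro power_mono) (auto simp: field_simps)
  also have "\<dots> \<le> exp (1/w)"
    by (rule exp_ge_one_plus_x_over_n_power_n) (use assms in \<open>auto intro: order_trans[of _ 0]\<close>)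
  finally have "inverse (exp (1/w)) \<le> inverse ((1 / (real ?n * w)) ^ ?n)"
    using assms by (intro le_imp_inverse_le zero_less_power) auto
  then have "exp (- (1/w)) \<le> (real ?n * w) ^ ?n"
    by (simp only: exp_minus inverse_eq_divide power_one_over div_by_1 divide_divide_eq_right mult_1)
  also have "\<dots> = real ?n ^ ?n * w\<^sup>2 * w ^ k"
    by (simp add: power_mult_distrib power_add power2_eq_square)
  finally show ?thesis using assms by (simp add: pos_divide_le_eq)
qed

definition bump :: "real \<Rightarrow> real \<Rightarrow> real \<Rightarrow> real poly \<Rightarrow> nat \<Rightarrow> real \<Rightarrow> real" where
  "bump c p q R k x = (if p < x \<and> x < q
     then poly R x * (exp (- (1 / (c * (x - p) * (q - x)))) / (c * (x - p) * (q - x)) ^ k) else 0)"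

text \<open>
  For \<open>W = c (x - p) (q - x)\<close> the functions \<open>R exp (- 1 / W) / W ^ k\<close>, extended by zero, form a
  class closed under differentiation.
\<close>

definition bump_deriv :: "real \<Rightarrow> real \<Rightarrow> real \<Rightarrow> real poly \<Rightarrow> nat \<Rightarrow> real poly" where
  "bump_deriv c p q R k = (let W = smult c ([:-p, 1:] * [:q, -1:]) in
     pderiv R * W\<^sup>2 + R * pderiv W - of_nat k * R * pderiv W * W)"

text \<open>Near an endpoint \<open>x\<close> the weight \<open>w\<close> is at most
  \<open>c * (q - p) * \<bar>y - x\<bar>\<close>, so the surviving factor \<open>w^2\<close> is
  quadratic in \<open>y - x\<close>. A quadratic bound at \<open>x\<close> yields the vanishing
  derivative there without any one-sided analysis.\<close>

lemma bump_bound: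
  assumes "0 < c" "p < q"
  shows "\<exists>C. \<forall>x y. (x = p \<or> x = q) \<longrightarrow> \<bar>bump c p q R k y\<bar> \<le> C * (y - x)\<^sup>2"
proof -
  have "bounded ((poly R) ` {p..q})"
    by (intro compact_imp_bounded compact_continuous_image continuous_intros compact_Icc)
  then obtain D where "D > 0" "\<forall>z \<in> poly R ` {p..q}. norm z \<le> D"
    unfolding bounded_pos by blast
  then have D: "\<And>y. y \<in> {p..q} \<Longrightarrow> \<bar>poly R y\<bar> \<le> D" "D > 0" by auto
  let ?N = "real (k+2) ^ (k+2)"
  have "\<bar>bump c p q R k y\<bar> \<le> (D * ?N * c\<^sup>2 * (q - p)\<^sup>2) * (y - x)\<^sup>2" if x: "x = p \<or> x = q" for x y
  proof (cases "p < y \<and> y < q")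
    case True
    define w where "w = c * (y - p) * (q - y)"
    have w: "0 < w" unfolding w_def using True assms by auto
    have "\<bar>bump c p q R k y\<bar> = \<bar>poly R y\<bar> * (exp (- (1/w)) / w ^ k)"
      using True w unfolding bump_def w_def[symmetric] by (simp add: abs_mult)
    also have "\<dots> \<le> D * (?N * w\<^sup>2)"
      using D True w exp_minus_inverse_le[OF w, of k] by (intro mult_mono) auto
    also have "w\<^sup>2 \<le> c\<^sup>2 * (q - p)\<^sup>2 * (y - x)\<^sup>2"
    proof -
      have "w \<le> c * (q - p) * \<bar>y - x\<bar>"
      proof -
        have "(y - p) * (q - y) \<le> (q - p) * \<bar>y - x\<bar>"
          using x True mult_right_mono[of "q - y" "q - p" "y - p"] mult_right_mono[of "y - p" "q - p" "q - y"]
          by (auto simp: mult_ac abs_if)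
        then show ?thesis unfolding w_def using assms by (simp add: mult.assoc)
      qed
      then have "w\<^sup>2 \<le> (c * (q - p) * \<bar>y - x\<bar>)\<^sup>2" using w by (intro power_mono) auto
      then show ?thesis by (simp add: power_mult_distrib)
    qed
    finally show ?thesis using D by (simp add: mult_ac)
  next
    case False
    then have "bump c p q R k y = 0" by (auto simp: bump_def)
    then show ?thesis using D assms by simp
  qed
  then show ?thesis by blast
qed

text \<open>The left side is what the product and quotient rules produce. The case
  \<open>k = 0\<close> is separate because \<open>k - 1\<close> is truncated; there the factor
  \<open>real k\<close> removes the term.\<close>

lemma bump_deriv_algebra:
  fixes w :: real
  assumes w: "0 < w"
  shows "r * ((e * (w' / w\<^sup>2) * w ^ k - e * (real k * (w' * w ^ (k - 1)))) / (w ^ k * w ^ k)) + r' * (e / w ^ k) =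
    (r' * w\<^sup>2 + r * w' - real k * r * w' * w) * (e / w ^ (k + 2))"
proof (cases k)
  case 0
  then show ?thesis using w by (simp add: field_simps power2_eq_square)
next
  case (Suc j)
  define v where "v = w ^ j"
  have v: "0 < v" using w unfolding v_def by simp
  have e: "w ^ k = w * v" "w ^ (k - 1) = v" "w ^ (k + 2) = w * v * (w * w)"
    unfolding Suc v_def by (simp_all add: mult_ac)
  have "r * ((e * (w' / (w * w)) * (w * v) - e * (n * (w' * v))) / (w * v * (w * v))) + r' * (e / (w * v)) =
    (r' * (w * w) + r * w' - n * r * w' * w) * (e / (w * v * (w * w)))" for n
    using w v by (simp add: divide_simps) (simp add: algebra_simps)
  then show ?thesis unfolding e power2_eq_square .
qed

lemma bump_has_deriv:
  assumes c: "0 < c" and pq: "p < q"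
  shows "(bump c p q R k has_real_derivative bump c p q (bump_deriv c p q R k) (k + 2) x) (at x)"
proof -
  consider "x < p" | "x > q" | "x = p \<or> x = q" | "p < x" "x < q" by linarith
  then show ?thesis
  proof cases
    case 1
    have "((\<lambda>_. 0) has_real_derivative 0) (at x)" by simp
    then have "(bump c p q R k has_real_derivative 0) (at x)"
      by (rule has_field_derivative_transform_within_open[where S="{..<p}"]) (use 1 in \<open>auto simp: bump_def\<close>)
    then show ?thesis using 1 by (simp add: bump_def)
  next
    case 2
    have "((\<lambda>_. 0) has_real_derivative 0) (at x)" by simp
    then have "(bump c p q R k has_real_derivative 0) (at x)"
      by (rule has_field_derivative_transform_within_open[where S="{q<..}"]) (use 2 in \<open>auto simp: bump_def\<close>)
    then show ?thesis using 2 by (simp add: bump_def)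
  next
    case 3
    obtain C where C: "\<And>y. \<bar>bump c p q R k y\<bar> \<le> C * (y - x)\<^sup>2" using bump_bound[OF c pq] 3 by metis
    have z: "bump c p q S j x = 0" for S j using 3 by (auto simp: bump_def)
    have "((\<lambda>y. (bump c p q R k y - bump c p q R k x) / (y - x)) \<longlongrightarrow> 0) (at x)"
    proof (rule Lim_null_comparison)
      show "\<forall>\<^sub>F y in at x. norm ((bump c p q R k y - bump c p q R k x) / (y - x)) \<le> C * \<bar>y - x\<bar>"
        unfolding eventually_at_filter
      proof (rule always_eventually, intro allI impI)
        fix y assume "y \<noteq> x"
        then show "norm ((bump c p q R k y - bump c p q R k x) / (y - x)) \<le> C * \<bar>y - x\<bar>"
          using C[of y] z[of R k] by (simp add: abs_divide pos_divide_le_eq power2_eq_square abs_mult[symmetric] mult_ac)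
      qed
      show "((\<lambda>y. C * \<bar>y - x\<bar>) \<longlongrightarrow> 0) (at x)"
        by (auto intro!: tendsto_eq_intros)
    qed
    then show ?thesis unfolding has_field_derivative_iff using z by simp
  next
    case 4
    define W where "W = smult c ([:-p, 1:] * [:q, -1:])"
    have W: "poly W y = c * (y - p) * (q - y)" for y unfolding W_def by (simp add: algebra_simps)
    have Wx: "0 < poly W x" unfolding W using 4 c by auto
    have "((\<lambda>y. poly R y * (exp (- (1 / poly W y)) / poly W y ^ k)) has_real_derivative
       poly (bump_deriv c p q R k) x * (exp (- (1 / poly W x)) / poly W x ^ (k + 2))) (at x)"
    proof -
      have dE: "((\<lambda>y. exp (- (1 / poly W y))) has_real_derivative
          exp (- (1 / poly W x)) * (poly (pderiv W) x / (poly W x)\<^sup>2)) (at x)"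
        using Wx by (auto intro!: derivative_eq_intros simp: power2_eq_square field_simps)
      have dV: "((\<lambda>y. poly W y ^ k) has_real_derivative real k * (poly (pderiv W) x * poly W x ^ (k - 1))) (at x)"
        by (auto intro!: derivative_eq_intros)
      have "((\<lambda>y. poly R y * (exp (- (1 / poly W y)) / poly W y ^ k)) has_real_derivative
          poly R x * ((exp (- (1 / poly W x)) * (poly (pderiv W) x / (poly W x)\<^sup>2) * poly W x ^ k
            - exp (- (1 / poly W x)) * (real k * (poly (pderiv W) x * poly W x ^ (k - 1)))) / (poly W x ^ k * poly W x ^ k))
          + poly (pderiv R) x * (exp (- (1 / poly W x)) / poly W x ^ k)) (at x)"
        by (rule DERIV_mult'[OF poly_DERIV DERIV_divide[OF dE dV]]) (use Wx in simp)
      then show ?thesis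
        unfolding bump_deriv_def W_def[symmetric] Let_def bump_deriv_algebra[OF Wx]
        by (simp add: of_nat_poly mult_ac)
    qed
    then have "(bump c p q R k has_real_derivative
       poly (bump_deriv c p q R k) x * (exp (- (1 / poly W x)) / poly W x ^ (k + 2))) (at x)"
      by (rule has_field_derivative_transform_within_open[where S="{p<..<q}"]) (use 4 in \<open>auto simp: bump_def W\<close>)
    then show ?thesis using 4 by (simp add: bump_def W)
  qed
qed

lemma bump_smooth:
  assumes c: "0 < c" and pq: "p < q"
  shows "(deriv ^^ n) (bump c p q R k) differentiable (at x)"
proof (induction n arbitrary: R k)
  case 0
  show ?case using bump_has_deriv[OF assms] by (auto simp: real_differentiable_def)
next
  case (Suc n)
  have "deriv (bump c p q R k) = bump c p q (bump_deriv c p q R k) (k + 2)"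
    by (intro ext DERIV_imp_deriv bump_has_deriv assms)
  then show ?case using Suc by (simp add: funpow_Suc_right del: funpow.simps)
qed

text \<open>The exponent is \<open>- 1 / ((n + 1) (x - p) (q - x))\<close>: as \<open>n\<close>
  grows the functions increase to the indicator of the open interval while staying below 1.
  \<open>Suc n\<close> keeps the scale positive.\<close>

definition bump1 :: "real \<Rightarrow> real \<Rightarrow> nat \<Rightarrow> real \<Rightarrow> real" where
  "bump1 p q n = bump (real (Suc n)) p q 1 0"

lemma bump1_bounds: "0 \<le> bump1 p q n x" "bump1 p q n x \<le> 1"
  by (auto simp: bump1_def bump_def)

lemma bump1_eq_0: "x \<le> p \<or> q \<le> x \<Longrightarrow> bump1 p q n x = 0"
  by (auto simp: bump1_def bump_def)

lemma bump1_tendsto: "(\<lambda>n. bump1 p q n x) \<longlonglongrightarrow> indicator {p<..<q} x"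
proof (cases "p < x \<and> x < q")
  case True
  have "(\<lambda>n. exp (- (inverse (real (Suc n)) * (1 / ((x - p) * (q - x)))))) \<longlonglongrightarrow> exp (- (0 * (1 / ((x - p) * (q - x)))))"
    by (intro tendsto_intros LIMSEQ_inverse_real_of_nat)
  then show ?thesis using True by (simp add: bump1_def bump_def field_simps)
qed (auto simp: bump1_def bump_def)

lemma bump1_smooth: "p < q \<Longrightarrow> (deriv ^^ n) (bump1 p q m) differentiable (at x)"
  unfolding bump1_def by (rule bump_smooth) auto

lemma bump1_has_deriv: "p < q \<Longrightarrow> (bump1 p q m has_real_derivative deriv (bump1 p q m) x) (at x)"
  using bump1_smooth[of p q 0 m x] by (simp add: DERIV_deriv_iff_real_differentiable)

lemma bump1_continuous: "p < q \<Longrightarrow> continuous_on S (bump1 p q m)"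
  by (meson DERIV_continuous_on bump1_has_deriv has_field_derivative_at_within)

lemma bump1_set_integrable: "p < q \<Longrightarrow> set_integrable lborel {a..b} (bump1 p q m)"
  unfolding set_integrable_def by (rule borel_integrable_compact) (auto intro: bump1_continuous)

lemma bump1_integral_pos:
  assumes "p < q" "a \<le> p" "q \<le> b" shows "0 < (LBINT x:{a..b}. bump1 p q m x)"
proof -
  have i: "bump1 p q m integrable_on {a..b}"
    using set_borel_integral_eq_integral(1)[OF bump1_set_integrable[OF assms(1)]] .
  have "integral {a..b} (bump1 p q m) \<noteq> 0"
  proof
    assume "integral {a..b} (bump1 p q m) = 0"
    then have "(bump1 p q m has_integral 0) {a..b}" using i by (metis integrable_integral)
    then have "bump1 p q m ((p+q)/2) = 0"
      using has_integral_0_cbox_imp_0[of a b "bump1 p q m" "(p+q)/2"] assms bump1_continuous bump1_bounds by auto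
    moreover have "bump1 p q m ((p+q)/2) > 0" using assms(1) by (simp add: bump1_def bump_def)
    ultimately show False by simp
  qed
  moreover have "0 \<le> integral {a..b} (bump1 p q m)" using i bump1_bounds by (intro integral_nonneg) auto
  ultimately show ?thesis
    using set_borel_integral_eq_integral(2)[OF bump1_set_integrable[OF assms(1)], of a b m] by simp
qed

text \<open>The primitive from the left vanishes left of \<open>p\<close>; the condition that
  \<open>\<psi>\<close> has mean zero is exactly what makes it vanish right of \<open>q\<close> as
  well.\<close>

lemma antiderivative_test_function:
  fixes \<psi> :: "real \<Rightarrow> real"
  assumes smooth: "\<And>n x. (deriv ^^ n) \<psi> differentiable (at x)"
    and supp: "\<And>x. x \<le> p \<or> q \<le> x \<Longrightarrow> \<psi> x = 0" and pq: "p < q"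
    and zero: "(LBINT x:{p..q}. \<psi> x) = 0" and S: "{p..q} \<subseteq> S"
  shows "\<exists>\<eta>. \<eta> \<in> test_functions S \<and> deriv \<eta> = \<psi> \<and> (\<forall>x. x \<le> p \<or> q \<le> x \<longrightarrow> \<eta> x = 0)
    \<and> (\<forall>x. (\<eta> has_real_derivative \<psi> x) (at x)) \<and> continuous_on UNIV \<psi>"
proof -
  have d\<psi>: "\<psi> differentiable (at x)" for x using smooth[of 0] by simp
  have cont: "continuous_on T \<psi>" for T
    using d\<psi> by (meson differentiable_imp_continuous_within continuous_at_imp_continuous_on)
  \<comment> \<open>The integral starts at \<open>p - 1\<close>, so that \<open>p\<close> itself is
    interior to the interval on which the fundamental theorem is applied.\<close>
  define \<eta> where "\<eta> x = integral {p-1..x} \<psi>" for x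
  have left: "\<eta> x = 0" if "x \<le> p" for x
  proof -
    have "integral {p-1..x} \<psi> = integral {p-1..x} (\<lambda>_. 0)"
      by (rule Henstock_Kurzweil_Integration.integral_cong) (use supp that in auto)
    then show ?thesis unfolding \<eta>_def by simp
  qed
  have io: "\<psi> integrable_on {a..b}" for a b by (intro integrable_continuous_real cont)
  have right: "\<eta> x = 0" if "q \<le> x" for x
  proof -
    have "\<eta> x = \<eta> p + integral {p..x} \<psi>"
      unfolding \<eta>_def by (subst Henstock_Kurzweil_Integration.integral_combine[OF _ _ io]) (use pq that in auto)
    also have "integral {p..x} \<psi> = integral {p..q} \<psi> + integral {q..x} \<psi>"
      by (subst Henstock_Kurzweil_Integration.integral_combine[OF _ _ io]) (use pq that in auto)
    also have "integral {q..x} \<psi> = integral {q..x} (\<lambda>_. 0)"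
      by (rule Henstock_Kurzweil_Integration.integral_cong) (use supp that in auto)
    also have "integral {p..q} \<psi> = 0"
    proof -
      have "set_integrable lborel {p..q} \<psi>"
        unfolding set_integrable_def by (rule borel_integrable_compact) (auto intro: cont)
      then show ?thesis using zero set_borel_integral_eq_integral(2) by metis
    qed
    finally show ?thesis using left[of p] by simp
  qed
  have der: "(\<eta> has_real_derivative \<psi> x) (at x)" for x
  proof (cases "x < p")
    case True
    have "((\<lambda>_. 0) has_real_derivative 0) (at x)" by simp
    then have "(\<eta> has_real_derivative 0) (at x)"
      by (rule has_field_derivative_transform_within_open[where S="{..<p}"]) (use True left in auto)
    then show ?thesis using True supp by simp
  next
    case False
    have "(\<eta> has_real_derivative \<psi> x) (at x within {p-1..x+1})"
      unfolding \<eta>_def by (rule integral_has_real_derivative[OF cont]) (use False in auto)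
    then show ?thesis
      using at_within_interior[of x "{p-1..x+1}"] False by auto
  qed
  have d\<eta>: "deriv \<eta> = \<psi>" by (intro ext DERIV_imp_deriv der)
  have "\<eta> \<in> test_functions S"
    unfolding test_functions_def
  proof (intro CollectI conjI allI)
    show "(deriv ^^ n) \<eta> differentiable (at x)" for n x
    proof (cases n)
      case 0
      then show ?thesis using der by (auto simp: real_differentiable_def)
    next
      case (Suc m)
      then show ?thesis using smooth[of m x] d\<eta> by (simp add: funpow_Suc_right del: funpow.simps)
    qed
    have "{x. \<eta> x \<noteq> 0} \<subseteq> {p..q}"
    proof
      fix x assume "x \<in> {x. \<eta> x \<noteq> 0}"
      then have "\<not> x \<le> p" "\<not> q \<le> x" using left[of x] right[of x] by auto
      then show "x \<in> {p..q}" by simp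
    qed
    then have cl: "closure {x. \<eta> x \<noteq> 0} \<subseteq> {p..q}" by (intro closure_minimal) auto
    show "compact (closure {x. \<eta> x \<noteq> 0})"
      using cl by (meson bounded_closed_interval bounded_subset closed_closure compact_eq_bounded_closed)
    show "closure {x. \<eta> x \<noteq> 0} \<subseteq> S" using cl S by simp
  qed
  then show ?thesis using d\<eta> left right der cont by (intro exI[of _ \<eta>]) auto
qed

lemma smooth_scaled_diff:
  fixes f g :: "real \<Rightarrow> real"
  assumes f: "\<And>n x. (deriv ^^ n) f differentiable (at x)" and g: "\<And>n x. (deriv ^^ n) g differentiable (at x)"
  shows "(deriv ^^ n) (\<lambda>x. f x - c * g x) differentiable (at x)"
proof -
  have "(deriv ^^ n) (\<lambda>x. f x - c * g x) = (\<lambda>x. (deriv ^^ n) f x - c * (deriv ^^ n) g x)"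
  proof (induction n)
    case (Suc n)
    have "deriv (\<lambda>x. (deriv ^^ n) f x - c * (deriv ^^ n) g x) y = deriv ((deriv ^^ n) f) y - c * deriv ((deriv ^^ n) g) y" for y
      by (intro DERIV_imp_deriv DERIV_diff DERIV_cmult) (simp_all add: DERIV_deriv_iff_real_differentiable f g)
    then show ?case using Suc by auto
  qed simp
  then show ?thesis by (auto intro!: derivative_intros f g)
qed

section \<open>The lemma of du Bois-Reymond\<close>

text \<open>Lebesgue differentiation in the form \<open>integrable_ccontinuous_explicit\<close>: in
  dimension one the cube with lower corner \<open>x\<close> and side \<open>r\<close> is
  \<open>{x..x+r}\<close>, so the averages are one-sided.\<close>

lemma AE_right_average_tendsto:
  fixes h :: "real \<Rightarrow> 'a::euclidean_space"
  assumes "\<And>a b. set_integrable lborel {a..b} h"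
  shows "AE x in lborel. ((\<lambda>e. (LBINT r:{x..x+e}. h r) /\<^sub>R e) \<longlongrightarrow> h x) (at_right 0)"
proof -
  have "h integrable_on cbox a b" for a b
    using set_borel_integral_eq_integral(1)[OF assms] by simp
  then obtain N where N: "negligible N"
    "\<And>x e. \<lbrakk>x \<notin> N; 0 < e\<rbrakk> \<Longrightarrow> \<exists>d>0. \<forall>r. 0 < r \<and> r < d \<longrightarrow>
       norm (integral (cbox x (x + r *\<^sub>R One)) h /\<^sub>R r ^ DIM(real) - h x) < e"
    using integrable_ccontinuous_explicit[of h] by blast
  have "((\<lambda>e. (LBINT r:{x..x+e}. h r) /\<^sub>R e) \<longlongrightarrow> h x) (at_right 0)" if x: "x \<notin> N" for x
  proof (rule tendstoI)
    fix e :: real assume "0 < e"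
    then obtain d where d: "d > 0" "\<And>r. 0 < r \<and> r < d \<Longrightarrow> norm (integral (cbox x (x + r *\<^sub>R One)) h /\<^sub>R r ^ DIM(real) - h x) < e"
      using N(2)[OF x] by blast
    show "\<forall>\<^sub>F r in at_right 0. dist ((LBINT s:{x..x+r}. h s) /\<^sub>R r) (h x) < e"
      unfolding eventually_at_right_field
    proof (intro exI[of _ d] conjI allI impI)
      fix r :: real assume "0 < r" "r < d"
      then show "dist ((LBINT s:{x..x+r}. h s) /\<^sub>R r) (h x) < e"
        using d(2)[of r] set_borel_integral_eq_integral(2)[OF assms, of x "x+r"] by (simp add: dist_norm)
    qed (use d in auto)
  qed
  moreover have "AE x in lborel. x \<notin> N"
    using N(1) unfolding negligible_iff_null_sets by (metis AE_completion_iff AE_not_in)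
  ultimately show ?thesis by (auto elim: AE_mp)
qed

lemma inverse_Suc_at_right: "filterlim (\<lambda>n. inverse (real (Suc n))) (at_right 0) sequentially"
  by (intro tendsto_imp_filterlim_at_right LIMSEQ_inverse_real_of_nat) auto

text \<open>The primitive \<open>E\<close> takes the same value at all rationals beyond
  \<open>a\<close>, hence is constant there by continuity, and the one-sided averages of
  \<open>h\<close> vanish. Rational endpoints keep the number of test functions countable.\<close>

lemma AE_zero_of_rational_integrals:
  fixes h :: "real \<Rightarrow> 'a::euclidean_space"
  assumes h: "\<And>t. set_integrable lborel {a..t} h"
    and zero: "\<And>p q. p \<in> \<rat> \<Longrightarrow> q \<in> \<rat> \<Longrightarrow> a < p \<Longrightarrow> p < q \<Longrightarrow> (LBINT r:{p..q}. h r) = 0"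
  shows "AE x in lborel. a < x \<longrightarrow> h x = 0"
proof -
  define E where "E t = (LBINT r:{a..t}. h r)" for t
  have E: "ac_from a E h" unfolding E_def by (rule ac_from_integral[OF h])
  have eqp: "E x = E p" if p: "p \<in> \<rat>" "a < p" and x: "p < x" for x p
  proof -
    let ?S = "{p<..<x+1} \<inter> \<rat>"
    have cl: "closure ?S = {p..x+1}"
    proof -
      have "closure ({p<..<x+1} \<inter> \<rat>) = closure {p<..<x+1}"
        using closure_open_Int_superset[of "{p<..<x+1}" "\<rat>::real set"] Rats_closure_real by simp
      then show ?thesis using x by simp
    qed
    have "continuous_on {p..x+1} E" by (rule continuous_on_subset[OF ac_from_continuous[OF E, of "x+1"]]) (use p in auto)
    then show ?thesis
    proof (intro continuous_constant_on_closure[of ?S E "E p" x])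
      show "E y = E p" if "y \<in> ?S" for y
        using ac_fromD(2)[OF E, of p y] zero[of p y] p that by auto
    qed (use cl x in auto)
  qed
  \<comment> \<open>The differentiation theorem needs integrability on every bounded interval of the
    line, so \<open>h\<close> is cut off to the left of \<open>a\<close>.\<close>
  define h' where "h' x = indicator {a<..} x *\<^sub>R h x" for x
  have "set_integrable lborel {s..t} h'" for s t
  proof -
    have "set_integrable lborel ({s..t} \<inter> {a<..}) h"
      by (rule set_integrable_subset[OF h[of t]]) auto
    moreover have "(\<lambda>x. indicator ({s..t} \<inter> {a<..}) x *\<^sub>R h x) = (\<lambda>x. indicator {s..t} x *\<^sub>R h' x)"
      by (auto simp: h'_def indicator_def)
    ultimately show ?thesis by (simp add: set_integrable_def)
  qed
  from AE_right_average_tendsto[OF this]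
  show ?thesis
  proof eventually_elim
    case (elim x)
    show ?case
    proof
      assume x: "a < x"
      obtain p' where p': "p' \<in> \<rat>" "a < p'" "p' < x" using Rats_dense_in_real[of a x] x by auto
      have Ec: "E y = E x" if "x < y" for y
        using eqp[OF p'(1,2), of y] eqp[OF p'(1,2,3)] p'(3) that by simp
      have "(LBINT r:{x..x+e}. h' r) /\<^sub>R e = 0" if "0 < e" for e
      proof -
        have "(LBINT r:{x..x+e}. h' r) = (LBINT r:{x..x+e}. h r)"
          unfolding set_lebesgue_integral_def
          by (rule Bochner_Integration.integral_cong) (use x in \<open>auto simp: h'_def indicator_def\<close>)
        also have "\<dots> = E (x+e) - E x" using ac_fromD(2)[OF E, of x "x+e"] x that by auto
        finally show ?thesis using Ec[of "x+e"] that by simp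
      qed
      then have "((\<lambda>e. (LBINT r:{x..x+e}. h' r) /\<^sub>R e) \<longlongrightarrow> 0) (at_right 0)"
        by (intro tendsto_eventually) (auto simp: eventually_at_right_field intro!: exI[of _ 1])
      then have "h' x = 0" using elim tendsto_unique[of "at_right (0::real)"] by auto
      then show "h x = 0" using x by (simp add: h'_def)
    qed
  qed
qed


lemma bump1_measurable: "p < q \<Longrightarrow> bump1 p q n \<in> borel_measurable borel"
  by (intro borel_measurable_continuous_onI bump1_continuous)

lemma norm_bump1_scaleR_le:
  fixes y :: "'a::euclidean_space"
  assumes "{p..q} \<subseteq> S"
  shows "norm (bump1 p q n x *\<^sub>R y) \<le> norm (indicator S x *\<^sub>R y)"
proof (cases "x \<in> S")
  case True
  then show ?thesis using bump1_bounds[of p q n x] by (simp add: mult_left_le_one_le)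
next
  case False
  then have "x \<notin> {p..q}" using assms by blast
  then have "x \<le> p \<or> q \<le> x" by auto
  then show ?thesis by (simp add: bump1_eq_0)
qed

lemma bump1_integrable:
  fixes F :: "real \<Rightarrow> 'a::euclidean_space"
  assumes F: "set_integrable lborel {a..b} F" and ab: "a \<le> p" "p < q" "q \<le> b"
  shows "integrable lborel (\<lambda>x. bump1 p q n x *\<^sub>R F x)"
proof (rule Bochner_Integration.integrable_bound)
  show "integrable lborel (\<lambda>x. indicator {a..b} x *\<^sub>R F x)" using F by (simp add: set_integrable_def)
  have [measurable]: "(\<lambda>x. indicator {a..b} x *\<^sub>R F x) \<in> borel_measurable borel"
    using F by (simp add: set_integrable_def borel_measurable_integrable[of lborel, simplified])
  note [measurable] = bump1_measurable[OF ab(2)]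
  \<comment> \<open>\<open>F\<close> may fail to be measurable outside \<open>{a..b}\<close>; only
    its truncation is known to be, and the bump does not see the difference.\<close>
  have "(\<lambda>x. bump1 p q n x *\<^sub>R F x) = (\<lambda>x. bump1 p q n x *\<^sub>R (indicator {a..b} x *\<^sub>R F x))"
  proof
    fix x show "bump1 p q n x *\<^sub>R F x = bump1 p q n x *\<^sub>R (indicator {a..b} x *\<^sub>R F x)"
      using ab by (cases "x \<le> p \<or> q \<le> x") (auto simp: indicator_def bump1_eq_0)
  qed
  then show "(\<lambda>x. bump1 p q n x *\<^sub>R F x) \<in> borel_measurable lborel"
    unfolding measurable_lborel2 by (rule ssubst) measurable
  show "AE x in lborel. norm (bump1 p q n x *\<^sub>R F x) \<le> norm (indicator {a..b} x *\<^sub>R F x)"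
    by (intro AE_I2 norm_bump1_scaleR_le) (use ab in auto)
qed

lemma integral_eq_set_integral_Icc:
  fixes f :: "real \<Rightarrow> 'a::euclidean_space"
  assumes "\<And>x. x \<notin> {a..b} \<Longrightarrow> f x = 0"
  shows "(LBINT x. f x) = (LBINT x:{a..b}. f x)"
  unfolding set_lebesgue_integral_def
  by (rule Bochner_Integration.integral_cong) (use assms in \<open>auto simp: indicator_def\<close>)

text \<open>Dominated convergence from the smooth cut-offs to the sharp one, with the restriction of
  \<open>norm F\<close> to \<open>{p..q}\<close> as the dominating function.\<close>

lemma bump1_cut_integral:
  fixes F :: "real \<Rightarrow> 'a::euclidean_space"
  assumes F: "set_integrable lborel {a..q} F" and pq: "a \<le> p" "p < q"
    and zero: "\<And>n. (LBINT x. bump1 p q n x *\<^sub>R F x) = 0"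
  shows "(LBINT x:{p..q}. F x) = 0"
proof -
  have [measurable]: "(\<lambda>x. indicator {a..q} x *\<^sub>R F x) \<in> borel_measurable borel"
    using F by (simp add: set_integrable_def borel_measurable_integrable[of lborel, simplified])
  have Fpq: "set_integrable lborel {p..q} F" by (rule set_integrable_Icc[OF F]) (use pq in auto)
  then have [measurable]: "(\<lambda>x. indicator {p..q} x *\<^sub>R F x) \<in> borel_measurable borel"
    by (simp add: set_integrable_def borel_measurable_integrable[of lborel, simplified])
  have "(\<lambda>n. LBINT x. bump1 p q n x *\<^sub>R F x) \<longlonglongrightarrow> (LBINT x. indicator {p..q} x *\<^sub>R F x)"
  proof (rule integral_dominated_convergence)
    show "integrable lborel (\<lambda>x. norm (indicator {p..q} x *\<^sub>R F x))"
      using integrable_norm[OF Fpq[unfolded set_integrable_def]] .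
    show "(\<lambda>x. bump1 p q n x *\<^sub>R F x) \<in> borel_measurable lborel" for n
      by (rule borel_measurable_integrable[OF bump1_integrable[OF F pq order_refl]])
    show "(\<lambda>x. indicator {p..q} x *\<^sub>R F x) \<in> borel_measurable lborel" by simp
    show "AE x in lborel. (\<lambda>n. bump1 p q n x *\<^sub>R F x) \<longlonglongrightarrow> indicator {p..q} x *\<^sub>R F x"
      using AE_lborel_singleton[of p] AE_lborel_singleton[of q]
    proof eventually_elim
      case (elim x)
      then have "indicator {p<..<q} x = (indicator {p..q} x :: real)" by (auto simp: indicator_def)
      then show ?case using tendsto_scaleR[OF bump1_tendsto[of p q x] tendsto_const[of "F x"]] by simp
    qed
    show "AE x in lborel. norm (bump1 p q n x *\<^sub>R F x) \<le> norm (indicator {p..q} x *\<^sub>R F x)" for n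
      by (intro AE_I2 norm_bump1_scaleR_le) auto
  qed
  then show ?thesis by (simp add: zero set_lebesgue_integral_def LIMSEQ_const_iff)
qed

text \<open>
  A single countable family of test functions works for all \<open>f\<close> and \<open>g\<close>. This matters for the
  time derivative, where each test function comes with its own exceptional null set of \<open>x\<close>.
\<close>

lemma du_bois_reymond_family:
  "\<exists>H. countable H \<and> H \<subseteq> test_functions {a<..} \<and>
    (\<forall>(f::real \<Rightarrow> 'a::euclidean_space) g.
      (\<forall>t. set_integrable lborel {a..t} f) \<longrightarrow> (\<forall>t. set_integrable lborel {a..t} g) \<longrightarrow>
      (\<forall>\<eta>\<in>H. (LBINT t. deriv \<eta> t *\<^sub>R f t) = - (LBINT t. \<eta> t *\<^sub>R g t)) \<longrightarrow>
      (\<exists>c. AE t in lborel. a < t \<longrightarrow> f t = c + (LBINT r:{a..t}. g r)))"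
proof -
  define \<rho> where "\<rho> = bump1 (a+1) (a+2) 0"
  define J where "J = (LBINT x. \<rho> x)"
  have J: "J > 0"
    using bump1_integral_pos[of "a+1" "a+2" "a+1" "a+2" 0]
    unfolding J_def \<rho>_def by (subst integral_eq_set_integral_Icc[of "a+1" "a+2"]) (auto simp: bump1_eq_0)
  \<comment> \<open>A bump is not the derivative of a test function. Subtracting
    \<open>k p q n\<close> times the fixed bump \<open>\<rho>\<close> makes its integral zero, and
    then \<open>antiderivative_test_function\<close> applies.\<close>
  define k where "k p q n = (LBINT x. bump1 p q n x) / J" for p q n
  define PP where "PP p q n \<eta> \<longleftrightarrow> \<eta> \<in> test_functions {a<..} \<and> deriv \<eta> = (\<lambda>x. bump1 p q n x - k p q n * \<rho> x) \<and>
     (\<forall>x. x \<le> min p (a+1) \<or> max q (a+2) \<le> x \<longrightarrow> \<eta> x = 0) \<and>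
     (\<forall>x. (\<eta> has_real_derivative bump1 p q n x - k p q n * \<rho> x) (at x)) \<and>
     continuous_on UNIV (\<lambda>x. bump1 p q n x - k p q n * \<rho> x)" for p q n \<eta>
  have ex: "\<exists>\<eta>. PP p q n \<eta>" if True: "a < p" "p < q" for p q n
  proof -
    let ?lo = "min p (a+1)" and ?hi = "max q (a+2)"
    show ?thesis unfolding PP_def
    proof (rule antiderivative_test_function)
      show "(deriv ^^ m) (\<lambda>x. bump1 p q n x - k p q n * \<rho> x) differentiable (at x)" for m x
        unfolding \<rho>_def using True by (intro smooth_scaled_diff bump1_smooth) auto
      show z: "bump1 p q n x - k p q n * \<rho> x = 0" if "x \<le> ?lo \<or> ?hi \<le> x" for x
        using that unfolding \<rho>_def by (auto simp: bump1_eq_0)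
      show "?lo < ?hi" "{?lo..?hi} \<subseteq> {a<..}" using True by auto
      have i: "set_integrable lborel {?lo..?hi} (bump1 p q n)" "set_integrable lborel {?lo..?hi} \<rho>"
        unfolding \<rho>_def using True by (auto intro!: bump1_set_integrable)
      have "(LBINT x:{?lo..?hi}. bump1 p q n x - k p q n * \<rho> x) =
         (LBINT x:{?lo..?hi}. bump1 p q n x) - k p q n * (LBINT x:{?lo..?hi}. \<rho> x)"
        using set_integral_diff(2)[OF i(1) set_integrable_mult_right[OF i(2), of "k p q n"]] by simp
      also have "(LBINT x:{?lo..?hi}. bump1 p q n x) = (LBINT x. bump1 p q n x)"
        by (rule integral_eq_set_integral_Icc[symmetric], rule bump1_eq_0) auto
      also have "(LBINT x:{?lo..?hi}. \<rho> x) = J" unfolding J_def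
        by (rule integral_eq_set_integral_Icc[symmetric], unfold \<rho>_def, rule bump1_eq_0) auto
      also have "(LBINT x. bump1 p q n x) - k p q n * J = 0" unfolding k_def using J by simp
      finally show "(LBINT x:{?lo..?hi}. bump1 p q n x - k p q n * \<rho> x) = 0" .
    qed
  qed
  define \<eta> where "\<eta> p q n = (SOME \<eta>. PP p q n \<eta>)" for p q n
  have \<eta>: "a < p \<Longrightarrow> p < q \<Longrightarrow> PP p q n (\<eta> p q n)" for p q n
    unfolding \<eta>_def by (rule someI_ex[OF ex])
  note \<eta> = \<eta>[unfolded PP_def]
  define I where "I = {(p, q, n::nat). p \<in> \<rat> \<and> q \<in> \<rat> \<and> a < p \<and> p < q}"
  define H where "H = (\<lambda>(p, q, n). \<eta> p q n) ` I"
  have "countable (\<rat> \<times> \<rat> \<times> (UNIV::nat set) :: (real \<times> real \<times> nat) set)"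
    by (intro countable_SIGMA countable_rat) auto
  then have "countable H" unfolding H_def
    by (intro countable_image, elim countable_subset[rotated]) (auto simp: I_def)
  moreover have "H \<subseteq> test_functions {a<..}" unfolding H_def I_def using \<eta> by auto
  moreover have "\<exists>c. AE t in lborel. a < t \<longrightarrow> f t = c + (LBINT r:{a..t}. g r)"
    if f: "\<forall>t. set_integrable lborel {a..t} f" and g: "\<forall>t. set_integrable lborel {a..t} g"
      and weak: "\<forall>\<eta>\<in>H. (LBINT t. deriv \<eta> t *\<^sub>R f t) = - (LBINT t. \<eta> t *\<^sub>R g t)"
    for f g :: "real \<Rightarrow> 'a"
  proof -
    define G where "G t = (LBINT r:{a..t}. g r)" for t
    have G: "ac_from a G g" unfolding G_def by (rule ac_from_integral) (use g in auto)
    define F where "F t = f t - G t" for t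
    have Gi: "set_integrable lborel {a..t} G" for t
      unfolding set_integrable_def by (rule borel_integrable_compact) (auto intro: ac_from_continuous[OF G])
    have F: "set_integrable lborel {a..t} F" for t
      unfolding F_def using f Gi by (intro set_integral_diff(1)) auto
    \<comment> \<open>Testing with the corrected bumps will give
      \<open>\<integral> bump1 F = k \<integral> \<rho> F\<close>, and the right side is
      \<open>c \<integral> bump1\<close> by the definition of \<open>k\<close>. So the constant is
      the mean of \<open>F\<close> weighted by \<open>\<rho>\<close>.\<close>
    define c where "c = (1 / J) *\<^sub>R (LBINT x. \<rho> x *\<^sub>R F x)"
    define h where "h t = F t - c" for t
    have h: "set_integrable lborel {a..t} h" for t
      unfolding h_def
    proof (rule set_integral_diff(1)[OF F])
      show "set_integrable lborel {a..t} (\<lambda>_. c)"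
        unfolding set_integrable_def by (rule borel_integrable_compact) auto
    qed
    have "AE x in lborel. a < x \<longrightarrow> h x = 0"
    proof (rule AE_zero_of_rational_integrals[OF h])
      fix p q :: real assume pq: "p \<in> \<rat>" "q \<in> \<rat>" "a < p" "p < q"
      show "(LBINT r:{p..q}. h r) = 0"
      proof (rule bump1_cut_integral[OF h])
        show "(LBINT x. bump1 p q n x *\<^sub>R h x) = 0" for n
        proof -
          let ?\<eta> = "\<eta> p q n" and ?\<psi> = "\<lambda>x. bump1 p q n x - k p q n * \<rho> x" and ?hi = "max q (a+2)"
          note e = \<eta>[OF pq(3,4), of n]
          have "?\<eta> \<in> H" unfolding H_def I_def using pq by force
          then have w: "(LBINT t. ?\<psi> t *\<^sub>R f t) = - (LBINT t. ?\<eta> t *\<^sub>R g t)" using weak e by auto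
          have "ac_from a ?\<eta> ?\<psi>"
            by (rule ac_from_deriv) (use e in \<open>auto simp: has_real_derivative_iff_has_vector_derivative[symmetric]\<close>)
          from ac_from_prod[OF bounded_bilinear_scaleR this G]
          have P: "ac_from a (\<lambda>t. ?\<eta> t *\<^sub>R G t) (\<lambda>t. ?\<psi> t *\<^sub>R G t + ?\<eta> t *\<^sub>R g t)" .
          let ?Z = "\<lambda>t. ?\<psi> t *\<^sub>R G t + ?\<eta> t *\<^sub>R g t"
          have z\<psi>: "?\<psi> x = 0" "?\<eta> x = 0" if "x \<notin> {a..?hi}" for x
          proof -
            have x: "x \<le> min p (a+1) \<or> max q (a+2) \<le> x" using that pq by auto
            then have "bump1 p q n x = 0" "\<rho> x = 0"
              unfolding \<rho>_def by (intro bump1_eq_0; auto)+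
            then show "?\<psi> x = 0" by simp
            show "?\<eta> x = 0" using e x by blast
          qed
          have ib: "integrable lborel (\<lambda>x. bump1 p q n x *\<^sub>R K x)" if "\<And>t. set_integrable lborel {a..t} K" for K :: "real \<Rightarrow> 'a"
            by (rule bump1_integrable[OF that order.strict_implies_order]) (use pq in auto)
          have i\<rho>: "integrable lborel (\<lambda>x. \<rho> x *\<^sub>R K x)" if "\<And>t. set_integrable lborel {a..t} K" for K :: "real \<Rightarrow> 'a"
            unfolding \<rho>_def by (rule bump1_integrable[OF that[of "a+2"]]) auto
          have i\<psi>: "integrable lborel (\<lambda>x. ?\<psi> x *\<^sub>R K x)"
            "(LBINT x. ?\<psi> x *\<^sub>R K x) = (LBINT x. bump1 p q n x *\<^sub>R K x) - k p q n *\<^sub>R (LBINT x. \<rho> x *\<^sub>R K x)"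
            if "\<And>t. set_integrable lborel {a..t} K" for K :: "real \<Rightarrow> 'a"
            using ib[OF that] i\<rho>[OF that]
            by (auto simp: scaleR_diff_left scaleR_scaleR[symmetric] simp del: scaleR_scaleR)
          \<comment> \<open>\<open>?\<eta>\<close> vanishes at both ends, so integration by parts of
            \<open>?\<eta> G\<close> has no boundary terms. It cancels the term with
            \<open>g\<close> in the weak equation and leaves
            \<open>\<integral> ?\<psi> F = 0\<close>.\<close>
          have "(LBINT t:{a..?hi}. ?Z t) = ?\<eta> ?hi *\<^sub>R G ?hi - ?\<eta> a *\<^sub>R G a"
            using ac_fromD(2)[OF P, of a ?hi] by simp
          also have "\<dots> = 0" using e pq by simp
          also have "(LBINT t:{a..?hi}. ?Z t) = (LBINT t. ?Z t)"
            by (rule integral_eq_set_integral_Icc[symmetric]) (simp only: z\<psi> scaleR_zero_left add_0 simp_thms)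
          also have "\<dots> = (LBINT t. ?\<psi> t *\<^sub>R G t) + (LBINT t. ?\<eta> t *\<^sub>R g t)"
          proof (rule Bochner_Integration.integral_add[OF i\<psi>(1)[OF Gi]])
            have "integrable lborel ?Z"
            proof -
              have "?Z = (\<lambda>t. indicator {a..?hi} t *\<^sub>R ?Z t)"
              proof
                fix t show "?Z t = indicator {a..?hi} t *\<^sub>R ?Z t"
                  using z\<psi>[of t] by (cases "t \<in> {a..?hi}") simp_all
              qed
              then show ?thesis using ac_fromD(1)[OF P, of a ?hi] unfolding set_integrable_def by simp
            qed
            from Bochner_Integration.integrable_diff[OF this i\<psi>(1)[OF Gi]]
            show "integrable lborel (\<lambda>t. ?\<eta> t *\<^sub>R g t)" by simp
          qed
          finally have "(LBINT t. ?\<psi> t *\<^sub>R f t) - (LBINT t. ?\<psi> t *\<^sub>R G t) = 0"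
            using w by (simp add: add_eq_0_iff2)
          then have "(LBINT t. ?\<psi> t *\<^sub>R F t) = 0"
            unfolding F_def scaleR_diff_right
            by (subst Bochner_Integration.integral_diff[OF i\<psi>(1) i\<psi>(1)[OF Gi]]) (use f in auto)
          then have 1: "(LBINT x. bump1 p q n x *\<^sub>R F x) = k p q n *\<^sub>R (LBINT x. \<rho> x *\<^sub>R F x)"
            unfolding i\<psi>(2)[OF F] by simp
          have ic: "integrable lborel (bump1 p q n)"
            using bump1_integrable[of a q "\<lambda>_. 1::real" p q n] pq by (simp add: set_integrable_def)
          have "(LBINT x. bump1 p q n x *\<^sub>R h x) = (LBINT x. bump1 p q n x *\<^sub>R F x) - (LBINT x. bump1 p q n x *\<^sub>R c)"
            unfolding h_def scaleR_diff_right
            by (rule Bochner_Integration.integral_diff[OF ib[OF F]]) (use ic in auto)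
          also have "(LBINT x. bump1 p q n x *\<^sub>R c) = (LBINT x. bump1 p q n x) *\<^sub>R c"
            using ic by simp
          finally show ?thesis unfolding 1 c_def k_def by simp
        qed
      qed (use pq in auto)
    qed
    then show ?thesis
      by (intro exI[of _ c]) (auto simp: h_def F_def G_def algebra_simps elim!: AE_mp)
  qed
  ultimately show ?thesis by blast
qed

section \<open>Difference quotients of square integrable functions\<close>

text \<open>Borel rather than Lebesgue measurability, so that shifts of \<open>f\<close> and
  functions on the product space stay measurable and Fubini applies.\<close>

definition sq_int :: "(real \<Rightarrow> 'a::euclidean_space) \<Rightarrow> bool" where
  "sq_int f \<longleftrightarrow> f \<in> borel_measurable borel \<and> integrable lborel (\<lambda>x. (norm (f x))\<^sup>2)"

definition sq_norm :: "(real \<Rightarrow> 'a::euclidean_space) \<Rightarrow> real" where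
  "sq_norm f = (LBINT x. (norm (f x))\<^sup>2)"

lemma sq_int_measurable: "sq_int f \<Longrightarrow> f \<in> borel_measurable borel"
  by (simp add: sq_int_def)

lemma sq_norm_nonneg: "0 \<le> sq_norm f"
  by (simp add: sq_norm_def)

lemma mult_le_sum_squares: "a * b \<le> a\<^sup>2 + (b::real)\<^sup>2"
proof -
  have "2 * (a * b) \<le> a\<^sup>2 + b\<^sup>2" using sum_squares_bound[of a b] by (simp add: mult.assoc)
  moreover have "0 \<le> a\<^sup>2 + b\<^sup>2" by simp
  ultimately show ?thesis by linarith
qed

lemma sq_int_inner:
  assumes "sq_int f" "sq_int g"
  shows "integrable lborel (\<lambda>x. f x \<bullet> g x)"
proof (rule Bochner_Integration.integrable_bound)
  show "integrable lborel (\<lambda>x. (norm (f x))\<^sup>2 + (norm (g x))\<^sup>2)"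
    using assms by (auto simp: sq_int_def)
  show "(\<lambda>x. f x \<bullet> g x) \<in> borel_measurable lborel" using assms by (auto simp: sq_int_def)
  show "AE x in lborel. norm (f x \<bullet> g x) \<le> norm ((norm (f x))\<^sup>2 + (norm (g x))\<^sup>2)"
  proof (rule AE_I2)
    fix x
    have "\<bar>f x \<bullet> g x\<bar> \<le> norm (f x) * norm (g x)" by (rule Cauchy_Schwarz_ineq2)
    also have "\<dots> \<le> (norm (f x))\<^sup>2 + (norm (g x))\<^sup>2"
      by (rule mult_le_sum_squares)
    finally show "norm (f x \<bullet> g x) \<le> norm ((norm (f x))\<^sup>2 + (norm (g x))\<^sup>2)" by simp
  qed
qed

lemma sq_int_lincomb:
  assumes f: "sq_int f" and g: "sq_int g"
  shows "sq_int (\<lambda>x. c *\<^sub>R f x + d *\<^sub>R g x)"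
    and "sq_norm (\<lambda>x. c *\<^sub>R f x + d *\<^sub>R g x) = c\<^sup>2 * sq_norm f + 2 * c * d * (LBINT x. f x \<bullet> g x) + d\<^sup>2 * sq_norm g"
proof -
  have e: "(norm (c *\<^sub>R f x + d *\<^sub>R g x))\<^sup>2 = (c\<^sup>2 * (norm (f x))\<^sup>2 + (2 * c * d) * (f x \<bullet> g x)) + d\<^sup>2 * (norm (g x))\<^sup>2" for x
    unfolding power2_norm_eq_inner by (simp add: inner_add_left inner_add_right inner_commute power2_eq_square algebra_simps)
  have i: "integrable lborel (\<lambda>x. (norm (f x))\<^sup>2)" "integrable lborel (\<lambda>x. (norm (g x))\<^sup>2)" using f g by (auto simp: sq_int_def)
  note j = sq_int_inner[OF f g]
  show "sq_int (\<lambda>x. c *\<^sub>R f x + d *\<^sub>R g x)"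
    unfolding sq_int_def e
    by (intro conjI Bochner_Integration.integrable_add integrable_mult_right i j) (use f g in \<open>auto simp: sq_int_def\<close>)
  show "sq_norm (\<lambda>x. c *\<^sub>R f x + d *\<^sub>R g x) = c\<^sup>2 * sq_norm f + 2 * c * d * (LBINT x. f x \<bullet> g x) + d\<^sup>2 * sq_norm g"
    unfolding sq_norm_def e using i j by (simp add: Bochner_Integration.integral_add)
qed

lemma sq_int_shift:
  assumes "sq_int f"
  shows "sq_int (\<lambda>x. f (x + c))" "sq_norm (\<lambda>x. f (x + c)) = sq_norm f"
proof -
  have [measurable]: "f \<in> borel_measurable borel" using assms by (simp add: sq_int_def)
  have "integrable lborel (\<lambda>x. (norm (f (c + 1 * x)))\<^sup>2)"
    using lborel_integrable_real_affine[of "\<lambda>x. (norm (f x))\<^sup>2" 1 c] assms by (simp add: sq_int_def)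
  then show "sq_int (\<lambda>x. f (x + c))" by (simp add: sq_int_def add.commute)
  show "sq_norm (\<lambda>x. f (x + c)) = sq_norm f"
    using lborel_integral_real_affine[of 1 "\<lambda>x. (norm (f x))\<^sup>2" c] by (simp add: sq_norm_def add.commute)
qed

lemma integrable_indicator_Icc: "integrable lborel (indicator {a..b} :: real \<Rightarrow> real)"
  by (rule integrable_real_indicator) (auto simp: emeasure_lborel_Icc_eq)

lemma set_integrable_of_sq:
  fixes f :: "real \<Rightarrow> 'a::euclidean_space"
  assumes [measurable]: "f \<in> borel_measurable borel"
    and sq: "integrable lborel (\<lambda>x. indicator {a..b} x * (norm (f x))\<^sup>2)"
  shows "set_integrable lborel {a..b} f"
  unfolding set_integrable_def
proof (rule Bochner_Integration.integrable_bound)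
  show "integrable lborel (\<lambda>x. indicator {a..b} x + indicator {a..b} x * (norm (f x))\<^sup>2)"
    by (intro Bochner_Integration.integrable_add integrable_indicator_Icc sq)
  show "AE x in lborel. norm (indicator {a..b} x *\<^sub>R f x) \<le> norm (indicator {a..b} x + indicator {a..b} x * (norm (f x))\<^sup>2 :: real)"
  proof (rule AE_I2)
    fix x
    have "norm (f x) \<le> 1 + (norm (f x))\<^sup>2" using mult_le_sum_squares[of "norm (f x)" 1] by simp
    then show "norm (indicator {a..b} x *\<^sub>R f x) \<le> norm (indicator {a..b} x + indicator {a..b} x * (norm (f x))\<^sup>2 :: real)"
      by (auto simp: indicator_def)
  qed
qed measurable

lemma sq_int_set_integrable:
  assumes "sq_int f"
  shows "set_integrable lborel {a..b} f"
proof (rule set_integrable_of_sq)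
  have "integrable lborel (\<lambda>x. indicator {a..b} x *\<^sub>R (norm (f x))\<^sup>2)"
    by (rule integrable_mult_indicator) (use assms in \<open>auto simp: sq_int_def\<close>)
  then show "integrable lborel (\<lambda>x. indicator {a..b} x * (norm (f x))\<^sup>2)" by simp
qed (use assms in \<open>simp add: sq_int_def\<close>)

text \<open>The mean of \<open>f\<close> over \<open>{x..x+h}\<close>, rescaled to the unit
  interval: the domain of integration depends on neither \<open>x\<close> nor \<open>h\<close>,
  which suits Fubini.\<close>

definition avg :: "real \<Rightarrow> (real \<Rightarrow> 'a::euclidean_space) \<Rightarrow> real \<Rightarrow> 'a" where
  "avg h f x = (LBINT s:{0..1}. f (x + h * s))"

lemma set_integrable_affine:
  fixes f :: "real \<Rightarrow> 'a::euclidean_space"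
  assumes f: "set_integrable lborel {x..x+h} f" and h: "0 < h"
  shows "set_integrable lborel {0..1} (\<lambda>s. f (x + h * s))"
    and "(LBINT r:{x..x+h}. f r) = h *\<^sub>R avg h f x"
proof -
  have ind: "indicator {x..x+h} (x + h * s) = (indicator {0..1} s :: real)" for s
    using h by (auto simp: indicator_def mult_le_cancel_left1 zero_le_mult_iff)
  show "set_integrable lborel {0..1} (\<lambda>s. f (x + h * s))"
    using lborel_integrable_real_affine[OF f[unfolded set_integrable_def], of h x] h
    by (simp add: ind set_integrable_def)
  show "(LBINT r:{x..x+h}. f r) = h *\<^sub>R avg h f x"
    using lborel_integral_real_affine[of h "\<lambda>r. indicator {x..x+h} r *\<^sub>R f r" x] h
    by (simp add: ind set_lebesgue_integral_def avg_def)
qed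

lemma avg_measurable:
  assumes [measurable]: "f \<in> borel_measurable borel"
  shows "avg h f \<in> borel_measurable borel"
  unfolding avg_def set_lebesgue_integral_def by measurable

lemma set_integrable_avg:
  assumes "sq_int f" "0 < h"
  shows "set_integrable lborel {0..1} (\<lambda>s. f (x + h * s))"
  by (rule set_integrable_affine[OF sq_int_set_integrable[OF assms(1)] assms(2)])

lemma avg_add:
  assumes "sq_int f" "sq_int g" "0 < h"
  shows "avg h (\<lambda>x. c *\<^sub>R f x + d *\<^sub>R g x) x = c *\<^sub>R avg h f x + d *\<^sub>R avg h g x"
  using set_integrable_avg[OF assms(1,3), of x] set_integrable_avg[OF assms(2,3), of x]
  unfolding avg_def by (simp add: set_integral_add)

text \<open>Jensen's inequality in the form of a non-negative variance: with \<open>m\<close> the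
  mean of \<open>?n\<close>, expand \<open>\<integral> (?n - m)^2 \<ge> 0\<close>.\<close>

lemma norm_avg_le:
  assumes f: "sq_int f" and h: "0 < h"
  shows "(norm (avg h f x))\<^sup>2 \<le> (LBINT s:{0..1}. (norm (f (x + h * s)))\<^sup>2)"
    and "set_integrable lborel {0..1} (\<lambda>s. (norm (f (x + h * s)))\<^sup>2)"
proof -
  let ?n = "\<lambda>s. norm (f (x + h * s))"
  have "integrable lborel (\<lambda>x. (norm (f x))\<^sup>2)" using f by (simp add: sq_int_def)
  then have "set_integrable lborel {x..x+h} (\<lambda>x. (norm (f x))\<^sup>2)"
    unfolding set_integrable_def by (intro integrable_mult_indicator) auto
  then show i2: "set_integrable lborel {0..1} (\<lambda>s. (?n s)\<^sup>2)"
    using set_integrable_affine(1)[of x h "\<lambda>x. (norm (f x))\<^sup>2"] h by simp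
  have i1: "set_integrable lborel {0..1} (\<lambda>s. ?n s)"
    using set_integrable_avg[OF f h, of x] by (rule set_integrable_norm)
  define m where "m = (LBINT s:{0..1}. ?n s)"
  have "norm (avg h f x) \<le> m"
    unfolding avg_def m_def by (rule set_integral_norm_bound[OF set_integrable_avg[OF f h]])
  then have "(norm (avg h f x))\<^sup>2 \<le> m\<^sup>2" by (intro power_mono) auto
  also have "m\<^sup>2 \<le> (LBINT s:{0..1}. (?n s)\<^sup>2)"
  proof -
    have c: "set_integrable lborel {0..1::real} (\<lambda>s. m\<^sup>2)" "(LBINT s:{0..1::real}. m\<^sup>2) = m\<^sup>2"
      by (simp_all add: set_integrable_def set_lebesgue_integral_def integrable_indicator_Icc)
    have "0 \<le> (LBINT s:{0..1}. ((?n s)\<^sup>2 - (2 * m) * ?n s) + m\<^sup>2)"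
    proof (unfold set_lebesgue_integral_def, rule Bochner_Integration.integral_nonneg)
      fix s
      have "0 \<le> (?n s - m)\<^sup>2" by simp
      then show "0 \<le> indicat_real {0..1} s *\<^sub>R (((?n s)\<^sup>2 - (2 * m) * ?n s) + m\<^sup>2)"
        by (auto simp: indicator_def power2_diff algebra_simps)
    qed
    also have "\<dots> = ((LBINT s:{0..1}. (?n s)\<^sup>2) - (2 * m) * m) + m\<^sup>2"
    proof -
      have d: "set_integrable lborel {0..1} (\<lambda>s. (2 * m) * ?n s)"
        using i1 by (intro set_integrable_mult_right) auto
      have "(LBINT s:{0..1}. (2 * m) * ?n s) = (2 * m) * m"
        unfolding m_def by (rule set_integral_mult_right)
      then show ?thesis
        unfolding set_integral_add(2)[OF set_integral_diff(1)[OF i2 d] c(1)] set_integral_diff(2)[OF i2 d] c(2) by simp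
    qed
    finally show ?thesis by (simp add: power2_eq_square)
  qed
  finally show "(norm (avg h f x))\<^sup>2 \<le> (LBINT s:{0..1}. (?n s)\<^sup>2)" .
qed

text \<open>Averaging is a contraction of \<open>L2\<close>: Jensen for each \<open>x\<close>, then
  Tonelli, then translation invariance of the inner integral.\<close>

lemma sq_int_avg:
  assumes f: "sq_int f" and h: "0 < h"
  shows "sq_int (avg h f)" "sq_norm (avg h f) \<le> sq_norm f"
proof -
  have [measurable]: "f \<in> borel_measurable borel" using f by (simp add: sq_int_def)
  have [measurable]: "avg h f \<in> borel_measurable borel" by (rule avg_measurable) measurable
  have N: "(\<integral>\<^sup>+x. ennreal ((norm (f (x + c)))\<^sup>2) \<partial>lborel) = ennreal (sq_norm f)" for c
    using sq_int_shift[OF f, of c] unfolding sq_int_def sq_norm_def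
    by (metis nn_integral_eq_integral zero_le_power2 AE_I2)
  have "(\<integral>\<^sup>+x. ennreal ((norm (avg h f x))\<^sup>2) \<partial>lborel)
      \<le> (\<integral>\<^sup>+x. (\<integral>\<^sup>+s. indicator {0..1} s * ennreal ((norm (f (x + h * s)))\<^sup>2) \<partial>lborel) \<partial>lborel)"
  proof (rule nn_integral_mono)
    fix x
    have "ennreal ((norm (avg h f x))\<^sup>2) \<le> ennreal (LBINT s:{0..1}. (norm (f (x + h * s)))\<^sup>2)"
      by (rule ennreal_leI[OF norm_avg_le(1)[OF f h]])
    also have "\<dots> = (\<integral>\<^sup>+s. ennreal (indicator {0..1} s * (norm (f (x + h * s)))\<^sup>2) \<partial>lborel)"
      using norm_avg_le(2)[OF f h, of x] unfolding set_integrable_def set_lebesgue_integral_def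
      by (subst nn_integral_eq_integral) auto
    also have "\<dots> = (\<integral>\<^sup>+s. indicator {0..1} s * ennreal ((norm (f (x + h * s)))\<^sup>2) \<partial>lborel)"
      by (intro nn_integral_cong) (auto simp: indicator_def)
    finally show "ennreal ((norm (avg h f x))\<^sup>2) \<le> (\<integral>\<^sup>+s. indicator {0..1} s * ennreal ((norm (f (x + h * s)))\<^sup>2) \<partial>lborel)" .
  qed
  also have "\<dots> = (\<integral>\<^sup>+s. (\<integral>\<^sup>+x. indicator {0..1} s * ennreal ((norm (f (x + h * s)))\<^sup>2) \<partial>lborel) \<partial>lborel)"
    by (rule lborel_pair.Fubini') measurable
  also have "\<dots> = (\<integral>\<^sup>+s. ennreal (sq_norm f) * indicator {0..1::real} s \<partial>lborel)"
    by (rule nn_integral_cong) (simp add: nn_integral_cmult N mult.commute)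
  also have "\<dots> = ennreal (sq_norm f)" by (subst nn_integral_cmult_indicator) auto
  finally have le: "(\<integral>\<^sup>+x. ennreal ((norm (avg h f x))\<^sup>2) \<partial>lborel) \<le> ennreal (sq_norm f)" .
  have i: "integrable lborel (\<lambda>x. (norm (avg h f x))\<^sup>2)"
    by (rule integrableI_bounded) (use le in \<open>auto intro: le_less_trans\<close>)
  then show "sq_int (avg h f)" by (simp add: sq_int_def)
  show "sq_norm (avg h f) \<le> sq_norm f"
    using le nn_integral_eq_integral[OF i] sq_norm_nonneg[of f] unfolding sq_norm_def by simp
qed

section \<open>Convergence of moving averages in the mean square\<close>

abbreviation hn :: "nat \<Rightarrow> real" where "hn n \<equiv> inverse (real (Suc n))"

lemma avg_tendsto_AE:
  fixes f :: "real \<Rightarrow> 'a::euclidean_space"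
  assumes f: "\<And>a b. set_integrable lborel {a..b} f"
  shows "AE x in lborel. (\<lambda>n. avg (hn n) f x) \<longlonglongrightarrow> f x"
  using AE_right_average_tendsto[of f, OF f]
proof eventually_elim
  case (elim x)
  have "(\<lambda>n. (LBINT r:{x..x + hn n}. f r) /\<^sub>R hn n) \<longlonglongrightarrow> f x"
    by (rule filterlim_compose[OF elim inverse_Suc_at_right])
  moreover have "(LBINT r:{x..x + hn n}. f r) /\<^sub>R hn n = avg (hn n) f x" for n
    by (subst set_integrable_affine(2)[OF f]) auto
  ultimately show ?case by simp
qed

text \<open>Fatou and almost everywhere convergence give the lower bound for the limit, the
  contraction property the upper one. No approximation by continuous functions is involved.\<close>

lemma sq_norm_avg_tendsto:
  assumes f: "sq_int f"
  shows "(\<lambda>n. sq_norm (avg (hn n) f)) \<longlonglongrightarrow> sq_norm f"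
proof (rule tendstoI)
  fix e :: real assume e: "0 < e"
  have [measurable]: "f \<in> borel_measurable borel" using f by (simp add: sq_int_def)
  have A: "sq_int (avg (hn n) f)" for n by (rule sq_int_avg[OF f]) simp
  have [measurable]: "avg (hn n) f \<in> borel_measurable borel" for n using A by (simp add: sq_int_def)
  have N: "(\<integral>\<^sup>+x. ennreal ((norm (g x))\<^sup>2) \<partial>lborel) = ennreal (sq_norm g)" if "sq_int g" for g :: "real \<Rightarrow> 'a"
    using that unfolding sq_int_def sq_norm_def by (intro nn_integral_eq_integral) auto
  have "ennreal (sq_norm f) = (\<integral>\<^sup>+x. liminf (\<lambda>n. ennreal ((norm (avg (hn n) f x))\<^sup>2)) \<partial>lborel)"
    unfolding N[OF f, symmetric]
  proof (rule nn_integral_cong_AE)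
    show "AE x in lborel. ennreal ((norm (f x))\<^sup>2) = liminf (\<lambda>n. ennreal ((norm (avg (hn n) f x))\<^sup>2))"
      using avg_tendsto_AE[of f, OF sq_int_set_integrable[OF f]]
    proof eventually_elim
      case (elim x)
      have "(\<lambda>n. ennreal ((norm (avg (hn n) f x))\<^sup>2)) \<longlonglongrightarrow> ennreal ((norm (f x))\<^sup>2)"
        by (intro tendsto_ennrealI tendsto_power tendsto_norm elim)
      then show ?case by (metis lim_imp_Liminf trivial_limit_sequentially)
    qed
  qed
  also have "\<dots> \<le> liminf (\<lambda>n. \<integral>\<^sup>+x. ennreal ((norm (avg (hn n) f x))\<^sup>2) \<partial>lborel)"
    by (rule nn_integral_liminf) measurable
  also have "\<dots> = liminf (\<lambda>n. ennreal (sq_norm (avg (hn n) f)))" by (simp only: N[OF A])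
  finally have L: "ennreal (sq_norm f) \<le> liminf (\<lambda>n. ennreal (sq_norm (avg (hn n) f)))" .
  \<comment> \<open>A negative \<open>sq_norm f - e\<close> is treated apart, because
    \<open>ennreal\<close> sends it to 0 and the strict comparison would be lost.\<close>
  have "\<forall>\<^sub>F n in sequentially. sq_norm f - e < sq_norm (avg (hn n) f)"
  proof (cases "sq_norm f - e < 0")
    case True
    then show ?thesis by (intro always_eventually allI) (rule less_le_trans[OF _ sq_norm_nonneg])
  next
    case False
    then have "ennreal (sq_norm f - e) < ennreal (sq_norm f)" using e by (intro ennreal_lessI) auto
    then have "\<forall>\<^sub>F n in sequentially. ennreal (sq_norm f - e) < ennreal (sq_norm (avg (hn n) f))"
      using L by (intro less_LiminfD) auto
    then show ?thesis using False by (auto elim!: eventually_mono simp: ennreal_less_iff)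
  qed
  then show "\<forall>\<^sub>F n in sequentially. dist (sq_norm (avg (hn n) f)) (sq_norm f) < e"
  proof eventually_elim
    case (elim n)
    have "sq_norm (avg (hn n) f) \<le> sq_norm f" by (rule sq_int_avg[OF f]) simp
    then show ?case using elim e by (simp add: dist_real_def)
  qed
qed

text \<open>Polarization: averaging is linear, so convergence of the norms of sums and differences
  gives convergence of the inner products.\<close>

lemma inner_avg_tendsto:
  assumes f: "sq_int f" and g: "sq_int g"
  shows "(\<lambda>n. LBINT x. avg (hn n) f x \<bullet> avg (hn n) g x) \<longlonglongrightarrow> (LBINT x. f x \<bullet> g x)"
proof -
  have pol: "(LBINT x. F x \<bullet> G x) = (sq_norm (\<lambda>x. 1 *\<^sub>R F x + 1 *\<^sub>R G x) - sq_norm (\<lambda>x. 1 *\<^sub>R F x + (-1) *\<^sub>R G x)) / 4"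
    if "sq_int F" "sq_int G" for F G :: "real \<Rightarrow> 'a"
    unfolding sq_int_lincomb(2)[OF that] by simp
  have h: "0 < hn n" for n by simp
  have e: "avg (hn n) (\<lambda>x. c *\<^sub>R f x + d *\<^sub>R g x) = (\<lambda>x. c *\<^sub>R avg (hn n) f x + d *\<^sub>R avg (hn n) g x)" for n c d
    using avg_add[OF f g h] by auto
  have "(\<lambda>n. (sq_norm (avg (hn n) (\<lambda>x. 1 *\<^sub>R f x + 1 *\<^sub>R g x)) - sq_norm (avg (hn n) (\<lambda>x. 1 *\<^sub>R f x + (-1) *\<^sub>R g x))) / 4)
     \<longlonglongrightarrow> (sq_norm (\<lambda>x. 1 *\<^sub>R f x + 1 *\<^sub>R g x) - sq_norm (\<lambda>x. 1 *\<^sub>R f x + (-1) *\<^sub>R g x)) / 4"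
    by (intro tendsto_intros sq_norm_avg_tendsto sq_int_lincomb f g) simp
  then show ?thesis
    unfolding e pol[OF f g] pol[OF sq_int_avg(1)[OF f h] sq_int_avg(1)[OF g h]] .
qed

text \<open>Expand the norms of \<open>sqrt e f + g / sqrt e\<close> and
  \<open>sqrt e f - g / sqrt e\<close>. This weighted form replaces Cauchy-Schwarz below, since the
  free weight \<open>e\<close> is what completes squares.\<close>

lemma abs_inner_integral_le:
  assumes "sq_int f" "sq_int g" "0 < e"
  shows "2 * \<bar>LBINT x. f x \<bullet> g x\<bar> \<le> e * sq_norm f + sq_norm g / e"
proof -
  let ?I = "LBINT x. f x \<bullet> g x"
  have 1: "0 \<le> (sqrt e)\<^sup>2 * sq_norm f + 2 * sqrt e * (1 / sqrt e) * ?I + (1 / sqrt e)\<^sup>2 * sq_norm g"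
    unfolding sq_int_lincomb(2)[OF assms(1,2), symmetric] by (rule sq_norm_nonneg)
  have 2: "0 \<le> (sqrt e)\<^sup>2 * sq_norm f + 2 * sqrt e * (- (1 / sqrt e)) * ?I + (- (1 / sqrt e))\<^sup>2 * sq_norm g"
    unfolding sq_int_lincomb(2)[OF assms(1,2), symmetric] by (rule sq_norm_nonneg)
  have "0 \<le> e * sq_norm f + 2 * ?I + sq_norm g / e" "0 \<le> e * sq_norm f - 2 * ?I + sq_norm g / e"
    using 1 2 assms(3) by (simp_all add: power2_minus power_divide)
  then show ?thesis by linarith
qed

text \<open>The adjoint of the forward average is the backward average. After exchanging the
  integrals, translate \<open>x\<close> by \<open>h - h * s\<close> and reflect \<open>s\<close> to
  \<open>1 - s\<close>.\<close>

lemma avg_adjoint: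
  assumes F: "sq_int F" and w: "sq_int w" and h: "0 < h"
  shows "(LBINT x. avg h F (x - h) \<bullet> w x) = (LBINT x. F x \<bullet> avg h w x)"
proof -
  have [measurable]: "F \<in> borel_measurable borel" "w \<in> borel_measurable borel" using F w by (auto simp: sq_int_def)
  define \<Phi> where "\<Phi> = (\<lambda>(x, s). indicator {0..1::real} s *\<^sub>R (F (x - h + h * s) \<bullet> w x))"
  define \<Psi> where "\<Psi> = (\<lambda>(x, s). indicator {0..1::real} s *\<^sub>R (F x \<bullet> w (x + h * s)))"
  \<comment> \<open>Whatever the shifts, the \<open>x\<close>-integral of the absolute value is at
    most \<open>sq_norm G + sq_norm H\<close>, and \<open>s\<close> ranges over a bounded
    interval.\<close>
  have swapi: "integrable lborel2 (\<lambda>(x, s). indicator {0..1::real} s *\<^sub>R (G (x + b s) \<bullet> H (x + c s)))"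
    if G: "sq_int G" and H: "sq_int H" and [measurable]: "b \<in> borel_measurable borel" "c \<in> borel_measurable borel"
    for G H :: "real \<Rightarrow> 'a" and b c :: "real \<Rightarrow> real"
  proof -
    have [measurable]: "G \<in> borel_measurable borel" "H \<in> borel_measurable borel" using G H by (auto simp: sq_int_def)
    let ?I = "\<lambda>s x. G (x + b s) \<bullet> H (x + c s)"
    have i': "integrable lborel (\<lambda>x. ?I s x)" for s
      by (rule sq_int_inner[OF sq_int_shift(1)[OF G] sq_int_shift(1)[OF H]])
    have bd: "(LBINT x. \<bar>?I s x\<bar>) \<le> sq_norm G + sq_norm H" for s
    proof -
      have "(LBINT x. \<bar>?I s x\<bar>) \<le> (LBINT x. (norm (G (x + b s)))\<^sup>2 + (norm (H (x + c s)))\<^sup>2)"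
      proof (rule integral_mono)
        show "integrable lborel (\<lambda>x. \<bar>?I s x\<bar>)" using i' by auto
        show "integrable lborel (\<lambda>x. (norm (G (x + b s)))\<^sup>2 + (norm (H (x + c s)))\<^sup>2)"
          using sq_int_shift(1)[OF G, of "b s"] sq_int_shift(1)[OF H, of "c s"] by (simp add: sq_int_def)
        show "\<bar>?I s x\<bar> \<le> (norm (G (x + b s)))\<^sup>2 + (norm (H (x + c s)))\<^sup>2" for x
          by (rule order_trans[OF Cauchy_Schwarz_ineq2 mult_le_sum_squares])
      qed
      also have "\<dots> = sq_norm G + sq_norm H"
        using sq_int_shift[OF G, of "b s"] sq_int_shift[OF H, of "c s"] by (simp add: sq_int_def sq_norm_def)
      finally show ?thesis .
    qed
    have "integrable lborel2 (\<lambda>(s, x). indicator {0..1::real} s *\<^sub>R (?I s x))"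
    proof (rule lborel_pair.Fubini_integrable)
      show "integrable lborel (\<lambda>s. LBINT x. norm (case (s, x) of (s, x) \<Rightarrow> indicator {0..1::real} s *\<^sub>R (?I s x)))"
      proof (rule Bochner_Integration.integrable_bound)
        show "integrable lborel (\<lambda>s. indicator {0..1::real} s * (sq_norm G + sq_norm H))" by simp
        show "AE s in lborel. norm (LBINT x. norm (case (s, x) of (s, x) \<Rightarrow> indicator {0..1::real} s *\<^sub>R (?I s x)))
            \<le> norm (indicator {0..1::real} s * (sq_norm G + sq_norm H))"
          using bd sq_norm_nonneg[of G] sq_norm_nonneg[of H] by (auto simp: indicator_def)
      qed measurable
      show "AE s in lborel. integrable lborel (\<lambda>x. case (s, x) of (s, x) \<Rightarrow> indicator {0..1::real} s *\<^sub>R (?I s x))"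
        using i' by auto
    qed measurable
    from lborel_pair.integrable_product_swap[OF this] show ?thesis by (simp add: case_prod_unfold)
  qed
  have \<Phi>: "integrable lborel2 \<Phi>"
    using swapi[OF F w, of "\<lambda>s. h * s - h" "\<lambda>_. 0"] by (simp add: \<Phi>_def algebra_simps)
  have \<Psi>: "integrable lborel2 \<Psi>"
    using swapi[OF F w, of "\<lambda>_. 0" "\<lambda>s. h * s"] by (simp add: \<Psi>_def algebra_simps)
  have e1: "(LBINT s. \<Phi> (x, s)) = avg h F (x - h) \<bullet> w x" for x
    using integral_bounded_linear[OF bounded_linear_inner_left set_integrable_avg[OF F h, unfolded set_integrable_def], of "x - h" "w x"]
    by (simp add: \<Phi>_def avg_def set_lebesgue_integral_def)
  have e2: "(LBINT s. \<Psi> (x, s)) = F x \<bullet> avg h w x" for x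
    using integral_bounded_linear[OF bounded_linear_inner_right set_integrable_avg[OF w h, unfolded set_integrable_def], of "F x" x]
    by (simp add: \<Psi>_def avg_def set_lebesgue_integral_def)
  have "(LBINT x. avg h F (x - h) \<bullet> w x) = (LBINT x. LBINT s. \<Phi> (x, s))" by (simp add: e1)
  also have "\<dots> = (LBINT s. LBINT x. \<Phi> (x, s))"
    using lborel_pair.Fubini_integral[of "\<lambda>x s. \<Phi> (x, s)"] \<Phi> by simp
  also have "\<dots> = (LBINT s. LBINT x. \<Psi> (x, 1 - s))"
  proof (rule Bochner_Integration.integral_cong[OF refl])
    fix s
    have "(LBINT x. \<Phi> (x, s)) = (LBINT x. \<Phi> ((h - h * s) + 1 * x, s))"
      using lborel_integral_real_affine[of 1 "\<lambda>x. \<Phi> (x, s)" "h - h * s"] by simp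
    also have "\<dots> = (LBINT x. \<Psi> (x, 1 - s))"
      by (rule Bochner_Integration.integral_cong[OF refl]) (auto simp: \<Phi>_def \<Psi>_def indicator_def algebra_simps)
    finally show "(LBINT x. \<Phi> (x, s)) = (LBINT x. \<Psi> (x, 1 - s))" .
  qed
  also have "\<dots> = (LBINT s. LBINT x. \<Psi> (x, s))"
    using lborel_integral_real_affine[of "-1" "\<lambda>s. LBINT x. \<Psi> (x, s)" 1] by simp
  also have "\<dots> = (LBINT x. LBINT s. \<Psi> (x, s))"
    using lborel_pair.Fubini_integral[of "\<lambda>x s. \<Psi> (x, s)"] \<Psi> by simp
  finally show ?thesis by (simp add: e2)
qed

section \<open>Difference quotients and discrete integration by parts\<close>

definition diffq :: "real \<Rightarrow> (real \<Rightarrow> 'a::real_vector) \<Rightarrow> real \<Rightarrow> 'a" where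
  "diffq h f x = (f (x + h) - f x) /\<^sub>R h"

text \<open>The fundamental theorem for a weak derivative \<open>g\<close> of \<open>f\<close>, free
  of a choice of continuous representative; the exceptional null set may depend on
  \<open>h\<close>.\<close>

definition ac_deriv :: "(real \<Rightarrow> 'a::euclidean_space) \<Rightarrow> (real \<Rightarrow> 'a) \<Rightarrow> bool" where
  "ac_deriv f g \<longleftrightarrow> (\<forall>h>0. AE x in lborel. diffq h f x = avg h g x)"

lemma sq_int_diffq:
  assumes "sq_int f" shows "sq_int (diffq h f)"
  using sq_int_lincomb(1)[OF sq_int_shift(1)[OF assms, of h] assms, of "inverse h" "- inverse h"]
  by (simp add: diffq_def[abs_def] algebra_simps)

lemma sq_norm_diffq_tendsto:
  assumes f: "sq_int f" and g: "sq_int g" and fg: "ac_deriv f g"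
  shows "(\<lambda>n. sq_norm (diffq (hn n) f)) \<longlonglongrightarrow> sq_norm g"
proof -
  have "sq_norm (diffq (hn n) f) = sq_norm (avg (hn n) g)" for n
    unfolding sq_norm_def
  proof (rule integral_cong_AE)
    have "AE x in lborel. diffq (hn n) f x = avg (hn n) g x" using fg unfolding ac_deriv_def by simp
    then show "AE x in lborel. (norm (diffq (hn n) f x))\<^sup>2 = (norm (avg (hn n) g x))\<^sup>2" by eventually_elim simp
  qed (use sq_int_measurable[OF sq_int_diffq[OF f, of "hn n"]] avg_measurable[OF sq_int_measurable[OF g], of "hn n"] in simp_all)
  then show ?thesis using sq_norm_avg_tendsto[OF g] by simp
qed

text \<open>\<open>w\<close> is merely square integrable, as \<open>u_t\<close> will be. The
  difference is moved from \<open>w\<close> to \<open>avg h g\<close>, where it becomes a backward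
  shift of \<open>avg h (avg h k)\<close>; \<open>avg_adjoint\<close> then hands one of the two
  averages back to \<open>w\<close>.\<close>

lemma inner_diffq:
  assumes f: "sq_int f" and g: "sq_int g" and k: "sq_int k" and w: "sq_int w"
    and fg: "ac_deriv f g" and gk: "ac_deriv g k" and h: "0 < h"
  shows "(LBINT x. diffq h f x \<bullet> diffq h w x) = - (LBINT x. avg h k x \<bullet> avg h w x)"
proof -
  let ?P = "avg h g"
  have P: "sq_int ?P" by (rule sq_int_avg[OF g h])
  have [measurable]: "f \<in> borel_measurable borel" "g \<in> borel_measurable borel" "k \<in> borel_measurable borel" "w \<in> borel_measurable borel"
    using f g k w by (auto simp: sq_int_def)
  \<comment> \<open>This holds for every \<open>x\<close>, although \<open>ac_deriv\<close> holds
    only almost everywhere: the outer average integrates the null set away.\<close>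
  have Pm: "?P (x - h) - ?P x = - (h *\<^sub>R avg h (avg h k) (x - h))" for x
  proof -
    have "AE y in lborel. g (y + h) - g y = h *\<^sub>R avg h k y"
    proof -
      have "AE y in lborel. diffq h g y = avg h k y" using gk h unfolding ac_deriv_def by blast
      then show ?thesis
      proof eventually_elim
        case (elim y)
        have "g (y + h) - g y = h *\<^sub>R diffq h g y" using h by (simp add: diffq_def)
        then show ?case using elim by simp
      qed
    qed
    then have ae: "AE s in lborel. g ((x - h + h * s) + h) - g (x - h + h * s) = h *\<^sub>R avg h k (x - h + h * s)"
      using AE_borel_affine[of h "\<lambda>y. g (y + h) - g y = h *\<^sub>R avg h k y" "x - h"] h avg_measurable[of k h] by simp
    have e: "(x - h + h * s) + h = x + h * s" for s by simp
    have i: "set_integrable lborel {0..1} (\<lambda>s. g (x + h * s))" "set_integrable lborel {0..1} (\<lambda>s. g (x - h + h * s))"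
      using set_integrable_avg[OF g h] by auto
    have "?P x - ?P (x - h) = (LBINT s:{0..1}. g (x + h * s) - g (x - h + h * s))"
      unfolding avg_def using set_integral_diff(2)[OF i] by simp
    also have "\<dots> = (LBINT s:{0..1}. h *\<^sub>R avg h k (x - h + h * s))"
      unfolding set_lebesgue_integral_def
    proof (rule integral_cong_AE)
      show "AE s in lborel. indicat_real {0..1} s *\<^sub>R (g (x + h * s) - g (x - h + h * s)) = indicat_real {0..1} s *\<^sub>R h *\<^sub>R avg h k (x - h + h * s)"
        using ae by eventually_elim (simp only: e)
    qed (use avg_measurable[of k h] in measurable)
    also have "\<dots> = h *\<^sub>R avg h (avg h k) (x - h)" by (simp add: avg_def[of h "avg h k"])
    finally show ?thesis by (simp add: algebra_simps)
  qed
  have wh: "sq_int (\<lambda>x. w (x + h))" by (rule sq_int_shift[OF w])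
  have Ph: "sq_int (\<lambda>x. ?P (x - h))" using sq_int_shift[OF P, of "- h"] by simp
  have "(LBINT x. diffq h f x \<bullet> diffq h w x) = (LBINT x. ?P x \<bullet> diffq h w x)"
  proof (rule integral_cong_AE)
    have "AE x in lborel. diffq h f x = ?P x" using fg h unfolding ac_deriv_def by simp
    then show "AE x in lborel. diffq h f x \<bullet> diffq h w x = ?P x \<bullet> diffq h w x" by eventually_elim simp
  qed (use sq_int_measurable[OF P] sq_int_measurable[OF sq_int_diffq[OF f, of h]] sq_int_measurable[OF sq_int_diffq[OF w, of h]] in simp_all)
  also have "\<dots> = (LBINT x. (?P x \<bullet> w (x + h)) / h - (?P x \<bullet> w x) / h)"
    by (rule Bochner_Integration.integral_cong[OF refl]) (simp add: diffq_def inner_diff_right divide_inverse algebra_simps)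
  also have "\<dots> = (LBINT x. ?P x \<bullet> w (x + h)) / h - (LBINT x. ?P x \<bullet> w x) / h"
    using sq_int_inner[OF P wh] sq_int_inner[OF P w] by simp
  also have "(LBINT x. ?P x \<bullet> w (x + h)) = (LBINT x. ?P (x - h) \<bullet> w x)"
    using lborel_integral_real_affine[of 1 "\<lambda>x. ?P x \<bullet> w (x + h)" "- h"] by simp
  also have "\<dots> / h - (LBINT x. ?P x \<bullet> w x) / h = (LBINT x. (?P (x - h) \<bullet> w x - ?P x \<bullet> w x) / h)"
    using sq_int_inner[OF Ph w] sq_int_inner[OF P w] by (simp add: diff_divide_distrib)
  also have "\<dots> = (LBINT x. - (avg h (avg h k) (x - h) \<bullet> w x))"
    using h by (intro Bochner_Integration.integral_cong refl) (simp add: inner_diff_left[symmetric] Pm)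
  also have "\<dots> = - (LBINT x. avg h k x \<bullet> avg h w x)"
    by (simp add: avg_adjoint[OF sq_int_avg(1)[OF k h] w h])
  finally show ?thesis .
qed

text \<open>The second claim is uniform in \<open>n\<close>. It supplies the dominating function
  when the limit is taken under an integral in time.\<close>

lemma inner_diffq_tendsto:
  assumes f: "sq_int f" and g: "sq_int g" and k: "sq_int k" and w: "sq_int w"
    and fg: "ac_deriv f g" and gk: "ac_deriv g k"
  shows "(\<lambda>n. LBINT x. diffq (hn n) f x \<bullet> diffq (hn n) w x) \<longlonglongrightarrow> - (LBINT x. k x \<bullet> w x)"
    and "2 * \<bar>LBINT x. diffq (hn n) f x \<bullet> diffq (hn n) w x\<bar> \<le> sq_norm k + sq_norm w"
proof -
  have h: "0 < hn n" for n by simp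
  show "(\<lambda>n. LBINT x. diffq (hn n) f x \<bullet> diffq (hn n) w x) \<longlonglongrightarrow> - (LBINT x. k x \<bullet> w x)"
    unfolding inner_diffq[OF assms h] by (intro tendsto_minus inner_avg_tendsto k w)
  have "2 * \<bar>LBINT x. avg (hn n) k x \<bullet> avg (hn n) w x\<bar> \<le> sq_norm (avg (hn n) k) + sq_norm (avg (hn n) w)"
    using abs_inner_integral_le[OF sq_int_avg(1)[OF k h] sq_int_avg(1)[OF w h], of 1] by simp
  then show "2 * \<bar>LBINT x. diffq (hn n) f x \<bullet> diffq (hn n) w x\<bar> \<le> sq_norm k + sq_norm w"
    unfolding inner_diffq[OF assms h] using sq_int_avg(2)[OF k h, of n] sq_int_avg(2)[OF w h, of n] by simp
qed

text \<open>Take \<open>w = f\<close>: the squared norms of the difference quotients have two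
  limits, one from each of the preceding results.\<close>

lemma inner_second_deriv:
  assumes f: "sq_int f" and g: "sq_int g" and k: "sq_int k" and fg: "ac_deriv f g" and gk: "ac_deriv g k"
  shows "(LBINT x. k x \<bullet> f x) = - sq_norm g"
proof -
  have "(\<lambda>n. sq_norm (diffq (hn n) f)) \<longlonglongrightarrow> - (LBINT x. k x \<bullet> f x)"
    using inner_diffq_tendsto(1)[OF f g k f fg gk] by (simp add: sq_norm_def power2_norm_eq_inner)
  from LIMSEQ_unique[OF this sq_norm_diffq_tendsto[OF f g fg]] show ?thesis by simp
qed

section \<open>Weak derivatives and Borel representatives\<close>

lemma measurable_completion_AE:
  assumes g: "g \<in> borel_measurable (completion M)" and eq: "AE x in M. f x = g x"
  shows "f \<in> borel_measurable (completion M)"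
proof (rule measurableI)
  fix B :: "'b set" assume B: "B \<in> sets borel"
  have "AE x in completion M. f x = g x" using eq by (simp add: AE_completion_iff)
  then have "AE x in completion M. (x \<in> g -` B \<inter> space (completion M)) \<longleftrightarrow> (x \<in> f -` B \<inter> space (completion M))"
    by eventually_elim auto
  then show "f -` B \<inter> space (completion M) \<in> sets (completion M)"
    by (rule completion.in_sets_AE) (use measurable_sets[OF g B] in auto)
qed simp

text \<open>\<open>f\<close> need not be known measurable beforehand: over a completed measure a
  function that agrees almost everywhere with a measurable one is measurable.\<close>

lemma integral_completion_AE:
  fixes f g :: "'a \<Rightarrow> 'b::{banach, second_countable_topology}"
  assumes g: "g \<in> borel_measurable M" and eq: "AE x in M. f x = g x"
  shows "integral\<^sup>L (completion M) f = integral\<^sup>L M g"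
    and "integrable (completion M) f \<longleftrightarrow> integrable M g"
proof -
  have gm: "g \<in> borel_measurable (completion M)" using g by (rule measurable_completion)
  have fm: "f \<in> borel_measurable (completion M)" by (rule measurable_completion_AE[OF gm eq])
  have e: "AE x in completion M. f x = g x" using eq by (simp add: AE_completion_iff)
  show "integral\<^sup>L (completion M) f = integral\<^sup>L M g"
    using integral_cong_AE[OF fm gm e] integral_completion[OF g] by simp
  show "integrable (completion M) f \<longleftrightarrow> integrable M g"
    using integrable_cong_AE[OF fm gm e] integrable_completion[OF g] by simp
qed

lemma completion_ex_borel_complex:
  fixes f :: "'a \<Rightarrow> complex"
  assumes f: "f \<in> borel_measurable (completion M)"
  shows "\<exists>g\<in>borel_measurable M. AE x in M. f x = g x"
proof -
  obtain r i where r: "r \<in> borel_measurable M" "AE x in M. Re (f x) = r x"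
    and i: "i \<in> borel_measurable M" "AE x in M. Im (f x) = i x"
    using completion_ex_borel_measurable_real[of "\<lambda>x. Re (f x)" M] completion_ex_borel_measurable_real[of "\<lambda>x. Im (f x)" M] f
    by auto
  have m: "(\<lambda>x. Complex (r x) (i x)) \<in> borel_measurable M"
    using r(1) i(1) unfolding Complex_eq by measurable
  have e: "AE x in M. f x = Complex (r x) (i x)"
    using r(2) i(2) by eventually_elim (simp add: complex_eq_iff)
  show ?thesis by (rule bexI[of _ "\<lambda>x. Complex (r x) (i x)"]) (fact e m)+
qed

definition borel_rep :: "(real \<Rightarrow> complex) \<Rightarrow> (real \<Rightarrow> complex) \<Rightarrow> bool" where
  "borel_rep f f' \<longleftrightarrow> f' \<in> borel_measurable borel \<and> (AE x in lborel. f x = f' x)"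

lemma borel_rep_exists: "f \<in> borel_measurable lebesgue \<Longrightarrow> \<exists>f'. borel_rep f f'"
  using completion_ex_borel_complex[of f lborel] unfolding borel_rep_def measurable_lborel2 by blast

lemma locally_integrable_measurable:
  assumes "locally_integrable f" shows "f \<in> borel_measurable lebesgue"
proof (rule borel_measurable_LIMSEQ_metric)
  show "(\<lambda>x. indicator {- real n..real n} x *\<^sub>R f x) \<in> borel_measurable lebesgue" for n
  proof -
    have "integrable (lebesgue_on {- real n..real n}) f" using assms unfolding locally_integrable_def by auto
    then have "integrable lebesgue (\<lambda>x. indicator {- real n..real n} x *\<^sub>R f x)"
      by (subst (asm) integrable_restrict_space) auto
    then show ?thesis by auto
  qed
  show "(\<lambda>n. indicator {- real n..real n} x *\<^sub>R f x) \<longlonglongrightarrow> f x" for x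
  proof (rule tendsto_eventually)
    obtain N :: nat where "\<bar>x\<bar> \<le> real N" using real_arch_simple by blast
    then have "indicator {- real n..real n} x *\<^sub>R f x = f x" if "N \<le> n" for n
      using that by (simp add: abs_le_iff)
    then show "\<forall>\<^sub>F n in sequentially. indicator {- real n..real n} x *\<^sub>R f x = f x"
      by (rule eventually_sequentiallyI)
  qed
qed

lemma L2_borel_rep:
  assumes "borel_rep f f'"
  shows "f \<in> L2 \<longleftrightarrow> sq_int f'" and "(L2_norm f)\<^sup>2 = sq_norm f'"
proof -
  have [measurable]: "f' \<in> borel_measurable borel" and ae: "AE x in lborel. f x = f' x"
    using assms by (auto simp: borel_rep_def)
  have m: "f \<in> borel_measurable lebesgue"
    by (rule measurable_completion_AE[OF _ ae]) (rule measurable_completion, simp)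
  have m2: "(\<lambda>x. (norm (f' x))\<^sup>2) \<in> borel_measurable lborel" by simp
  have ae2: "AE x in lborel. (norm (f x))\<^sup>2 = (norm (f' x))\<^sup>2" using ae by eventually_elim simp
  show "f \<in> L2 \<longleftrightarrow> sq_int f'"
    using m integral_completion_AE(2)[OF m2 ae2] by (simp add: L2_def sq_int_def)
  show "(L2_norm f)\<^sup>2 = sq_norm f'"
    using integral_completion_AE(1)[OF m2 ae2] sq_norm_nonneg[of f'] by (simp add: L2_norm_def sq_norm_def)
qed

lemma L2_measurable: "f \<in> L2 \<Longrightarrow> f \<in> borel_measurable lebesgue"
  by (simp add: L2_def)

lemma locally_integrable_borel_rep:
  assumes f: "locally_integrable f" and r: "borel_rep f f'"
  shows "set_integrable lborel {a..b} f'"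
proof -
  have [measurable]: "f' \<in> borel_measurable borel" and ae: "AE x in lborel. f x = f' x"
    using r by (auto simp: borel_rep_def)
  have "integrable (lebesgue_on {a..b}) f" using f unfolding locally_integrable_def by auto
  then have i: "integrable lebesgue (\<lambda>x. indicator {a..b} x *\<^sub>R f x)"
    by (subst (asm) integrable_restrict_space) auto
  have e: "AE x in lborel. indicator {a..b} x *\<^sub>R f x = indicator {a..b} x *\<^sub>R f' x"
    using ae by eventually_elim simp
  have m: "(\<lambda>x. indicator {a..b} x *\<^sub>R f' x) \<in> borel_measurable lborel" by simp
  show ?thesis using i unfolding set_integrable_def integral_completion_AE(2)[OF m e] .
qed

lemma test_function_measurable:
  assumes "\<eta> \<in> test_functions S"
  shows "\<eta> \<in> borel_measurable borel" "deriv \<eta> \<in> borel_measurable borel"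
proof -
  have d: "(deriv ^^ n) \<eta> differentiable (at x)" for n x using assms by (auto simp: test_functions_def)
  have "continuous_on UNIV ((deriv ^^ n) \<eta>)" for n
    using d by (meson continuous_at_imp_continuous_on differentiable_imp_continuous_within)
  from this[of 0] this[of 1] show "\<eta> \<in> borel_measurable borel" "deriv \<eta> \<in> borel_measurable borel"
    by (auto intro: borel_measurable_continuous_onI)
qed

lemma AE_lborel_shift:
  assumes "AE x in lborel. P (x::real)" shows "AE x in lborel. P (c + x)"
proof -
  obtain N where "{x \<in> space lborel. \<not> P x} \<subseteq> N" "emeasure lborel N = 0" "N \<in> sets lborel"
    using assms by (rule AE_E)
  then have N: "N \<in> null_sets lborel" "{x. \<not> P x} \<subseteq> N" by (auto intro: null_setsI)
  have [measurable]: "N \<in> sets borel" using N by auto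
  have "AE x in lborel. x \<notin> N" using N(1) by (rule AE_not_in)
  then have "AE x in lborel. c + 1 * x \<notin> N"
    by (rule AE_borel_affine[rotated 2]) (auto)
  then show ?thesis by eventually_elim (use N in auto)
qed

text \<open>The lemma of du Bois-Reymond has a base point, so it is applied on each half-line
  starting at \<open>- real N\<close>. The constants \<open>c N\<close> need no matching, because
  they cancel in \<open>f' (x + h) - f' x\<close> once \<open>N\<close> exceeds
  \<open>\<bar>x\<bar>\<close>.\<close>

lemma has_weak_deriv_diffq:
  assumes w: "has_weak_deriv f g" and rf: "borel_rep f f'" and rg: "borel_rep g g'"
  shows "ac_deriv f' g'"
  unfolding ac_deriv_def
proof (intro allI impI)
  fix h :: real assume h: "0 < h"
  have [measurable]: "f' \<in> borel_measurable borel" "g' \<in> borel_measurable borel"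
    and aef: "AE x in lborel. f x = f' x" and aeg: "AE x in lborel. g x = g' x"
    using rf rg by (auto simp: borel_rep_def)
  have li: "set_integrable lborel {a..b} f'" "set_integrable lborel {a..b} g'" for a b
    using w locally_integrable_borel_rep[OF _ rf] locally_integrable_borel_rep[OF _ rg] by (auto simp: has_weak_deriv_def)
  have "\<exists>c. AE t in lborel. - real N < t \<longrightarrow> f' t = c + (LBINT r:{- real N..t}. g' r)" for N
  proof -
    obtain H where H: "H \<subseteq> test_functions {- real N<..}"
      "\<And>(f::real \<Rightarrow> complex) g. \<forall>t. set_integrable lborel {- real N..t} f \<Longrightarrow> \<forall>t. set_integrable lborel {- real N..t} g \<Longrightarrow>
        \<forall>\<eta>\<in>H. (LBINT t. deriv \<eta> t *\<^sub>R f t) = - (LBINT t. \<eta> t *\<^sub>R g t) \<Longrightarrow>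
        \<exists>c. AE t in lborel. - real N < t \<longrightarrow> f t = c + (LBINT r:{- real N..t}. g r)"
      using du_bois_reymond_family[of "- real N", where ?'a = complex] by blast
    show ?thesis
    proof (rule H(2))
      show "\<forall>\<eta>\<in>H. (LBINT t. deriv \<eta> t *\<^sub>R f' t) = - (LBINT t. \<eta> t *\<^sub>R g' t)"
      proof
        fix \<eta> assume "\<eta> \<in> H"
        then have \<eta>: "\<eta> \<in> test_functions UNIV" using H(1) by (auto simp: test_functions_def)
        note [measurable] = test_function_measurable[OF \<eta>]
        have "(LINT x|lebesgue. deriv \<eta> x *\<^sub>R f x) = (LBINT t. deriv \<eta> t *\<^sub>R f' t)"
          by (rule integral_completion_AE) (use aef in \<open>auto elim!: AE_mp\<close>)
        moreover have "(LINT x|lebesgue. \<eta> x *\<^sub>R g x) = (LBINT t. \<eta> t *\<^sub>R g' t)"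
          by (rule integral_completion_AE) (use aeg in \<open>auto elim!: AE_mp\<close>)
        ultimately show "(LBINT t. deriv \<eta> t *\<^sub>R f' t) = - (LBINT t. \<eta> t *\<^sub>R g' t)"
          using w \<eta> unfolding has_weak_deriv_def by auto
      qed
    qed (use li in auto)
  qed
  then obtain c where c: "\<And>N. AE t in lborel. - real N < t \<longrightarrow> f' t = c N + (LBINT r:{- real N..t}. g' r)"
    by metis
  have c1: "AE t in lborel. \<forall>N. - real N < t \<longrightarrow> f' t = c N + (LBINT r:{- real N..t}. g' r)"
    using c by (simp add: AE_all_countable)
  \<comment> \<open>The representation is needed at \<open>x\<close> and at \<open>h + x\<close>;
    hence the translate of the null set.\<close>
  show "AE x in lborel. diffq h f' x = avg h g' x"
    using c1 AE_lborel_shift[OF c1, of h]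
  proof eventually_elim
    case (elim x)
    obtain N :: nat where N: "\<bar>x\<bar> < real N" using reals_Archimedean2 by blast
    have "f' (h + x) - f' x = (LBINT r:{- real N..h + x}. g' r) - (LBINT r:{- real N..x}. g' r)"
    proof -
      have "- real N < x" "- real N < h + x" using N h by linarith+
      then show ?thesis using elim(1)[rule_format, of N] elim(2)[rule_format, of N] by simp
    qed
    also have "\<dots> = (LBINT r:{x..x + h}. g' r)"
      using set_integral_Icc_split[OF li(2), of "- real N" x "x + h"] N h by (simp add: add.commute)
    also have "\<dots> = h *\<^sub>R avg h g' x" by (rule set_integrable_affine(2)[OF li(2) h])
    finally show ?case unfolding diffq_def using h by (simp add: add.commute)
  qed
qed

text \<open>The difference quotients of \<open>f\<close> determine the averages of either
  derivative, and the averages over shrinking intervals recover the derivative almost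
  everywhere.\<close>

lemma has_weak_deriv_unique:
  assumes 1: "has_weak_deriv f g" and 2: "has_weak_deriv f k"
  shows "AE x in lborel. g x = k x"
proof -
  have m: "locally_integrable f" "locally_integrable g" "locally_integrable k" using 1 2 by (auto simp: has_weak_deriv_def)
  obtain f' g' k' where r: "borel_rep f f'" "borel_rep g g'" "borel_rep k k'"
    using borel_rep_exists[OF locally_integrable_measurable] m by metis
  note d = has_weak_deriv_diffq[OF 1 r(1,2)] has_weak_deriv_diffq[OF 2 r(1,3)]
  have "AE x in lborel. \<forall>n. diffq (hn n) f' x = avg (hn n) g' x" "AE x in lborel. \<forall>n. diffq (hn n) f' x = avg (hn n) k' x"
    using d unfolding ac_deriv_def AE_all_countable by auto
  then have "AE x in lborel. g' x = k' x"
    using avg_tendsto_AE[of g', OF locally_integrable_borel_rep[OF m(2) r(2)]] avg_tendsto_AE[of k', OF locally_integrable_borel_rep[OF m(3) r(3)]]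
    by eventually_elim (use LIMSEQ_unique in fastforce)
  then show ?thesis using r(2,3) unfolding borel_rep_def by (auto elim: AE_mp)
qed

lemma locally_integrable_cong:
  assumes f: "locally_integrable f" and eq: "AE x in lborel. f x = g x"
  shows "locally_integrable g"
  unfolding locally_integrable_def
proof (intro allI impI)
  fix K :: "real set" assume K: "compact K"
  then have Ks: "K \<inter> space lebesgue \<in> sets lebesgue" by (auto intro!: sets_completionI_sets borel_compact)
  have "f \<in> borel_measurable lebesgue" by (rule locally_integrable_measurable[OF f])
  moreover from this have "g \<in> borel_measurable lebesgue" by (rule measurable_completion_AE) (use eq in \<open>auto elim: AE_mp\<close>)
  moreover have "AE x in lebesgue. f x = g x" using eq by (simp add: AE_completion_iff)
  moreover have "integrable lebesgue (\<lambda>x. indicator K x *\<^sub>R f x)"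
  proof -
    have "integrable (lebesgue_on K) f" using f K unfolding locally_integrable_def by blast
    then show ?thesis unfolding integrable_restrict_space[OF Ks] .
  qed
  ultimately have "integrable lebesgue (\<lambda>x. indicator K x *\<^sub>R g x)"
    using Ks by (subst integrable_cong_AE[where g="\<lambda>x. indicator K x *\<^sub>R f x"]) (auto elim: AE_mp)
  then show "integrable (lebesgue_on K) g" unfolding integrable_restrict_space[OF Ks] .
qed

lemma has_weak_deriv_cong:
  assumes w: "has_weak_deriv f k" and eq: "AE x in lborel. f x = g x"
  shows "has_weak_deriv g k"
  unfolding has_weak_deriv_def
proof (intro conjI ballI)
  have f: "locally_integrable f" using w by (simp add: has_weak_deriv_def)
  show g: "locally_integrable g" by (rule locally_integrable_cong[OF f eq])
  show "locally_integrable k" using w by (simp add: has_weak_deriv_def)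
  fix \<eta> assume \<eta>: "\<eta> \<in> test_functions UNIV"
  note [measurable] = measurable_completion[of _ lborel, OF test_function_measurable(2)[OF \<eta>, folded measurable_lborel2]]
  note [measurable] = locally_integrable_measurable[OF f] locally_integrable_measurable[OF g]
  have "(LINT x|lebesgue. deriv \<eta> x *\<^sub>R f x) = (LINT x|lebesgue. deriv \<eta> x *\<^sub>R g x)"
    by (rule integral_cong_AE) (use eq in \<open>auto simp: AE_completion_iff elim!: AE_mp\<close>)
  then show "(LINT x|lebesgue. deriv \<eta> x *\<^sub>R g x) = - (LINT x|lebesgue. \<eta> x *\<^sub>R k x)"
    using w \<eta> unfolding has_weak_deriv_def by auto
qed

lemma L2_cong:
  assumes "f \<in> L2" and eq: "AE x in lborel. f x = g x"
  shows "g \<in> L2"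
proof -
  obtain f' where r: "borel_rep f f'" using borel_rep_exists[OF L2_measurable[OF assms(1)]] by blast
  then have "borel_rep g f'" using eq unfolding borel_rep_def by (auto elim: AE_mp)
  then show ?thesis using L2_borel_rep(1)[OF r] L2_borel_rep(1) assms(1) by blast
qed

text \<open>\<open>weak_deriv\<close> is a choice and may differ from the derivatives witnessing
  membership in \<open>sobolev 2\<close>. Uniqueness up to null sets transfers regularity from the
  witnesses to the chosen functions, one order at a time.\<close>

lemma sobolev_2D:
  assumes u: "u \<in> sobolev 2"
  shows "u \<in> L2" "weak_deriv u \<in> L2" "weak_deriv (weak_deriv u) \<in> L2"
    "has_weak_deriv u (weak_deriv u)" "has_weak_deriv (weak_deriv u) (weak_deriv (weak_deriv u))"
proof -
  obtain g k where g: "u \<in> L2" "has_weak_deriv u g" "g \<in> L2" "has_weak_deriv g k" "k \<in> L2"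
    using u by (auto simp: numeral_2_eq_2)
  show "u \<in> L2" by fact
  show w: "has_weak_deriv u (weak_deriv u)" unfolding weak_deriv_def by (rule someI[of _ g]) fact
  have e: "AE x in lborel. g x = weak_deriv u x" by (rule has_weak_deriv_unique[OF g(2) w])
  show "weak_deriv u \<in> L2" by (rule L2_cong[OF g(3) e])
  have wk: "has_weak_deriv (weak_deriv u) k" by (rule has_weak_deriv_cong[OF g(4) e])
  show w2: "has_weak_deriv (weak_deriv u) (weak_deriv (weak_deriv u))"
    unfolding weak_deriv_def[of "weak_deriv u"] by (rule someI[of _ k]) fact
  have "AE x in lborel. k x = weak_deriv (weak_deriv u) x" by (rule has_weak_deriv_unique[OF wk w2])
  then show "weak_deriv (weak_deriv u) \<in> L2" by (rule L2_cong[OF g(5)])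
qed

lemma sobolev_norm_eqs:
  "(sobolev_norm 0 f)\<^sup>2 = (L2_norm f)\<^sup>2"
  "(sobolev_norm 1 f)\<^sup>2 = (L2_norm f)\<^sup>2 + (L2_norm (weak_deriv f))\<^sup>2"
  "(sobolev_norm 2 f)\<^sup>2 = (L2_norm f)\<^sup>2 + (L2_norm (weak_deriv f))\<^sup>2 + (L2_norm (weak_deriv (weak_deriv f)))\<^sup>2"
  by (simp_all add: sobolev_norm_def numeral_2_eq_2 sum_nonneg)

section \<open>Energy identities\<close>

definition loc_sq_int :: "(real \<times> real \<Rightarrow> complex) \<Rightarrow> bool" where
  "loc_sq_int F \<longleftrightarrow> F \<in> borel_measurable (borel \<Otimes>\<^sub>M borel) \<and>
     (\<forall>T. integrable lborel2 (\<lambda>(t, x). indicator {0..T} t * (norm (F (t, x)))\<^sup>2))"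

text \<open>The equation \<open>U_t = V\<close> read on lines of constant \<open>x\<close>. The
  constant \<open>c\<close> depends on \<open>x\<close>, and nothing is said about its
  measurability.\<close>

definition time_primitive :: "(real \<times> real \<Rightarrow> complex) \<Rightarrow> (real \<times> real \<Rightarrow> complex) \<Rightarrow> bool" where
  "time_primitive U V \<longleftrightarrow> loc_sq_int U \<and> loc_sq_int V \<and>
     (AE x in lborel. \<exists>c. AE t in lborel. 0 < t \<longrightarrow> U (t, x) = c + (LBINT s:{0..t}. V (s, x)))"

lemma loc_sq_int_measurable: "loc_sq_int F \<Longrightarrow> F \<in> borel_measurable (borel \<Otimes>\<^sub>M borel)"
  by (simp add: loc_sq_int_def)

lemma loc_sq_int_slice:
  assumes F: "loc_sq_int F"
  shows "AE t in lborel. 0 \<le> t \<longrightarrow> sq_int (\<lambda>x. F (t, x))"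
proof -
  note [measurable] = loc_sq_int_measurable[OF F]
  have "AE t in lborel. integrable lborel (\<lambda>x. indicator {0..real n} t * (norm (F (t, x)))\<^sup>2)" for n
    using lborel_pair.AE_integrable_fst'[of "\<lambda>(t, x). indicator {0..real n} t * (norm (F (t, x)))\<^sup>2"] F
    by (simp add: loc_sq_int_def)
  then have "AE t in lborel. \<forall>n. integrable lborel (\<lambda>x. indicator {0..real n} t * (norm (F (t, x)))\<^sup>2)"
    unfolding AE_all_countable by (rule allI)
  then show ?thesis
  proof eventually_elim
    case (elim t)
    show ?case
    proof
      assume t: "0 \<le> t"
      obtain n where "t \<le> real n" using real_arch_simple by blast
      then have "integrable lborel (\<lambda>x. (norm (F (t, x)))\<^sup>2)" using elim[rule_format, of n] t by simp
      then show "sq_int (\<lambda>x. F (t, x))" by (simp add: sq_int_def)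
    qed
  qed
qed

lemma loc_sq_int_sq_norm:
  assumes F: "loc_sq_int F"
  shows "set_integrable lborel {0..T} (\<lambda>t. sq_norm (\<lambda>x. F (t, x)))"
proof -
  have "integrable lborel (\<lambda>t. LBINT x. indicator {0..T} t * (norm (F (t, x)))\<^sup>2)"
    using lborel_pair.integrable_fst'[of "\<lambda>(t, x). indicator {0..T} t * (norm (F (t, x)))\<^sup>2"] F
    by (simp add: loc_sq_int_def)
  then show ?thesis by (simp add: set_integrable_def sq_norm_def)
qed

lemma loc_sq_int_inner:
  assumes F: "loc_sq_int F" and G: "loc_sq_int G"
  shows "integrable lborel2 (\<lambda>(t, x). indicator {0..T} t * (F (t, x) \<bullet> G (t, x)))"
proof (rule Bochner_Integration.integrable_bound)
  note [measurable] = loc_sq_int_measurable[OF F] loc_sq_int_measurable[OF G]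
  show "integrable lborel2 (\<lambda>p. (case p of (t, x) \<Rightarrow> indicator {0..T} t * (norm (F (t, x)))\<^sup>2) +
     (case p of (t, x) \<Rightarrow> indicator {0..T} t * (norm (G (t, x)))\<^sup>2))"
    using F G by (intro Bochner_Integration.integrable_add) (auto simp: loc_sq_int_def)
  show "(\<lambda>(t, x). indicator {0..T} t * (F (t, x) \<bullet> G (t, x))) \<in> borel_measurable lborel2"
    by measurable
  have "\<bar>F p \<bullet> G p\<bar> \<le> (norm (F p))\<^sup>2 + (norm (G p))\<^sup>2" for p
    by (rule order_trans[OF Cauchy_Schwarz_ineq2 mult_le_sum_squares])
  then show "AE p in lborel2. norm (case p of (t, x) \<Rightarrow> indicator {0..T} t * (F (t, x) \<bullet> G (t, x))) \<le>
     norm ((case p of (t, x) \<Rightarrow> indicator {0..T} t * (norm (F (t, x)))\<^sup>2) + (case p of (t, x) \<Rightarrow> indicator {0..T} t * (norm (G (t, x)))\<^sup>2))"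
    by (auto simp: indicator_def)
qed

lemma loc_sq_int_time_slice:
  assumes F: "loc_sq_int F"
  shows "AE x in lborel. \<forall>T. set_integrable lborel {0..T} (\<lambda>t. F (t, x))"
proof -
  note [measurable] = loc_sq_int_measurable[OF F]
  have "AE x in lborel. integrable lborel (\<lambda>t. indicator {0..real n} t * (norm (F (t, x)))\<^sup>2)" for n
    using lborel_pair.AE_integrable_fst'[OF lborel_pair.integrable_product_swap, of "\<lambda>(t, x). indicator {0..real n} t * (norm (F (t, x)))\<^sup>2"] F
    by (simp add: loc_sq_int_def)
  then have "AE x in lborel. \<forall>n. integrable lborel (\<lambda>t. indicator {0..real n} t * (norm (F (t, x)))\<^sup>2)"
    unfolding AE_all_countable by (rule allI)
  then show ?thesis
  proof eventually_elim
    case (elim x)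
    show ?case
    proof
      fix T :: real
      obtain n where n: "T \<le> real n" using real_arch_simple by blast
      have "set_integrable lborel {0..real n} (\<lambda>t. F (t, x))"
        by (rule set_integrable_of_sq) (use elim in simp_all)
      then show "set_integrable lborel {0..T} (\<lambda>t. F (t, x))"
        by (rule set_integrable_Icc) (use n in auto)
    qed
  qed
qed

text \<open>Moves the variable endpoint \<open>t\<close> from the domain into the integrand, where
  joint measurability in \<open>t\<close> and the parameters can be derived.\<close>

lemma set_integral_Icc_eq_if:
  fixes f :: "real \<Rightarrow> 'a::euclidean_space"
  shows "(LBINT s:{a..t}. f s) = (LBINT s. (if a \<le> s \<and> s \<le> t then f s else 0))"
  unfolding set_lebesgue_integral_def
  by (rule Bochner_Integration.integral_cong) (auto simp: indicator_def)

lemma energy_identity: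
  assumes UV: "time_primitive U V"
  shows "set_integrable lborel {0..T} (\<lambda>t. 2 * (LBINT x. U (t, x) \<bullet> V (t, x)))"
    and "\<exists>C. AE t in lborel. 0 < t \<longrightarrow>
      sq_norm (\<lambda>x. U (t, x)) = C + (LBINT s:{0..t}. 2 * (LBINT x. U (s, x) \<bullet> V (s, x)))"
proof -
  have U: "loc_sq_int U" and V: "loc_sq_int V"
    and prim: "AE x in lborel. \<exists>c. AE t in lborel. 0 < t \<longrightarrow> U (t, x) = c + (LBINT s:{0..t}. V (s, x))"
    using UV by (auto simp: time_primitive_def)
  note [measurable] = loc_sq_int_measurable[OF U] loc_sq_int_measurable[OF V]
  note UVi = loc_sq_int_inner[OF U V]
  have "set_integrable lborel {0..T} (\<lambda>t. LBINT x. U (t, x) \<bullet> V (t, x))" for T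
    using lborel_pair.integrable_fst'[OF UVi[of T]] by (simp add: set_integrable_def)
  then show "set_integrable lborel {0..T} (\<lambda>t. 2 * (LBINT x. U (t, x) \<bullet> V (t, x)))" for T by simp
  define W where "W t x = (LBINT s:{0..t}. V (s, x))" for t x
  have [measurable]: "(\<lambda>(t, x). W t x) \<in> borel_measurable (borel \<Otimes>\<^sub>M borel)"
    unfolding W_def set_integral_Icc_eq_if case_prod_unfold by measurable
  \<comment> \<open>The constants of \<open>prim\<close> are only known to exist. Their value is
    recovered as the mean of \<open>U - W\<close> over a unit interval of time, an expression that
    is visibly measurable in \<open>x\<close>.\<close>
  define c where "c x = (LBINT t:{0..1}. U (t, x) - W t x)" for x
  have [measurable]: "c \<in> borel_measurable borel"
    unfolding c_def set_integral_Icc_eq_if by measurable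
  have c1: "AE x in lborel. AE t in lborel. 0 < t \<longrightarrow> U (t, x) = c x + W t x"
    using prim
  proof eventually_elim
    case (elim x)
    then obtain c' where c': "AE t in lborel. 0 < t \<longrightarrow> U (t, x) = c' + W t x" unfolding W_def by blast
    have "c x = (LBINT t:{0..1::real}. c')"
      unfolding c_def set_lebesgue_integral_def
    proof (rule integral_cong_AE)
      show "AE t in lborel. indicat_real {0..1} t *\<^sub>R (U (t, x) - W t x) = indicat_real {0..1} t *\<^sub>R c'"
        using c' AE_lborel_singleton[of 0] by eventually_elim (auto simp: indicator_def)
    qed measurable
    also have "\<dots> = c'" by (simp add: set_lebesgue_integral_def)
    finally show ?case using c' by simp
  qed
  have c2: "AE t in lborel. AE x in lborel. 0 < t \<longrightarrow> U (t, x) = c x + W t x"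
    using c1 by (subst (asm) lborel_pair.AE_commute) measurable
  have sq: "AE x in lborel. \<forall>t. 0 \<le> t \<longrightarrow> (norm (c x + W t x))\<^sup>2 = (norm (c x))\<^sup>2 + (LBINT s:{0..t}. 2 * (U (s, x) \<bullet> V (s, x)))"
    using c1 loc_sq_int_time_slice[OF V]
  proof eventually_elim
    case (elim x)
    have W: "ac_from 0 (\<lambda>t. W t x) (\<lambda>s. V (s, x))"
      unfolding W_def by (rule ac_from_integral) (use elim(2) in auto)
    have W0: "W 0 x = 0" unfolding W_def by (rule set_integral_Icc_self)
    have cW: "ac_from 0 (\<lambda>t. c x + W t x) (\<lambda>s. 0 + V (s, x))"
      by (intro ac_from_add ac_from_const W)
    note Q = ac_fromD(2)[OF ac_from_prod[OF bounded_bilinear_inner cW cW] order_refl]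
    show ?case
    proof (intro allI impI)
      fix t :: real assume t: "0 \<le> t"
      have "(LBINT s:{0..t}. (0 + V (s, x)) \<bullet> (c x + W s x) + (c x + W s x) \<bullet> (0 + V (s, x))) = (LBINT s:{0..t}. 2 * (U (s, x) \<bullet> V (s, x)))"
        unfolding set_lebesgue_integral_def
      proof (rule integral_cong_AE)
        show "AE s in lborel. indicat_real {0..t} s *\<^sub>R ((0 + V (s, x)) \<bullet> (c x + W s x) + (c x + W s x) \<bullet> (0 + V (s, x))) =
           indicat_real {0..t} s *\<^sub>R (2 * (U (s, x) \<bullet> V (s, x)))"
          using elim(1) AE_lborel_singleton[of 0] by eventually_elim (auto simp: indicator_def inner_commute)
      qed measurable
      then show "(norm (c x + W t x))\<^sup>2 = (norm (c x))\<^sup>2 + (LBINT s:{0..t}. 2 * (U (s, x) \<bullet> V (s, x)))"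
        using Q[OF t] W0 by (simp add: power2_norm_eq_inner)
    qed
  qed
  have "AE t in lborel. 0 < t \<longrightarrow> sq_norm (\<lambda>x. U (t, x)) = sq_norm c + (LBINT s:{0..t}. 2 * (LBINT x. U (s, x) \<bullet> V (s, x)))"
    using c2 loc_sq_int_slice[OF U]
  proof eventually_elim
    case (elim t)
    show ?case
    proof
      assume t: "0 < t"
      let ?K = "\<lambda>s x. 2 * (case (s, x) of (s, x) \<Rightarrow> indicator {0..t} s * (U (s, x) \<bullet> V (s, x)))"
      define R where "R x = (LBINT s:{0..t}. 2 * (U (s, x) \<bullet> V (s, x)))" for x
      note i2 = integrable_mult_right[OF UVi[of t], of 2]
      have e: "(\<lambda>s. indicator {0..t} s *\<^sub>R (2 * (U (s, x) \<bullet> V (s, x)))) = (\<lambda>s. ?K s x)" for x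
        by (auto simp: fun_eq_iff)
      have Ri: "integrable lborel R"
        using lborel_pair.integrable_snd[of "\<lambda>s x. ?K s x"] i2
        unfolding R_def[abs_def] set_lebesgue_integral_def e by (simp add: case_prod_unfold)
      have RI: "integral\<^sup>L lborel R = (LBINT s:{0..t}. 2 * (LBINT x. U (s, x) \<bullet> V (s, x)))"
      proof -
        have "integral\<^sup>L lborel R = (LBINT x. LBINT s. ?K s x)"
          unfolding R_def[abs_def] set_lebesgue_integral_def e ..
        also have "\<dots> = (LBINT s. LBINT x. ?K s x)"
          by (rule lborel_pair.Fubini_integral) (use i2 in \<open>simp add: case_prod_unfold\<close>)
        also have "\<dots> = (LBINT s:{0..t}. 2 * (LBINT x. U (s, x) \<bullet> V (s, x)))"
          unfolding set_lebesgue_integral_def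
          by (rule Bochner_Integration.integral_cong) (auto simp: indicator_def)
        finally show ?thesis .
      qed
      have Ui: "integrable lborel (\<lambda>x. (norm (U (t, x)))\<^sup>2)" using elim(2) t by (simp add: sq_int_def)
      have ae: "AE x in lborel. (norm (U (t, x)))\<^sup>2 - R x = (norm (c x))\<^sup>2"
        using elim(1) sq by eventually_elim (use t in \<open>auto simp: R_def\<close>)
      \<comment> \<open>The function on the right is integrable, so the integral can be split; its
        value \<open>sq_norm c\<close> is the constant of the energy identity, the same for all such
        \<open>t\<close>.\<close>
      have "sq_norm c = (LBINT x. (norm (U (t, x)))\<^sup>2 - R x)"
        unfolding sq_norm_def
      proof (rule integral_cong_AE)
        show "AE x in lborel. (norm (c x))\<^sup>2 = (norm (U (t, x)))\<^sup>2 - R x" using ae by eventually_elim simp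
        show "(\<lambda>x. (norm (U (t, x)))\<^sup>2 - R x) \<in> borel_measurable lborel" using Ri Ui by auto
      qed measurable
      also have "\<dots> = sq_norm (\<lambda>x. U (t, x)) - integral\<^sup>L lborel R" unfolding sq_norm_def using Ui Ri by simp
      finally show "sq_norm (\<lambda>x. U (t, x)) = sq_norm c + (LBINT s:{0..t}. 2 * (LBINT x. U (s, x) \<bullet> V (s, x)))"
        using RI by simp
    qed
  qed
  then show "\<exists>C. AE t in lborel. 0 < t \<longrightarrow>
      sq_norm (\<lambda>x. U (t, x)) = C + (LBINT s:{0..t}. 2 * (LBINT x. U (s, x) \<bullet> V (s, x)))" by blast
qed

lemma loc_sq_int_shift:
  assumes F: "loc_sq_int F"
  shows "loc_sq_int (\<lambda>(t, x). F (t, x + h))"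
  unfolding loc_sq_int_def
proof (intro conjI allI)
  note [measurable] = loc_sq_int_measurable[OF F]
  show "(\<lambda>(t, x). F (t, x + h)) \<in> borel_measurable (borel \<Otimes>\<^sub>M borel)" by measurable
  fix T
  define f where "f p = ennreal (indicator {0..T} (fst p) * (norm (F p))\<^sup>2)" for p
  have [measurable]: "f \<in> borel_measurable (borel \<Otimes>\<^sub>M borel)" unfolding f_def by measurable
  have "integrable lborel2 (\<lambda>(t, x). indicator {0..T} t * (norm (F (t, x)))\<^sup>2)" using F by (simp add: loc_sq_int_def)
  then have fin: "(\<integral>\<^sup>+p. f p \<partial>lborel2) < \<infinity>"
    unfolding integrable_iff_bounded f_def by (simp add: case_prod_unfold)
  have "(\<integral>\<^sup>+p. f (fst p, snd p + h) \<partial>lborel2) = (\<integral>\<^sup>+t. \<integral>\<^sup>+x. f (t, x + h) \<partial>lborel \<partial>lborel)"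
    by (subst lborel.nn_integral_fst[symmetric]) simp_all
  also have "\<dots> = (\<integral>\<^sup>+t. \<integral>\<^sup>+x. f (t, x) \<partial>lborel \<partial>lborel)"
  proof (rule nn_integral_cong)
    fix t
    show "(\<integral>\<^sup>+x. f (t, x + h) \<partial>lborel) = (\<integral>\<^sup>+x. f (t, x) \<partial>lborel)"
      using nn_integral_real_affine[of "\<lambda>x. f (t, x)" 1 h] by (simp add: add.commute)
  qed
  also have "\<dots> = (\<integral>\<^sup>+p. f p \<partial>lborel2)" by (rule lborel.nn_integral_fst) simp
  finally have "(\<integral>\<^sup>+p. f (fst p, snd p + h) \<partial>lborel2) < \<infinity>" using fin by simp
  then show "integrable lborel2 (\<lambda>(t, x). indicator {0..T} t * (norm (case (t, x) of (t, x) \<Rightarrow> F (t, x + h)))\<^sup>2)"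
    unfolding integrable_iff_bounded f_def by (simp add: case_prod_unfold)
qed

lemma loc_sq_int_diff:
  assumes F: "loc_sq_int F" and G: "loc_sq_int G"
  shows "loc_sq_int (\<lambda>p. (F p - G p) /\<^sub>R h)"
  unfolding loc_sq_int_def
proof (intro conjI allI)
  note [measurable] = loc_sq_int_measurable[OF F] loc_sq_int_measurable[OF G]
  show "(\<lambda>p. (F p - G p) /\<^sub>R h) \<in> borel_measurable (borel \<Otimes>\<^sub>M borel)" by measurable
  fix T
  show "integrable lborel2 (\<lambda>(t, x). indicator {0..T} t * (norm ((F (t, x) - G (t, x)) /\<^sub>R h))\<^sup>2)"
  proof (rule Bochner_Integration.integrable_bound)
    show "integrable lborel2 (\<lambda>p. (2 * (inverse h)\<^sup>2) * ((case p of (t, x) \<Rightarrow> indicator {0..T} t * (norm (F (t, x)))\<^sup>2) +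
       (case p of (t, x) \<Rightarrow> indicator {0..T} t * (norm (G (t, x)))\<^sup>2)))"
      using F G by (intro integrable_mult_right Bochner_Integration.integrable_add) (auto simp: loc_sq_int_def)
    show "(\<lambda>(t, x). indicator {0..T} t * (norm ((F (t, x) - G (t, x)) /\<^sub>R h))\<^sup>2) \<in> borel_measurable lborel2" by measurable
    have "(norm ((F p - G p) /\<^sub>R h))\<^sup>2 \<le> 2 * (inverse h)\<^sup>2 * ((norm (F p))\<^sup>2 + (norm (G p))\<^sup>2)" for p
    proof -
      have "(norm (F p - G p))\<^sup>2 \<le> (norm (F p) + norm (G p))\<^sup>2" by (intro power_mono norm_triangle_ineq4) auto
      also have "\<dots> \<le> 2 * ((norm (F p))\<^sup>2 + (norm (G p))\<^sup>2)"
        using sum_squares_bound[of "norm (F p)" "norm (G p)"] by (simp add: power2_sum)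
      finally have "(inverse h)\<^sup>2 * (norm (F p - G p))\<^sup>2 \<le> (inverse h)\<^sup>2 * (2 * ((norm (F p))\<^sup>2 + (norm (G p))\<^sup>2))"
        by (rule mult_left_mono) simp
      then show ?thesis by (simp add: power_mult_distrib power_inverse distrib_left mult_ac)
    qed
    then show "AE p in lborel2. norm (case p of (t, x) \<Rightarrow> indicator {0..T} t * (norm ((F (t, x) - G (t, x)) /\<^sub>R h))\<^sup>2) \<le>
        norm ((2 * (inverse h)\<^sup>2) * ((case p of (t, x) \<Rightarrow> indicator {0..T} t * (norm (F (t, x)))\<^sup>2) +
       (case p of (t, x) \<Rightarrow> indicator {0..T} t * (norm (G (t, x)))\<^sup>2)))"
      by (auto simp: indicator_def)
  qed
qed

text \<open>Shifting \<open>x\<close> preserves the equation on lines of constant \<open>x\<close>;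
  it also shifts the exceptional null set, so both \<open>x\<close> and \<open>h + x\<close> must
  avoid it.\<close>

lemma time_primitive_diffq:
  assumes UV: "time_primitive U V"
  shows "time_primitive (\<lambda>(t, x). diffq h (\<lambda>x. U (t, x)) x) (\<lambda>(t, x). diffq h (\<lambda>x. V (t, x)) x)"
proof -
  have U: "loc_sq_int U" and V: "loc_sq_int V"
    and prim: "AE x in lborel. \<exists>c. AE t in lborel. 0 < t \<longrightarrow> U (t, x) = c + (LBINT s:{0..t}. V (s, x))"
    using UV by (auto simp: time_primitive_def)
  have e: "(\<lambda>(t, x). diffq h (\<lambda>x. F (t, x)) x) = (\<lambda>p. ((case p of (t, x) \<Rightarrow> F (t, x + h)) - F p) /\<^sub>R h)" for F :: "real \<times> real \<Rightarrow> complex"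
    by (auto simp: diffq_def fun_eq_iff)
  note sl = loc_sq_int_time_slice[OF V]
  show ?thesis
    unfolding time_primitive_def
  proof (intro conjI)
    show "loc_sq_int (\<lambda>(t, x). diffq h (\<lambda>x. U (t, x)) x)" unfolding e by (intro loc_sq_int_diff loc_sq_int_shift U)
    show "loc_sq_int (\<lambda>(t, x). diffq h (\<lambda>x. V (t, x)) x)" unfolding e by (intro loc_sq_int_diff loc_sq_int_shift V)
    show "AE x in lborel. \<exists>c. AE t in lborel. 0 < t \<longrightarrow> (case (t, x) of (t, x) \<Rightarrow> diffq h (\<lambda>x. U (t, x)) x) =
       c + (LBINT s:{0..t}. case (s, x) of (t, x) \<Rightarrow> diffq h (\<lambda>x. V (t, x)) x)"
      using prim AE_lborel_shift[OF prim, of h] sl AE_lborel_shift[OF sl, of h]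
    proof eventually_elim
      case (elim x)
      obtain c where c: "AE t in lborel. 0 < t \<longrightarrow> U (t, x) = c + (LBINT s:{0..t}. V (s, x))" using elim(1) by blast
      obtain d where d: "AE t in lborel. 0 < t \<longrightarrow> U (t, h + x) = d + (LBINT s:{0..t}. V (s, h + x))" using elim(2) by blast
      have "AE t in lborel. 0 < t \<longrightarrow> diffq h (\<lambda>x. U (t, x)) x = (d - c) /\<^sub>R h + (LBINT s:{0..t}. diffq h (\<lambda>x. V (s, x)) x)"
        using c d
      proof eventually_elim
        case (elim t)
        have "(LBINT s:{0..t}. diffq h (\<lambda>x. V (s, x)) x) = ((LBINT s:{0..t}. V (s, h + x)) - (LBINT s:{0..t}. V (s, x))) /\<^sub>R h"
          unfolding diffq_def
          using set_integral_diff(2)[of lborel "{0..t}" "\<lambda>s. V (s, h + x)" "\<lambda>s. V (s, x)"] \<open>\<forall>T. set_integrable lborel {0..T} (\<lambda>t. V (t, x))\<close>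
            \<open>\<forall>T. set_integrable lborel {0..T} (\<lambda>t. V (t, h + x))\<close> by (simp add: add.commute)
        then show ?case using elim by (simp add: diffq_def add.commute scaleR_add_right scaleR_diff_right)
      qed
      then show ?case by auto
    qed
  qed
qed

lemma ex_pos_of_AE:
  assumes "AE t in lborel. 0 < t \<longrightarrow> P (t::real)"
  shows "\<exists>t>0. P t"
proof (rule ccontr)
  assume n: "\<not> (\<exists>t>0. P t)"
  have "AE t in lborel. \<not> (0 < (t::real))" using assms by eventually_elim (use n in blast)
  then have "AE t in lborel. t \<notin> {0<..<1::real}" by eventually_elim auto
  then have "emeasure lborel {0<..<1::real} = 0"
    by (subst (asm) AE_iff_measurable[of "{0<..<1}"]) auto
  then show False by simp
qed

text \<open>
  \<open>g\<close> and \<open>k\<close> are chosen for each \<open>t\<close> separately and need not be jointly measurable, so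
  the density \<open>Q\<close> is defined as a limit of densities for difference quotients.
\<close>

lemma second_energy_identity:
  assumes UV: "time_primitive U V"
    and reg: "AE t in lborel. 0 \<le> t \<longrightarrow> sq_int (g t) \<and> sq_int (k t) \<and> ac_deriv (\<lambda>x. U (t, x)) (g t) \<and> ac_deriv (g t) (k t)"
    and m: "\<And>T. set_integrable lborel {0..T} m" "AE t in lborel. 0 \<le> t \<longrightarrow> sq_norm (k t) \<le> m t"
  obtains Q C where "\<And>T. set_integrable lborel {0..T} Q"
    "AE t in lborel. 0 \<le> t \<longrightarrow> Q t = - 2 * (LBINT x. k t x \<bullet> V (t, x))"
    "AE t in lborel. 0 < t \<longrightarrow> sq_norm (g t) = C + (LBINT s:{0..t}. Q s)"
proof -
  have U: "loc_sq_int U" and V: "loc_sq_int V" using UV by (auto simp: time_primitive_def)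
  note [measurable] = loc_sq_int_measurable[OF U] loc_sq_int_measurable[OF V]
  define P where "P n t = 2 * (LBINT x. diffq (hn n) (\<lambda>x. U (t, x)) x \<bullet> diffq (hn n) (\<lambda>x. V (t, x)) x)" for n t
  define S where "S n t = sq_norm (diffq (hn n) (\<lambda>x. U (t, x)))" for n t
  have [measurable]: "P n \<in> borel_measurable borel" for n unfolding P_def diffq_def by measurable
  have "\<exists>C. AE t in lborel. 0 < t \<longrightarrow> S n t = C + (LBINT s:{0..t}. P n s)" for n
    using energy_identity(2)[OF time_primitive_diffq[OF UV, of "hn n"]] by (simp add: P_def S_def)
  then obtain C where C: "\<And>n. AE t in lborel. 0 < t \<longrightarrow> S n t = C n + (LBINT s:{0..t}. P n s)" by metis
  have C: "AE t in lborel. \<forall>n. 0 < t \<longrightarrow> S n t = C n + (LBINT s:{0..t}. P n s)"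
    unfolding AE_all_countable by (rule allI) (rule C)
  define Q where "Q t = lim (\<lambda>n. P n t)" for t
  have [measurable]: "Q \<in> borel_measurable borel" unfolding Q_def by (rule borel_measurable_lim_metric) simp
  have lims: "AE t in lborel. 0 \<le> t \<longrightarrow> (\<lambda>n. P n t) \<longlonglongrightarrow> - 2 * (LBINT x. k t x \<bullet> V (t, x)) \<and>
      (\<forall>n. \<bar>P n t\<bar> \<le> m t + sq_norm (\<lambda>x. V (t, x))) \<and> (\<lambda>n. S n t) \<longlonglongrightarrow> sq_norm (g t)"
    (is "AE t in lborel. 0 \<le> t \<longrightarrow> ?R t")
    using reg m(2) loc_sq_int_slice[OF U] loc_sq_int_slice[OF V]
  proof eventually_elim
    case (elim t)
    show ?case
    proof
      assume t: "0 \<le> t"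
      have r: "sq_int (\<lambda>x. U (t, x))" "sq_int (g t)" "sq_int (k t)" "sq_int (\<lambda>x. V (t, x))"
        "ac_deriv (\<lambda>x. U (t, x)) (g t)" "ac_deriv (g t) (k t)" using elim t by auto
      have "(\<lambda>n. P n t) \<longlonglongrightarrow> 2 * (- (LBINT x. k t x \<bullet> V (t, x)))"
        unfolding P_def by (intro tendsto_mult_left inner_diffq_tendsto(1)[OF r])
      moreover have "\<bar>P n t\<bar> \<le> m t + sq_norm (\<lambda>x. V (t, x))" for n
        using inner_diffq_tendsto(2)[OF r, of n] elim(2) t unfolding P_def by (simp add: abs_mult)
      moreover have "(\<lambda>n. S n t) \<longlonglongrightarrow> sq_norm (g t)"
        unfolding S_def by (rule sq_norm_diffq_tendsto[OF r(1,2,5)])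
      ultimately show "?R t" by simp
    qed
  qed
  have Qk: "AE t in lborel. 0 \<le> t \<longrightarrow> Q t = - 2 * (LBINT x. k t x \<bullet> V (t, x))"
    using lims by eventually_elim (auto simp: Q_def limI)
  \<comment> \<open>The bound \<open>sq_norm (k t) + sq_norm V\<close> is uniform in
    \<open>n\<close>, but \<open>sq_norm (k t)\<close> need not be measurable in \<open>t\<close>;
    \<open>m\<close> stands in for it.\<close>
  have dom: "integrable lborel (\<lambda>t. indicator {0..T} t *\<^sub>R (m t + sq_norm (\<lambda>x. V (t, x))))" for T
    using set_integral_add(1)[OF m(1) loc_sq_int_sq_norm[OF V], of T] by (simp add: set_integrable_def)
  have cv: "AE t in lborel. (\<lambda>n. indicator {0..T} t *\<^sub>R P n t) \<longlonglongrightarrow> indicator {0..T} t *\<^sub>R Q t" for T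
    using lims
  proof eventually_elim
    case (elim t)
    show ?case
    proof (cases "t \<in> {0..T}")
      case True
      then have "(\<lambda>n. P n t) \<longlonglongrightarrow> Q t" using elim limI unfolding Q_def by fastforce
      then show ?thesis by (intro tendsto_intros)
    qed auto
  qed
  have bd: "AE t in lborel. norm (indicator {0..T} t *\<^sub>R P n t) \<le> indicator {0..T} t *\<^sub>R (m t + sq_norm (\<lambda>x. V (t, x)))" for T n
    using lims by eventually_elim (auto simp: indicator_def)
  have Qi: "set_integrable lborel {0..T} Q" for T
    unfolding set_integrable_def
    by (rule integrable_dominated_convergence[OF _ _ dom cv bd]) measurable
  have Pl: "(\<lambda>n. LBINT s:{0..T}. P n s) \<longlonglongrightarrow> (LBINT s:{0..T}. Q s)" for T
    unfolding set_lebesgue_integral_def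
    by (rule integral_dominated_convergence[OF _ _ dom cv bd]) measurable
  have "AE t in lborel. 0 < t \<longrightarrow> (\<forall>n. S n t = C n + (LBINT s:{0..t}. P n s)) \<and> (\<lambda>n. S n t) \<longlonglongrightarrow> sq_norm (g t)"
    using C lims by eventually_elim auto
  \<comment> \<open>\<open>C n\<close> does not depend on \<open>t\<close>. Convergence of the other
    two terms at a single time forces \<open>C\<close> to converge, and uniqueness of limits then
    gives the same constant for almost every time.\<close>
  then have Cl: "AE t in lborel. 0 < t \<longrightarrow> C \<longlonglongrightarrow> sq_norm (g t) - (LBINT s:{0..t}. Q s)"
  proof eventually_elim
    case (elim t)
    show ?case
    proof
      assume "0 < t"
      then have e: "\<forall>n. S n t = C n + (LBINT s:{0..t}. P n s)" and l: "(\<lambda>n. S n t) \<longlonglongrightarrow> sq_norm (g t)"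
        using elim by blast+
      have "(\<lambda>n. S n t - (LBINT s:{0..t}. P n s)) \<longlonglongrightarrow> sq_norm (g t) - (LBINT s:{0..t}. Q s)"
        by (rule tendsto_diff[OF l Pl])
      moreover have "(\<lambda>n. S n t - (LBINT s:{0..t}. P n s)) = C" using e by auto
      ultimately show "C \<longlonglongrightarrow> sq_norm (g t) - (LBINT s:{0..t}. Q s)" by simp
    qed
  qed
  obtain t0 where t0: "C \<longlonglongrightarrow> sq_norm (g t0) - (LBINT s:{0..t0}. Q s)"
    using ex_pos_of_AE[OF Cl] by blast
  define C0 where "C0 = sq_norm (g t0) - (LBINT s:{0..t0}. Q s)"
  have "AE t in lborel. 0 < t \<longrightarrow> sq_norm (g t) = C0 + (LBINT s:{0..t}. Q s)"
    using Cl
  proof eventually_elim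
    case (elim t)
    show ?case
    proof
      assume "0 < t"
      then have "sq_norm (g t) - (LBINT s:{0..t}. Q s) = C0"
        using elim LIMSEQ_unique[OF _ t0] unfolding C0_def by blast
      then show "sq_norm (g t) = C0 + (LBINT s:{0..t}. Q s)" by simp
    qed
  qed
  from that[OF Qi Qk this] show ?thesis .
qed

section \<open>Vanishing of rapidly decaying solutions\<close>

text \<open>Exchanging the two quantifiers requires a measurable set, which \<open>Q\<close> need
  not define; so the exchange is done for a measurable null set \<open>N\<close> containing the
  exceptions.\<close>

lemma AE_lborel_pairD:
  assumes "AE p in (lborel::(real \<times> real) measure). Q p"
  shows "AE t in lborel. AE x in lborel. Q (t, x)" "AE x in lborel. AE t in lborel. Q (t, x)"
proof -
  have Q: "AE p in lborel2. Q p" unfolding lborel_prod by (rule assms)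
  then show "AE t in lborel. AE x in lborel. Q (t, x)" by (rule lborel_pair.AE_pair)
  obtain N where N: "{p \<in> space lborel2. \<not> Q p} \<subseteq> N" "emeasure lborel2 N = 0" "N \<in> sets lborel2"
    using Q by (rule AE_E)
  then have "N \<in> null_sets lborel2" by (intro null_setsI)
  then have "AE p in lborel2. p \<notin> N" by (rule AE_not_in)
  then have "AE t in lborel. AE x in lborel. (t, x) \<notin> N" by (rule lborel_pair.AE_pair)
  moreover have "{p \<in> space lborel2. (fst p, snd p) \<notin> N} \<in> sets lborel2"
    using sets.compl_sets[OF N(3)] by (simp add: set_diff_eq)
  ultimately have "AE x in lborel. AE t in lborel. (t, x) \<notin> N" by (subst (asm) lborel_pair.AE_commute)
  moreover have "Q (t, x)" if "(t, x) \<notin> N" for t x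
    using that N(1) by (auto simp: space_pair_measure)
  ultimately show "AE x in lborel. AE t in lborel. Q (t, x)"
    by (auto elim!: eventually_mono)
qed

text \<open>
  Lebesgue measurability in the plane does not pass to the product of the two completed measures;
  Borel representatives make Fubini available.
\<close>

lemma borel_rep_joint:
  fixes w :: "real \<Rightarrow> real \<Rightarrow> complex"
  assumes "(\<lambda>(t, x). w t x) \<in> borel_measurable (lebesgue_on ({0..} \<times> UNIV))"
  obtains W where "W \<in> borel_measurable (borel \<Otimes>\<^sub>M borel)"
    "AE t in lborel. 0 \<le> t \<longrightarrow> borel_rep (w t) (\<lambda>x. W (t, x))"
    "AE x in lborel. AE t in lborel. 0 \<le> t \<longrightarrow> w t x = W (t, x)"
    "AE p in lborel. 0 \<le> fst p \<longrightarrow> w (fst p) (snd p) = W p"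
proof -
  let ?D = "{0..} \<times> UNIV :: (real \<times> real) set"
  have D: "?D \<inter> space lebesgue \<in> sets lebesgue"
    by (auto intro!: sets_completionI_sets borel_closed closed_Times)
  have "(\<lambda>p. indicator ?D p *\<^sub>R (case p of (t, x) \<Rightarrow> w t x)) \<in> borel_measurable lebesgue"
    using assms unfolding borel_measurable_restrict_space_iff[OF D] .
  then obtain W where W: "W \<in> borel_measurable lborel"
    "AE p in lborel. indicator ?D p *\<^sub>R (case p of (t, x) \<Rightarrow> w t x) = W p"
    using completion_ex_borel_complex by blast
  have Wm [measurable]: "W \<in> borel_measurable (borel \<Otimes>\<^sub>M borel)" using W(1) by (simp add: borel_prod)
  note ae = AE_lborel_pairD[OF W(2)]
  show ?thesis
  proof (rule that[OF Wm])
    show "AE t in lborel. 0 \<le> t \<longrightarrow> borel_rep (w t) (\<lambda>x. W (t, x))"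
      using ae(1)
    proof eventually_elim
      case (elim t)
      show ?case
      proof
        assume "0 \<le> t"
        then have "AE x in lborel. w t x = W (t, x)" using elim by simp
        then show "borel_rep (w t) (\<lambda>x. W (t, x))" unfolding borel_rep_def by simp
      qed
    qed
    show "AE x in lborel. AE t in lborel. 0 \<le> t \<longrightarrow> w t x = W (t, x)"
      using ae(2) by eventually_elim (auto elim!: eventually_mono)
    show "AE p in lborel. 0 \<le> fst p \<longrightarrow> w (fst p) (snd p) = W p"
      using W(2) by eventually_elim (auto simp: case_prod_unfold)
  qed
qed

lemma AE_lebesgue_on_Ici: "(AE t in lebesgue_on {0..}. P t) \<longleftrightarrow> (AE t in lborel. 0 \<le> t \<longrightarrow> P (t::real))"
  by (subst AE_restrict_space_iff) (auto simp: AE_completion_iff)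

lemma loc_sq_int_of_L2_loc:
  fixes w :: "real \<Rightarrow> real \<Rightarrow> complex"
  assumes w: "w \<in> L2_loc_sobolev 0" and [measurable]: "W \<in> borel_measurable (borel \<Otimes>\<^sub>M borel)"
    and rep: "AE t in lborel. 0 \<le> t \<longrightarrow> borel_rep (w t) (\<lambda>x. W (t, x))"
  shows "loc_sq_int W"
proof -
  have L: "AE t in lborel. 0 \<le> t \<longrightarrow> w t \<in> L2"
    using w by (simp add: L2_loc_sobolev_def AE_lebesgue_on_Ici)
  have pos: "integrable lborel2 (\<lambda>(t, x). indicator {0..T} t * (norm (W (t, x)))\<^sup>2)" if T: "0 < T" for T
  proof -
    define f where "f p = ennreal (indicator {0..T} (fst p) * (norm (W p))\<^sup>2)" for p
    have [measurable]: "f \<in> borel_measurable (borel \<Otimes>\<^sub>M borel)" unfolding f_def by measurable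
    have i: "integrable lebesgue (\<lambda>t. indicator {0..T} t *\<^sub>R (sobolev_norm 0 (w t))\<^sup>2)"
    proof -
      have "integrable (lebesgue_on {0..T}) (\<lambda>t. (sobolev_norm 0 (w t))\<^sup>2)" using w T by (simp add: L2_loc_sobolev_def)
      then show ?thesis by (subst (asm) integrable_restrict_space) auto
    qed
    have "(\<integral>\<^sup>+p. f p \<partial>lborel2) = (\<integral>\<^sup>+t. \<integral>\<^sup>+x. f (t, x) \<partial>lborel \<partial>lborel)"
      by (subst lborel.nn_integral_fst) simp_all
    also have "\<dots> = (\<integral>\<^sup>+t. ennreal (norm (indicator {0..T} t *\<^sub>R (sobolev_norm 0 (w t))\<^sup>2)) \<partial>lborel)"
    proof (rule nn_integral_cong_AE)
      show "AE t in lborel. (\<integral>\<^sup>+x. f (t, x) \<partial>lborel) = ennreal (norm (indicator {0..T} t *\<^sub>R (sobolev_norm 0 (w t))\<^sup>2))"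
        using L rep
      proof eventually_elim
        case (elim t)
        show ?case
        proof (cases "t \<in> {0..T}")
          case True
          then have r: "borel_rep (w t) (\<lambda>x. W (t, x))" and "w t \<in> L2" using elim by auto
          then have s: "sq_int (\<lambda>x. W (t, x))" using L2_borel_rep(1) by blast
          have "(\<integral>\<^sup>+x. f (t, x) \<partial>lborel) = (\<integral>\<^sup>+x. ennreal ((norm (W (t, x)))\<^sup>2) \<partial>lborel)"
            using True by (simp add: f_def)
          also have "\<dots> = ennreal (sq_norm (\<lambda>x. W (t, x)))"
            unfolding sq_norm_def using s by (intro nn_integral_eq_integral) (auto simp: sq_int_def)
          also have "sq_norm (\<lambda>x. W (t, x)) = (sobolev_norm 0 (w t))\<^sup>2"
            using L2_borel_rep(2)[OF r] by (simp only: sobolev_norm_eqs(1))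
          finally show ?thesis using True by simp
        qed (simp add: f_def)
      qed
    qed
    also have "\<dots> < \<infinity>"
      using i unfolding integrable_iff_bounded nn_integral_completion by simp
    finally show ?thesis
      unfolding integrable_iff_bounded f_def by (simp add: case_prod_unfold)
  qed
  show ?thesis
    unfolding loc_sq_int_def
  proof (intro conjI allI)
    fix T :: real
    show "integrable lborel2 (\<lambda>(t, x). indicator {0..T} t * (norm (W (t, x)))\<^sup>2)"
    proof (rule Bochner_Integration.integrable_bound)
      \<comment> \<open>\<open>L2_loc_sobolev\<close> speaks of positive times only, whereas
        \<open>loc_sq_int\<close> quantifies over all \<open>T\<close>.\<close>
      show "integrable lborel2 (\<lambda>(t, x). indicator {0..max T 1} t * (norm (W (t, x)))\<^sup>2)" by (rule pos) simp
      show "(\<lambda>(t, x). indicator {0..T} t * (norm (W (t, x)))\<^sup>2) \<in> borel_measurable lborel2" by measurable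
      show "AE p in lborel2. norm (case p of (t, x) \<Rightarrow> indicator {0..T} t * (norm (W (t, x)))\<^sup>2)
          \<le> norm (case p of (t, x) \<Rightarrow> indicator {0..max T 1} t * (norm (W (t, x)))\<^sup>2)"
        by (rule AE_I2) (auto simp: indicator_def)
    qed
  qed simp
qed

lemma test_function_vanish:
  assumes \<eta>: "\<eta> \<in> test_functions S" and t: "t \<notin> S"
  shows "\<eta> t = 0" "deriv \<eta> t = 0"
proof -
  define C where "C = closure {x. \<eta> x \<noteq> 0}"
  have tC: "t \<in> - C" using \<eta> t unfolding C_def test_functions_def by blast
  have z: "0 = \<eta> x" if "x \<in> - C" for x
    using that closure_subset[of "{x. \<eta> x \<noteq> 0}"] unfolding C_def by auto
  have oC: "open (- C)" unfolding C_def by (rule open_Compl[OF closed_closure])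
  show "\<eta> t = 0" by (rule z[OF tC, symmetric])
  have "((\<lambda>_. 0) has_real_derivative 0) (at t)" by simp
  then have "(\<eta> has_real_derivative 0) (at t)"
    by (rule has_field_derivative_transform_within_open[OF _ oC tC z])
  then show "deriv \<eta> t = 0" by (rule DERIV_imp_deriv)
qed

lemma time_primitive_of_time_deriv:
  assumes uv: "has_time_deriv u v"
    and U: "loc_sq_int U" "AE x in lborel. AE t in lborel. 0 \<le> t \<longrightarrow> u t x = U (t, x)"
    and V: "loc_sq_int V" "AE x in lborel. AE t in lborel. 0 \<le> t \<longrightarrow> v t x = V (t, x)"
  shows "time_primitive U V"
  unfolding time_primitive_def
proof (intro conjI U V)
  note [measurable] = loc_sq_int_measurable[OF U(1)] loc_sq_int_measurable[OF V(1)]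
  obtain H where H: "countable H" "H \<subseteq> test_functions {0<..}"
    "\<And>(f::real \<Rightarrow> complex) g. \<forall>t. set_integrable lborel {0..t} f \<Longrightarrow> \<forall>t. set_integrable lborel {0..t} g \<Longrightarrow>
        \<forall>\<eta>\<in>H. (LBINT t. deriv \<eta> t *\<^sub>R f t) = - (LBINT t. \<eta> t *\<^sub>R g t) \<Longrightarrow>
        \<exists>c. AE t in lborel. 0 < t \<longrightarrow> f t = c + (LBINT r:{0..t}. g r)"
    using du_bois_reymond_family[of 0, where ?'a = complex] by blast
  have "AE x in lborel. \<forall>\<eta>\<in>H. (LINT t|lebesgue_on {0..}. deriv \<eta> t *\<^sub>R u t x) = - (LINT t|lebesgue_on {0..}. \<eta> t *\<^sub>R v t x)"
    using uv H(1,2) unfolding has_time_deriv_def by (auto simp: AE_ball_countable AE_completion_iff)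
  then show "AE x in lborel. \<exists>c. AE t in lborel. 0 < t \<longrightarrow> U (t, x) = c + (LBINT s:{0..t}. V (s, x))"
    using U(2) V(2) loc_sq_int_time_slice[OF U(1)] loc_sq_int_time_slice[OF V(1)]
  proof eventually_elim
    case (elim x)
    \<comment> \<open>A test function supported in positive times extends the integral over the
      half-line to the whole line, where the Borel representative may replace the original
      function.\<close>
    have tr: "(LINT t|lebesgue_on {0..}. \<theta> t *\<^sub>R f t) = (LBINT t. \<theta> t *\<^sub>R f' t)"
      if "AE t in lborel. 0 \<le> t \<longrightarrow> f t = f' t" and z: "\<And>t. t < 0 \<Longrightarrow> \<theta> t = 0"
        and [measurable]: "\<theta> \<in> borel_measurable borel" "f' \<in> borel_measurable borel"
      for \<theta> :: "real \<Rightarrow> real" and f f' :: "real \<Rightarrow> complex"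
    proof -
      have "(LINT t|lebesgue_on {0..}. \<theta> t *\<^sub>R f t) = (LINT t|lebesgue. indicator {0..} t *\<^sub>R (\<theta> t *\<^sub>R f t))"
        by (rule integral_restrict_space) auto
      also have "\<dots> = (LBINT t. \<theta> t *\<^sub>R f' t)"
      proof (rule integral_completion_AE(1))
        show "AE t in lborel. indicat_real {0..} t *\<^sub>R \<theta> t *\<^sub>R f t = \<theta> t *\<^sub>R f' t"
          using that(1) by eventually_elim (use z in \<open>auto simp: indicator_def not_le\<close>)
      qed measurable
      finally show ?thesis .
    qed
    show ?case
    proof (rule H(3))
      show "\<forall>\<eta>\<in>H. (LBINT t. deriv \<eta> t *\<^sub>R U (t, x)) = - (LBINT t. \<eta> t *\<^sub>R V (t, x))"
      proof
        fix \<eta> assume \<eta>: "\<eta> \<in> H"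
        then have \<eta>': "\<eta> \<in> test_functions {0<..}" using H(2) by auto
        note [measurable] = test_function_measurable[OF \<eta>']
        have "(LINT t|lebesgue_on {0..}. deriv \<eta> t *\<^sub>R u t x) = (LBINT t. deriv \<eta> t *\<^sub>R U (t, x))"
          by (rule tr) (use elim(2) test_function_vanish[OF \<eta>'] in auto)
        moreover have "(LINT t|lebesgue_on {0..}. \<eta> t *\<^sub>R v t x) = (LBINT t. \<eta> t *\<^sub>R V (t, x))"
          by (rule tr) (use elim(3) test_function_vanish[OF \<eta>'] in auto)
        ultimately show "(LBINT t. deriv \<eta> t *\<^sub>R U (t, x)) = - (LBINT t. \<eta> t *\<^sub>R V (t, x))"
          using elim(1) \<eta> by auto
      qed
    qed (use elim in auto)
  qed
qed

text \<open>Each bounded interval yields measurability of a truncation only; their pointwise limit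
  is measurable on the half-line, so a single Borel representative serves all
  \<open>T\<close>.\<close>

lemma lebesgue_on_Icc_borel_rep:
  fixes m :: "real \<Rightarrow> real"
  assumes "\<And>T. 0 < T \<Longrightarrow> integrable (lebesgue_on {0..T}) m"
  obtains m' where "\<And>T. set_integrable lborel {0..T} m'" "AE t in lborel. 0 \<le> t \<longrightarrow> m t = m' t"
proof -
  have i: "integrable lebesgue (\<lambda>t. indicator {0..T} t *\<^sub>R m t)" if "0 < T" for T
    using assms[OF that] by (subst (asm) integrable_restrict_space) auto
  have "(\<lambda>t. indicator {0..} t *\<^sub>R m t) \<in> borel_measurable lebesgue"
  proof (rule borel_measurable_LIMSEQ_metric)
    show "(\<lambda>t. indicator {0..real (Suc n)} t *\<^sub>R m t) \<in> borel_measurable lebesgue" for n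
      using i[of "real (Suc n)"] by auto
    show "(\<lambda>n. indicator {0..real (Suc n)} t *\<^sub>R m t) \<longlonglongrightarrow> indicator {0..} t *\<^sub>R m t" for t
    proof (rule tendsto_eventually)
      obtain N :: nat where N: "t \<le> real N" using real_arch_simple by blast
      have "indicator {0..real (Suc n)} t *\<^sub>R m t = indicator {0..} t *\<^sub>R m t" if "N \<le> n" for n
        using that N by (auto simp: indicator_def)
      then show "\<forall>\<^sub>F n in sequentially. indicator {0..real (Suc n)} t *\<^sub>R m t = indicator {0..} t *\<^sub>R m t"
        by (rule eventually_sequentiallyI)
    qed
  qed
  then obtain m' where m': "m' \<in> borel_measurable lborel" "AE t in lborel. indicator {0..} t *\<^sub>R m t = m' t"
    using completion_ex_borel_measurable_real by blast
  note [measurable] = m'(1)[unfolded measurable_lborel2]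
  show ?thesis
  proof (rule that[of m'])
    show "set_integrable lborel {0..T} m'" for T
    proof -
      have e: "AE t in lborel. indicator {0..max T 1} t *\<^sub>R m t = indicator {0..max T 1} t *\<^sub>R m' t"
        using m'(2) by eventually_elim (auto simp: indicator_def split: if_splits)
      have mm: "(\<lambda>t. indicator {0..max T 1} t *\<^sub>R m' t) \<in> borel_measurable lborel" by measurable
      have "set_integrable lborel {0..max T 1} m'"
        using i[of "max T 1"] unfolding set_integrable_def integral_completion_AE(2)[OF mm e] by simp
      then show ?thesis by (rule set_integrable_Icc) auto
    qed
    show "AE t in lborel. 0 \<le> t \<longrightarrow> m t = m' t" using m'(2) by eventually_elim auto
  qed
qed

lemma lebesgue_on_Ici_borel_rep:
  fixes m :: "real \<Rightarrow> real"
  assumes "integrable (lebesgue_on {0..}) m"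
  obtains m' where "set_integrable lborel {0..} m'" "AE t in lborel. 0 \<le> t \<longrightarrow> m t = m' t"
proof -
  have i: "integrable lebesgue (\<lambda>t. indicator {0..} t *\<^sub>R m t)"
    using assms by (subst (asm) integrable_restrict_space) auto
  then obtain m' where m': "m' \<in> borel_measurable lborel" "AE t in lborel. indicator {0..} t *\<^sub>R m t = m' t"
    using completion_ex_borel_measurable_real[of "\<lambda>t. indicator {0..} t *\<^sub>R m t" lborel] by blast
  have m'i: "integrable lborel m'" using i unfolding integral_completion_AE(2)[OF m'] .
  show ?thesis
  proof (rule that[of m'])
    show "set_integrable lborel {0..} m'"
      unfolding set_integrable_def by (intro integrable_mult_indicator m'i) auto
    show "AE t in lborel. 0 \<le> t \<longrightarrow> m t = m' t" using m'(2) by eventually_elim auto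
  qed
qed

text \<open>A violation at \<open>t\<close> would persist on some interval to the right of
  \<open>t\<close>, which has positive measure.\<close>

lemma continuous_AE_le:
  fixes G :: "real \<Rightarrow> real"
  assumes G: "\<And>b. continuous_on {T..b} G" and ae: "AE t in lborel. T < t \<longrightarrow> G t \<le> e" and t: "T \<le> t"
  shows "G t \<le> e"
proof (rule ccontr)
  assume "\<not> G t \<le> e"
  then have "0 < G t - e" "t \<in> {T..t+1}" using t by auto
  then obtain d where d: "0 < d" "\<And>s. s \<in> {T..t+1} \<Longrightarrow> dist s t < d \<Longrightarrow> dist (G s) (G t) < G t - e"
    using G[of "t+1"] unfolding continuous_on_iff by blast
  define r where "r = min d 1"
  have r: "0 < r" "r \<le> d" "r \<le> 1" using d by (auto simp: r_def)
  have "AE s in lborel. s \<notin> {t<..<t+r}"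
    using ae
  proof eventually_elim
    case (elim s)
    show ?case
    proof
      assume s: "s \<in> {t<..<t+r}"
      then have "dist (G s) (G t) < G t - e" using d(2)[of s] r t by (auto simp: dist_real_def)
      then show False using elim s t by (auto simp: dist_real_def)
    qed
  qed
  then have "emeasure lborel {t<..<t+r} = 0"
    by (subst (asm) AE_iff_measurable[of "{t<..<t+r}"]) auto
  then show False using r by simp
qed

text \<open>The equation at one fixed time: \<open>V\<close>, \<open>g\<close>, \<open>k\<close>
  stand for \<open>u_t\<close>, \<open>u_x\<close>, \<open>u_xx\<close>, and \<open>al\<close>,
  \<open>ph\<close>, \<open>L\<close> for \<open>a t\<close>, \<open>\<phi> t\<close> and the
  ellipticity constant. Both bounds come from inserting \<open>V = f + al k\<close> and using
  \<open>\<langle>k, U\<rangle> = - B\<close>.\<close>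

lemma frequency_inequalities:
  fixes U V g k :: "real \<Rightarrow> complex"
  assumes U: "sq_int U" and V: "sq_int V" and g: "sq_int g" and k: "sq_int k"
    and Ug: "ac_deriv U g" and gk: "ac_deriv g k"
    and al: "1 \<le> L" "inverse L \<le> al" "al \<le> L" and ph: "0 \<le> ph"
    and F: "sq_norm (\<lambda>x. V x - al *\<^sub>R k x) \<le> ph * (sq_norm U + sq_norm g)"
  defines "p \<equiv> 2 * (LBINT x. U x \<bullet> V x)" and "q \<equiv> - 2 * (LBINT x. k x \<bullet> V x)"
  shows "q * sq_norm U - sq_norm g * p \<le> ((1 + L) * ph) * (sq_norm U + sq_norm g) * sq_norm U"
    and "- ((2 * L + 1 + (1 + L) * ph) * (sq_norm U + sq_norm g)) \<le> p"
proof -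
  define f where "f x = 1 *\<^sub>R V x + (- al) *\<^sub>R k x" for x
  have f: "sq_int f" unfolding f_def by (rule sq_int_lincomb(1)[OF V k])
  define A B C Fn where "A = sq_norm U" and "B = sq_norm g" and "C = sq_norm k" and "Fn = sq_norm f"
  have pos: "0 \<le> A" "0 \<le> B" "0 \<le> C" "0 \<le> Fn" unfolding A_def B_def C_def Fn_def by (rule sq_norm_nonneg)+
  have Fn: "Fn \<le> ph * (A + B)" using F unfolding Fn_def f_def A_def B_def by simp
  have al0: "0 < al" using al by (meson less_le_trans inverse_positive_iff_positive zero_less_one)
  have kU: "(LBINT x. k x \<bullet> U x) = - B" unfolding B_def by (rule inner_second_deriv[OF U g k Ug gk])
  have Vx: "V x = f x + al *\<^sub>R k x" for x unfolding f_def by simp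
  have ip: "(LBINT x. w x \<bullet> V x) = (LBINT x. w x \<bullet> f x) + al * (LBINT x. w x \<bullet> k x)"
    if w: "sq_int w" for w :: "real \<Rightarrow> complex"
    unfolding Vx inner_add_right inner_scaleR_right
    using sq_int_inner[OF w f] sq_int_inner[OF w k] by simp
  define a b where "a = (LBINT x. U x \<bullet> f x)" and "b = (LBINT x. k x \<bullet> f x)"
  have p: "p = 2 * a - 2 * al * B"
    unfolding p_def ip[OF U] a_def using kU by (simp add: inner_commute)
  have q: "q = - 2 * b - 2 * al * C"
    unfolding q_def ip[OF k] b_def C_def sq_norm_def by (simp add: power2_norm_eq_inner)
  have a: "2 * \<bar>a\<bar> \<le> A + Fn"
    using abs_inner_integral_le[OF U f, of 1] unfolding a_def A_def Fn_def by simp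
  show "- ((2 * L + 1 + (1 + L) * ph) * (sq_norm U + sq_norm g)) \<le> p"
  proof -
    have "- (A + Fn) - 2 * al * B \<le> p" using a unfolding p by linarith
    moreover have "A + Fn + 2 * al * B \<le> (2 * L + 1 + (1 + L) * ph) * (A + B)"
    proof -
      have "2 * al * B \<le> 2 * L * (A + B)" using al al0 pos by (intro mult_mono) auto
      moreover have "0 \<le> L * (ph * (A + B))" using al ph pos by (intro mult_nonneg_nonneg) auto
      ultimately show ?thesis using Fn pos by (simp add: algebra_simps)
    qed
    ultimately show ?thesis unfolding A_def B_def by linarith
  qed
  have "q * A - B * p \<le> ((1 + L) * ph) * (A + B) * A"
  proof (cases "A = 0")
    case True
    \<comment> \<open>If \<open>U\<close> vanishes in \<open>L2\<close>, so does \<open>g\<close>,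
      since \<open>B = - \<langle>k, U\<rangle>\<close>. The weight \<open>e / (C + 1)\<close> makes
      the remaining term at most \<open>e\<close>; the added 1 covers \<open>C = 0\<close>.\<close>
    have "B \<le> 0"
    proof (rule field_le_epsilon)
      fix e :: real assume e: "0 < e"
      have "2 * \<bar>LBINT x. k x \<bullet> U x\<bar> \<le> (e / (C + 1)) * C + A / (e / (C + 1))"
        unfolding C_def A_def by (rule abs_inner_integral_le[OF k U]) (use e pos in \<open>auto simp: C_def\<close>)
      then have "2 * B \<le> (e / (C + 1)) * C" using kU True pos by simp
      also have "\<dots> \<le> e" using e pos by (simp add: field_simps)
      finally show "B \<le> 0 + e" using pos by simp
    qed
    then show ?thesis using True pos by simp
  next
    case False
    then have A: "0 < A" using pos by simp
    define w where "w x = A *\<^sub>R k x + B *\<^sub>R U x" for x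
    have w: "sq_int w" unfolding w_def by (rule sq_int_lincomb(1)[OF k U])
    have wn: "sq_norm w = A * (A * C - B\<^sup>2)"
      unfolding w_def sq_int_lincomb(2)[OF k U] kU C_def[symmetric] A_def[symmetric]
      by (simp add: power2_eq_square algebra_simps)
    have wf: "(LBINT x. w x \<bullet> f x) = A * b + B * a"
      unfolding w_def inner_add_left inner_scaleR_left a_def b_def
      using sq_int_inner[OF k f] sq_int_inner[OF U f] by simp
    \<comment> \<open>The weight \<open>2 * al / A\<close> turns
      \<open>sq_norm w = A * (A * C - B^2)\<close> into exactly the term that the equation supplies
      with the opposite sign.\<close>
    have "2 * \<bar>A * b + B * a\<bar> \<le> (2 * al / A) * sq_norm w + Fn / (2 * al / A)"
      unfolding wf[symmetric] Fn_def by (rule abs_inner_integral_le[OF w f]) (use al0 A in auto)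
    also have "\<dots> = 2 * al * (A * C - B\<^sup>2) + Fn * A / (2 * al)"
      unfolding wn using A al0 by (simp add: field_simps)
    finally have "2 * \<bar>A * b + B * a\<bar> \<le> 2 * al * (A * C - B\<^sup>2) + Fn * A / (2 * al)" .
    moreover have "- 2 * X \<le> 2 * \<bar>X\<bar>" for X :: real by simp
    ultimately have 1: "- 2 * (A * b + B * a) \<le> 2 * al * (A * C - B\<^sup>2) + Fn * A / (2 * al)"
      by (rule order_trans[rotated])
    have "q * A - B * p = - 2 * (A * b + B * a) - 2 * al * (A * C - B\<^sup>2)"
      unfolding p q by (simp add: algebra_simps power2_eq_square)
    also have "\<dots> \<le> Fn * A / (2 * al)" using 1 by linarith
    also have "\<dots> = Fn * A * (inverse al / 2)" by (simp add: field_simps)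
    \<comment> \<open>Ellipticity gives \<open>inverse al / 2 \<le> L / 2\<close>; the larger
      \<open>1 + L\<close> is also sufficient for the lower bound on \<open>p\<close>.\<close>
    also have "\<dots> \<le> (ph * (A + B) * A) * (1 + L)"
    proof (rule mult_mono)
      show "Fn * A \<le> ph * (A + B) * A" using Fn A by (intro mult_right_mono) auto
      have "inverse al \<le> inverse (inverse L)" using al by (intro le_imp_inverse_le) auto
      then show "inverse al / 2 \<le> 1 + L" using al by simp
    qed (use pos ph al0 in auto)
    finally show ?thesis by (simp add: mult_ac)
  qed
  then show "q * sq_norm U - sq_norm g * p \<le> ((1 + L) * ph) * (sq_norm U + sq_norm g) * sq_norm U"
    unfolding A_def B_def .
qed

theorem theorem1:
  fixes \<Lambda>\<^sub>0 :: real
    and a \<phi> \<mu> \<psi> :: "real \<Rightarrow> real"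
    and u :: "real \<Rightarrow> real \<Rightarrow> complex"
  assumes "\<Lambda>\<^sub>0 \<ge> 1"
    and "continuous_on {0..} a"
    and "\<forall>t\<ge>0. inverse \<Lambda>\<^sub>0 \<le> a t \<and> a t \<le> \<Lambda>\<^sub>0"
    and "AE t in lebesgue_on {0..}. \<phi> t > 0"
    and "integrable (lebesgue_on {0..}) \<phi>"
    and "modulus_of_continuity \<mu>"
    and "osgood \<mu>"
    and "AE t in lebesgue_on {0..}. \<psi> t > 0"
    and "integrable (lebesgue_on {0..}) \<psi>"
    and "\<exists>C. AE t in lebesgue_on {0..}. \<bar>\<psi> t\<bar> \<le> C"
    and "AE t in lebesgue_on {0..}. local_modulus_quotient \<mu> a t \<le> ennreal (\<psi> t)"
    and "u \<in> L2_loc_sobolev 2 \<inter> H1_loc_L2"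
    and "AE t in lebesgue_on {0..}.
           (L2_norm (\<lambda>x. time_deriv u t x - a t *\<^sub>R weak_deriv (weak_deriv (u t)) x))\<^sup>2
             \<le> \<phi> t * (sobolev_norm 1 (u t))\<^sup>2"
    and "\<forall>r>0. ((\<lambda>t. exp (r * t) * sobolev_norm 1 (u t)) \<longlongrightarrow> 0) at_top"
  shows "AE (t, x) in lebesgue_on ({0..} \<times> UNIV). u t x = 0"
proof -
  let ?L = "\<Lambda>\<^sub>0"
  define v where "v = time_deriv u"
  have uv: "has_time_deriv u v"
    unfolding v_def time_deriv_def by (rule someI_ex[of "has_time_deriv u"]) (use assms(12) in \<open>auto simp: H1_loc_L2_def\<close>)
  have u2: "u \<in> L2_loc_sobolev 2" using assms(12) by simp
  have u0: "u \<in> L2_loc_sobolev 0" and v0: "v \<in> L2_loc_sobolev 0" using uv by (auto simp: has_time_deriv_def)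
  have um: "(\<lambda>(t, x). u t x) \<in> borel_measurable (lebesgue_on ({0..} \<times> UNIV))"
    and vm: "(\<lambda>(t, x). v t x) \<in> borel_measurable (lebesgue_on ({0..} \<times> UNIV))"
    using u0 v0 unfolding L2_loc_sobolev_def by blast+
  obtain U where U: "U \<in> borel_measurable (borel \<Otimes>\<^sub>M borel)"
    "AE t in lborel. 0 \<le> t \<longrightarrow> borel_rep (u t) (\<lambda>x. U (t, x))"
    "AE x in lborel. AE t in lborel. 0 \<le> t \<longrightarrow> u t x = U (t, x)"
    "AE p in lborel. 0 \<le> fst p \<longrightarrow> u (fst p) (snd p) = U p"
    by (rule borel_rep_joint[OF um])
  obtain V where V: "V \<in> borel_measurable (borel \<Otimes>\<^sub>M borel)"
    "AE t in lborel. 0 \<le> t \<longrightarrow> borel_rep (v t) (\<lambda>x. V (t, x))"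
    "AE x in lborel. AE t in lborel. 0 \<le> t \<longrightarrow> v t x = V (t, x)"
    by (rule borel_rep_joint[OF vm])
  have Usq: "loc_sq_int U" by (rule loc_sq_int_of_L2_loc[OF u0 U(1,2)])
  have Vsq: "loc_sq_int V" by (rule loc_sq_int_of_L2_loc[OF v0 V(1,2)])
  have UV: "time_primitive U V" by (rule time_primitive_of_time_deriv[OF uv Usq U(3) Vsq V(3)])
  define g where "g t = (SOME g'. borel_rep (weak_deriv (u t)) g')" for t
  define k where "k t = (SOME k'. borel_rep (weak_deriv (weak_deriv (u t))) k')" for t
  let ?U = "\<lambda>t x. U (t, x)" and ?V = "\<lambda>t x. V (t, x)"
  have sob: "AE t in lborel. 0 \<le> t \<longrightarrow> u t \<in> sobolev 2"
    using u2 unfolding L2_loc_sobolev_def by (auto simp: AE_lebesgue_on_Ici)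
  have slice: "AE t in lborel. 0 \<le> t \<longrightarrow>
      borel_rep (u t) (?U t) \<and> borel_rep (v t) (?V t) \<and>
      borel_rep (weak_deriv (u t)) (g t) \<and> borel_rep (weak_deriv (weak_deriv (u t))) (k t) \<and>
      sq_int (?U t) \<and> sq_int (?V t) \<and> sq_int (g t) \<and> sq_int (k t) \<and>
      ac_deriv (?U t) (g t) \<and> ac_deriv (g t) (k t) \<and>
      (sobolev_norm 1 (u t))\<^sup>2 = sq_norm (?U t) + sq_norm (g t) \<and>
      sq_norm (k t) \<le> (sobolev_norm 2 (u t))\<^sup>2" (is "AE t in lborel. 0 \<le> t \<longrightarrow> ?R t")
    using sob U(2) V(2) loc_sq_int_slice[OF Vsq]
  proof eventually_elim
    case (elim t)
    show ?case
    proof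
      assume t: "0 \<le> t"
      note s = sobolev_2D[OF elim(1)[rule_format, OF t]]
      have r: "borel_rep (u t) (?U t)" "borel_rep (v t) (?V t)" using elim t by auto
      have rg: "borel_rep (weak_deriv (u t)) (g t)"
        unfolding g_def by (rule someI_ex[OF borel_rep_exists[OF L2_measurable[OF s(2)]]])
      have rk: "borel_rep (weak_deriv (weak_deriv (u t))) (k t)"
        unfolding k_def by (rule someI_ex[OF borel_rep_exists[OF L2_measurable[OF s(3)]]])
      have "sq_int (?U t)" "sq_int (g t)" "sq_int (k t)"
        using L2_borel_rep(1)[OF r(1)] L2_borel_rep(1)[OF rg] L2_borel_rep(1)[OF rk] s by auto
      moreover note r rg rk has_weak_deriv_diffq[OF s(4) r(1) rg] has_weak_deriv_diffq[OF s(5) rg rk]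
      moreover have "sq_int (?V t)" using elim t by auto
      moreover have "(sobolev_norm 1 (u t))\<^sup>2 = sq_norm (?U t) + sq_norm (g t)"
        unfolding sobolev_norm_eqs L2_borel_rep(2)[OF r(1)] L2_borel_rep(2)[OF rg] ..
      moreover have "sq_norm (k t) \<le> (sobolev_norm 2 (u t))\<^sup>2"
        unfolding sobolev_norm_eqs L2_borel_rep(2)[OF r(1)] L2_borel_rep(2)[OF rg] L2_borel_rep(2)[OF rk]
        using sq_norm_nonneg[of "\<lambda>x. U (t, x)"] sq_norm_nonneg[of "g t"] by simp
      ultimately show "?R t" by blast
    qed
  qed
  \<comment> \<open>The \<open>H2\<close> regularity of \<open>u\<close> enters as a locally
    integrable majorant of \<open>sq_norm (k t)\<close>.\<close>
  obtain m where m: "\<And>T. set_integrable lborel {0..T} m" "AE t in lborel. 0 \<le> t \<longrightarrow> (sobolev_norm 2 (u t))\<^sup>2 = m t"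
    by (rule lebesgue_on_Icc_borel_rep[of "\<lambda>t. (sobolev_norm 2 (u t))\<^sup>2"])
      (use u2 in \<open>auto simp: L2_loc_sobolev_def\<close>)
  have mk: "AE t in lborel. 0 \<le> t \<longrightarrow> sq_norm (k t) \<le> m t"
    using slice m(2) by eventually_elim auto
  have reg: "AE t in lborel. 0 \<le> t \<longrightarrow> sq_int (g t) \<and> sq_int (k t) \<and> ac_deriv (?U t) (g t) \<and> ac_deriv (g t) (k t)"
    using slice by eventually_elim auto
  define P where "P t = 2 * (LBINT x. U (t, x) \<bullet> V (t, x))" for t
  have Pi: "set_integrable lborel {0..T} P" for T unfolding P_def by (rule energy_identity(1)[OF UV])
  obtain C1 where C1: "AE t in lborel. 0 < t \<longrightarrow> sq_norm (?U t) = C1 + (LBINT s:{0..t}. P s)"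
    using energy_identity(2)[OF UV] unfolding P_def by blast
  obtain Q C2 where Q: "\<And>T. set_integrable lborel {0..T} Q"
    "AE t in lborel. 0 \<le> t \<longrightarrow> Q t = - 2 * (LBINT x. k t x \<bullet> V (t, x))"
    and C2: "AE t in lborel. 0 < t \<longrightarrow> sq_norm (g t) = C2 + (LBINT s:{0..t}. Q s)"
    using second_energy_identity[OF UV reg m(1) mk] by blast
  \<comment> \<open>\<open>A\<close> and \<open>B\<close> are the continuous representatives of
    \<open>\<parallel>u\<parallel>^2\<close> and \<open>\<parallel>u_x\<parallel>^2\<close>; they
    agree with the norms only for almost every \<open>t\<close>, so pointwise facts are transferred
    by continuity.\<close>
  define A where "A t = C1 + (LBINT s:{0..t}. P s)" for t
  define B where "B t = C2 + (LBINT s:{0..t}. Q s)" for t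
  have A: "ac_from 0 A P"
    using ac_from_add[OF ac_from_const ac_from_integral[OF Pi]] unfolding A_def by simp
  have B: "ac_from 0 B Q"
    using ac_from_add[OF ac_from_const ac_from_integral[OF Q(1)]] unfolding B_def by simp
  have nonneg: "0 \<le> X t" if X: "ac_from 0 X X'" and ae: "AE t in lborel. 0 < t \<longrightarrow> 0 \<le> X t" and t: "0 \<le> t"
    for X X' :: "real \<Rightarrow> real" and t
  proof -
    have "- X t \<le> 0"
      by (rule continuous_AE_le[where T=0, OF _ _ t]) (use ae ac_from_continuous[OF X] in \<open>auto intro: continuous_on_minus\<close>)
    then show ?thesis by simp
  qed
  have A0: "0 \<le> A t" if "0 \<le> t" for t
    by (rule nonneg[OF A _ that]) (use C1 in \<open>eventually_elim, metis A_def sq_norm_nonneg\<close>)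
  have B0: "0 \<le> B t" if "0 \<le> t" for t
    by (rule nonneg[OF B _ that]) (use C2 in \<open>eventually_elim, metis B_def sq_norm_nonneg\<close>)
  obtain \<phi>' where \<phi>': "set_integrable lborel {0..} \<phi>'" "AE t in lborel. 0 \<le> t \<longrightarrow> \<phi> t = \<phi>' t"
    using lebesgue_on_Ici_borel_rep[OF assms(5)] by blast
  \<comment> \<open>\<open>\<phi>\<close> is positive only almost everywhere; the absolute value
    makes \<open>\<kappa>\<close> non-negative at every time, as the locale asks.\<close>
  define \<kappa> where "\<kappa> t = (1 + ?L) * \<bar>\<phi>' t\<bar>" for t
  have ineq: "AE t in lborel. 0 \<le> t \<longrightarrow>
     Q t * A t - B t * P t \<le> \<kappa> t * (A t + B t) * A t \<and> - ((2 * ?L + 1 + \<kappa> t) * (A t + B t)) \<le> P t"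
    (is "AE t in lborel. 0 \<le> t \<longrightarrow> ?R t")
    using slice C1 C2 Q(2) \<phi>'(2) assms(4)[unfolded AE_lebesgue_on_Ici] assms(13)[unfolded AE_lebesgue_on_Ici] AE_lborel_singleton[of 0]
  proof eventually_elim
    case (elim t)
    show ?case
    proof
      assume t: "0 \<le> t"
      then have t': "0 < t" using elim(8) by simp
      have sl: "borel_rep (v t) (?V t)" "borel_rep (weak_deriv (weak_deriv (u t))) (k t)"
        "sq_int (?U t)" "sq_int (?V t)" "sq_int (g t)" "sq_int (k t)"
        "ac_deriv (?U t) (g t)" "ac_deriv (g t) (k t)"
        "(sobolev_norm 1 (u t))\<^sup>2 = sq_norm (?U t) + sq_norm (g t)"
        using elim(1) t by auto
      have AB: "sq_norm (?U t) = A t" "sq_norm (g t) = B t"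
        using elim(2,3) t' by (auto simp: A_def B_def)
      have ph: "0 < \<phi> t" "\<bar>\<phi>' t\<bar> = \<phi> t" using elim(5,6) t by auto
      have rf: "borel_rep (\<lambda>x. time_deriv u t x - a t *\<^sub>R weak_deriv (weak_deriv (u t)) x) (\<lambda>x. V (t, x) - a t *\<^sub>R k t x)"
      proof -
        have "AE x in lborel. v t x = V (t, x)" "AE x in lborel. weak_deriv (weak_deriv (u t)) x = k t x"
          using sl(1,2) by (auto simp: borel_rep_def)
        then have "AE x in lborel. time_deriv u t x - a t *\<^sub>R weak_deriv (weak_deriv (u t)) x = V (t, x) - a t *\<^sub>R k t x"
          by eventually_elim (simp add: v_def)
        then show ?thesis using sl(4,6) by (auto simp: borel_rep_def sq_int_def)
      qed
      have F: "sq_norm (\<lambda>x. V (t, x) - a t *\<^sub>R k t x) \<le> \<phi> t * (sq_norm (?U t) + sq_norm (g t))"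
        using elim(7) t unfolding L2_borel_rep(2)[OF rf] sl(9) by simp
      have al: "inverse ?L \<le> a t" "a t \<le> ?L" using assms(3) t by auto
      note fi = frequency_inequalities[OF sl(3-8) assms(1) al order.strict_implies_order[OF ph(1)] F, folded P_def, unfolded AB]
      have "Q t = - 2 * (LBINT x. k t x \<bullet> V (t, x))" using elim(4) t by simp
      then show "?R t"
        using fi unfolding \<kappa>_def ph(2) by simp
    qed
  qed
  interpret frequency_ode A B P Q \<kappa> "2 * ?L + 1"
  proof
    show "set_integrable lborel {0..} \<kappa>"
      unfolding \<kappa>_def using set_integrable_abs[OF \<phi>'(1)] by simp
    show "0 \<le> \<kappa> t" "0 \<le> 2 * ?L + 1" for t using assms(1) by (auto simp: \<kappa>_def)
    show "AE t in lborel. 0 \<le> t \<longrightarrow> Q t * A t - B t * P t \<le> \<kappa> t * (A t + B t) * A t"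
      using ineq by eventually_elim auto
    show "AE t in lborel. 0 \<le> t \<longrightarrow> - ((2 * ?L + 1 + \<kappa> t) * (A t + B t)) \<le> P t"
      using ineq by eventually_elim auto
  qed (fact A B A0 B0)+
  have decay: "((\<lambda>t. exp (r * t) * A t) \<longlongrightarrow> 0) at_top" for r
  proof (rule tendstoI)
    fix e :: real assume e: "0 < e"
    \<comment> \<open>The assumed decay concerns positive rates and the norm itself, whereas
      \<open>A\<close> is bounded by the square of the norm; hence \<open>max r 1\<close> and the
      halved rate.\<close>
    define r' where "r' = max r 1"
    have "((\<lambda>t. exp (r' / 2 * t) * sobolev_norm 1 (u t)) \<longlongrightarrow> 0) at_top"
      by (rule assms(14)[rule_format]) (simp add: r'_def)
    then have "((\<lambda>t. (exp (r' / 2 * t) * sobolev_norm 1 (u t))\<^sup>2) \<longlongrightarrow> 0\<^sup>2) at_top" by (rule tendsto_power)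
    then have "\<forall>\<^sub>F t in at_top. (exp (r' / 2 * t) * sobolev_norm 1 (u t))\<^sup>2 < e / 2"
      by (rule order_tendstoD(2)) (use e in simp)
    then obtain T0 where T0: "\<And>t. T0 \<le> t \<Longrightarrow> (exp (r' / 2 * t) * sobolev_norm 1 (u t))\<^sup>2 < e / 2"
      unfolding eventually_at_top_linorder by blast
    define T where "T = max T0 0"
    \<comment> \<open>The estimate is known for almost every \<open>t\<close> and passes to every
      \<open>t\<close> by continuity as a weak inequality; \<open>e / 2\<close> leaves room for the
      strict one.\<close>
    have "exp (r * t) * A t \<le> e / 2" if t: "T \<le> t" for t
    proof (rule continuous_AE_le[OF _ _ t])
      have "continuous_on {0..b} A" for b by (rule ac_from_continuous[OF A])
      then show "continuous_on {T..b} (\<lambda>t. exp (r * t) * A t)" for b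
        by (intro continuous_intros) (auto intro: continuous_on_subset[of "{0..b}"] simp: T_def)
      show "AE t in lborel. T < t \<longrightarrow> exp (r * t) * A t \<le> e / 2"
        using slice C1
      proof eventually_elim
        case (elim t)
        show ?case
        proof
          assume t: "T < t"
          then have t0: "0 < t" "T0 \<le> t" by (auto simp: T_def)
          have "A t \<le> (sobolev_norm 1 (u t))\<^sup>2"
            using elim t0 sq_norm_nonneg[of "g t"] by (auto simp: A_def)
          moreover have "exp (r * t) \<le> (exp (r' / 2 * t))\<^sup>2"
            using t0 by (simp add: r'_def power2_eq_square exp_add[symmetric] mult_right_mono)
          ultimately have "exp (r * t) * A t \<le> (exp (r' / 2 * t))\<^sup>2 * (sobolev_norm 1 (u t))\<^sup>2"
            using A0[of t] t0 by (intro mult_mono) auto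
          also have "\<dots> < e / 2" using T0[OF t0(2)] by (simp add: power_mult_distrib)
          finally show "exp (r * t) * A t \<le> e / 2" by simp
        qed
      qed
    qed
    then have "dist (exp (r * t) * A t) 0 < e" if "T \<le> t" for t
      using that A0[of t] e by (fastforce simp: T_def abs_mult)
    then show "\<forall>\<^sub>F t in at_top. dist (exp (r * t) * A t) 0 < e"
      unfolding eventually_at_top_linorder by blast
  qed
  \<comment> \<open>Stated for the Borel function \<open>U\<close>: its zero set is measurable, so
    the iterated statement implies the one in the plane, which is then carried over to
    \<open>u\<close>.\<close>
  have "AE t in lborel. AE x in lborel. 0 \<le> fst (t, x) \<longrightarrow> U (t, x) = 0"
    using slice C1 AE_lborel_singleton[of 0]
  proof eventually_elim
    case (elim t)
    show ?case
    proof (cases "0 \<le> t")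
      case True
      then have True: "0 < t" using elim(3) by simp
      then have "sq_norm (?U t) = 0" "sq_int (?U t)"
        using elim vanishes[OF decay, of t] by (auto simp: A_def)
      then have "AE x in lborel. (norm (U (t, x)))\<^sup>2 = 0"
        unfolding sq_norm_def sq_int_def by (subst (asm) integral_nonneg_eq_0_iff_AE) auto
      then show ?thesis by eventually_elim simp
    qed simp
  qed
  then have "AE p in lborel2. 0 \<le> fst p \<longrightarrow> U p = 0"
    using U(1) by (intro lborel_pair.AE_pair_measure) measurable
  then have "AE p in lborel. 0 \<le> fst p \<longrightarrow> u (fst p) (snd p) = 0"
    using U(4) unfolding lborel_prod by eventually_elim auto
  moreover have "({0..} \<times> UNIV :: (real \<times> real) set) \<inter> space lebesgue \<in> sets lebesgue"
    by (auto intro!: sets_completionI_sets borel_closed closed_Times)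
  ultimately show ?thesis
    by (auto simp: AE_restrict_space_iff AE_completion_iff case_prod_unfold mem_Times_iff)
qed

end
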